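(* Let $p\in(1,\infty)$, $s\in(0,1)$, $0<\alpha<sp<d$, $\mu\in(0,\mu_{d,s,p})$, and $f\in(\mathcal D^{s,p}(\mathbb R^d))^*$. Let $\{u_n\}\subset\mathcal D^{s,p}(\mathbb R^d)$ be a Palais-Smale sequence for $I_{\mu,\alpha,f}$ at level $\eta\in\mathbb R$. Then there exists a subsequence (still denoted $\{u_n\}$) for which the following holds: there exist $k\in\mathbb N\cup\{0\}$, sequences $\{r_n^i\}_n\subset(0,\infty)$ and functions $u,\tilde u_i\in\mathcal D^{s,p}(\mathbb R^d)$ ($1\le i\le k$) such that $u$ is a weak solution (with no sign assumption) of $$(-\Delta_p)^su-\mu\frac{|u|^{p-2}u}{|x|^{sp}}=\frac{|u|^{p_s^*(\alpha)-2}u}{|x|^\alpha}+f\quad\text{in }\mathbb R^d,$$ each $\tilde u_i\in\mathcal D^{s,p}(\mathbb R^d)\setminus\{0\}$ is a weak solution of $$(-\Delta_p)^s\tilde u_i-\mu\frac{|\tilde u_i|^{p-2}\tilde u_i}{|x|^{sp}}=\frac{|\tilde u_i|^{p_s^*(\alpha)-2}\tilde u_i}{|x|^\alpha}\quad\text{in }\mathbb R^d,$$ and: (a) $u_n=u+\sum_{i=1}^kC_{r_n^i}\tilde u_i+o_n(1)$, where $o_n(1)\to0$ in $\mathcal D^{s,p}(\mathbb R^d)$ as $n\to\infty$; (b) $\eta=I_{\mu,\alpha,f}(u)+\sum_{i=1}^kI_{\mu,\alpha,0}(\tilde u_i)$; (c) for each $i$, $r_n^i\to0$ or $r_n^i\to\infty$,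 and $\left|\log\left(r_n^i/r_n^j\right)\right|\to\infty$ for $i\ne j$, $1\le i,j\le k$. In the case $k=0$ there are no $\tilde u_i$ and $r_n^i$: properties (a) and (b) read $u_n=u+o_n(1)$ in $\mathcal D^{s,p}(\mathbb R^d)$ and $\eta=I_{\mu,\alpha,f}(u)$, and (c) is void.
   Context: $\mathcal D^{s,p}(\mathbb R^d)$ is the completion of $C_c^\infty(\mathbb R^d)$ under $[u]_{s,p}:=\left(\iint_{\mathbb R^d\times\mathbb R^d}\frac{|u(x)-u(y)|^p}{|x-y|^{d+sp}}\,dx\,dy\right)^{1/p}$; equivalently it is $\{u\in L^{p_s^*}(\mathbb R^d):[u]_{s,p}<\infty\}$ with $p_s^*=\frac{dp}{d-sp}$. $(\mathcal D^{s,p})^*$ is its dual, with pairing $\langle f,u\rangle$. $p_s^*(\alpha):=\frac{p(d-\alpha)}{d-sp}$. $\mu_{d,s,p}>0$ is the best constant in the fractional Hardy inequality $\mu_{d,s,p}\int_{\mathbb R^d}\frac{|u|^p}{|x|^{sp}}dx\le[u]_{s,p}^p$ for all $u\in\mathcal D^{s,p}(\mathbb R^d)$. For $u,\phi\in\mathcal D^{s,p}$ put $\mathcal A(u,\phi)=\iint\frac{|u(x)-u(y)|^{p-2}(u(x)-u(y))(\phi(x)-\phi(y))}{|x-y|^{d+sp}}dx\,dy$. A function $u\in\mathcal D^{s,p}$ is a weak solution of $(-\Delta_p)^su-\mu\frac{|u|^{p-2}u}{|x|^{sp}}=\frac{|u|^{p_s^*(\alpha)-2}u}{|x|^{\alpha}}+f$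 if for all $\phi\in\mathcal D^{s,p}$: $\mathcal A(u,\phi)-\mu\int\frac{|u|^{p-2}u}{|x|^{sp}}\phi\,dx=\int\frac{|u|^{p_s^*(\alpha)-2}u}{|x|^\alpha}\phi\,dx+\langle f,\phi\rangle$ (take $f=0$ for the homogeneous equation). Energy: $I_{\mu,\alpha,f}(u)=\frac1p[u]_{s,p}^p-\frac\mu p\int\frac{|u|^p}{|x|^{sp}}dx-\frac1{p_s^*(\alpha)}\int\frac{|u|^{p_s^*(\alpha)}}{|x|^\alpha}dx-\langle f,u\rangle$, a $C^1$ functional on $\mathcal D^{s,p}$. A Palais-Smale sequence for $I$ at level $\eta$ is $\{u_n\}$ with $I(u_n)\to\eta$ and $I'(u_n)\to0$ in $(\mathcal D^{s,p})^*$. For $r>0$: $C_ru(x):=r^{-\frac{d-sp}p}u(x/r)$. *)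

theory Defs
  imports "HOL-Analysis.Analysis"
begin

text \<open>
  The ambient space is a Euclidean space of dimension \<open>d = DIM('a)\<close>.  Elements of
  \<open>D\<^sup>s\<^sup>,\<^sup>p\<close> are represented by Borel functions; the seminorm identifies functions that
  agree almost everywhere.  Since \<open>0 powr a = 0\<close> and \<open>x / 0 = 0\<close>, all integrands below
  vanish on the null sets (origin, diagonal) where the kernels are singular, and
  \<open>\<bar>t\<bar> powr (p - 2) * t\<close> is \<open>0\<close> at \<open>t = 0\<close> also for \<open>p < 2\<close>.
\<close>

definition crit_exp :: "real \<Rightarrow> real \<Rightarrow> real \<Rightarrow> real \<Rightarrow> real" where
  "crit_exp d s p \<alpha> = p * (d - \<alpha>) / (d - s * p)"

definition gagliardo_energy :: "real \<Rightarrow> real \<Rightarrow> ('a::euclidean_space \<Rightarrow> real) \<Rightarrow> ennreal" where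
  "gagliardo_energy s p u =
     (\<integral>\<^sup>+ z. ennreal (\<bar>u (fst z) - u (snd z)\<bar> powr p
               / norm (fst z - snd z) powr (real DIM('a) + s * p)) \<partial>(lborel \<Otimes>\<^sub>M lborel))"

text \<open>Meaningful only when \<open>gagliardo_energy s p u\<close> is finite, in particular on \<open>Dsp s p\<close>.\<close>

definition gagliardo :: "real \<Rightarrow> real \<Rightarrow> ('a::euclidean_space \<Rightarrow> real) \<Rightarrow> real" where
  "gagliardo s p u = enn2real (gagliardo_energy s p u) powr (1 / p)"

definition Dsp :: "real \<Rightarrow> real \<Rightarrow> ('a::euclidean_space \<Rightarrow> real) set" where
  "Dsp s p = {u \<in> borel_measurable lborel.
      integrable lborel (\<lambda>x. \<bar>u x\<bar> powr crit_exp (real DIM('a)) s p 0)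
      \<and> gagliardo_energy s p u < \<infinity>}"

text \<open>Only the values of a functional on \<open>Dsp s p\<close> are relevant.\<close>

definition Dsp_dual :: "real \<Rightarrow> real \<Rightarrow> (('a::euclidean_space \<Rightarrow> real) \<Rightarrow> real) set" where
  "Dsp_dual s p = {L.
      (\<forall>u\<in>Dsp s p. \<forall>v\<in>Dsp s p. L (\<lambda>x. u x + v x) = L u + L v)
      \<and> (\<forall>c. \<forall>u\<in>Dsp s p. L (\<lambda>x. c * u x) = c * L u)
      \<and> (\<exists>C. \<forall>u\<in>Dsp s p. \<bar>L u\<bar> \<le> C * gagliardo s p u)}"

definition dual_norm :: "real \<Rightarrow> real \<Rightarrow> (('a::euclidean_space \<Rightarrow> real) \<Rightarrow> real) \<Rightarrow> real" where
  "dual_norm s p L = (SUP u\<in>{u \<in> Dsp s p. gagliardo s p u \<le> 1}. \<bar>L u\<bar>)"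

text \<open>
  The Hardy integral is taken in \<open>ennreal\<close>, so that an admissible constant \<open>m > 0\<close> forces
  it to be finite.
\<close>

definition hardy_const :: "'a::euclidean_space itself \<Rightarrow> real \<Rightarrow> real \<Rightarrow> real" where
  "hardy_const _ s p = Sup {m. 0 \<le> m \<and> (\<forall>u \<in> (Dsp s p :: ('a \<Rightarrow> real) set).
      ennreal m * (\<integral>\<^sup>+ x. ennreal (\<bar>u x\<bar> powr p / norm x powr (s * p)) \<partial>lborel)
        \<le> gagliardo_energy s p u)}"

definition frac_form ::
  "real \<Rightarrow> real \<Rightarrow> ('a::euclidean_space \<Rightarrow> real) \<Rightarrow> ('a \<Rightarrow> real) \<Rightarrow> real" where
  "frac_form s p u \<phi> =
     (LINT z|(lborel \<Otimes>\<^sub>M lborel).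
        \<bar>u (fst z) - u (snd z)\<bar> powr (p - 2) * (u (fst z) - u (snd z)) * (\<phi> (fst z) - \<phi> (snd z))
          / norm (fst z - snd z) powr (real DIM('a) + s * p))"

definition weak_solution ::
  "real \<Rightarrow> real \<Rightarrow> real \<Rightarrow> real \<Rightarrow> (('a::euclidean_space \<Rightarrow> real) \<Rightarrow> real) \<Rightarrow> ('a \<Rightarrow> real) \<Rightarrow> bool" where
  "weak_solution s p \<mu> \<alpha> f u \<longleftrightarrow> u \<in> Dsp s p \<and>
     (\<forall>\<phi>\<in>Dsp s p.
        frac_form s p u \<phi>
          - \<mu> * (LINT x|lborel. \<bar>u x\<bar> powr (p - 2) * u x / norm x powr (s * p) * \<phi> x)
        = (LINT x|lborel. \<bar>u x\<bar> powr (crit_exp (real DIM('a)) s p \<alpha> - 2) * u x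
              / norm x powr \<alpha> * \<phi> x)
          + f \<phi>)"

definition energy ::
  "real \<Rightarrow> real \<Rightarrow> real \<Rightarrow> real \<Rightarrow> (('a::euclidean_space \<Rightarrow> real) \<Rightarrow> real) \<Rightarrow> ('a \<Rightarrow> real) \<Rightarrow> real" where
  "energy s p \<mu> \<alpha> f u =
     1 / p * gagliardo s p u powr p
     - \<mu> / p * (LINT x|lborel. \<bar>u x\<bar> powr p / norm x powr (s * p))
     - 1 / crit_exp (real DIM('a)) s p \<alpha>
         * (LINT x|lborel. \<bar>u x\<bar> powr crit_exp (real DIM('a)) s p \<alpha> / norm x powr \<alpha>)
     - f u"

text \<open>\<open>L\<close> is the Frechet derivative of \<open>F\<close> at \<open>u\<close> on the normed space \<open>Dsp s p\<close>.\<close>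

definition Dsp_has_derivative ::
  "real \<Rightarrow> real \<Rightarrow> (('a::euclidean_space \<Rightarrow> real) \<Rightarrow> real) \<Rightarrow> (('a \<Rightarrow> real) \<Rightarrow> real)
     \<Rightarrow> ('a \<Rightarrow> real) \<Rightarrow> bool" where
  "Dsp_has_derivative s p F L u \<longleftrightarrow> L \<in> Dsp_dual s p \<and>
     (\<forall>\<epsilon>>0. \<exists>\<delta>>0. \<forall>\<phi>\<in>Dsp s p. gagliardo s p \<phi> < \<delta> \<longrightarrow>
        \<bar>F (\<lambda>x. u x + \<phi> x) - F u - L \<phi>\<bar> \<le> \<epsilon> * gagliardo s p \<phi>)"

definition palais_smale ::
  "real \<Rightarrow> real \<Rightarrow> (('a::euclidean_space \<Rightarrow> real) \<Rightarrow> real) \<Rightarrow> real \<Rightarrow> (nat \<Rightarrow> 'a \<Rightarrow> real) \<Rightarrow> bool" where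
  "palais_smale s p F \<eta> U \<longleftrightarrow>
     (\<forall>n. U n \<in> Dsp s p) \<and> (\<lambda>n. F (U n)) \<longlonglongrightarrow> \<eta> \<and>
     (\<exists>L. (\<forall>n. Dsp_has_derivative s p F (L n) (U n)) \<and> (\<lambda>n. dual_norm s p (L n)) \<longlonglongrightarrow> 0)"

definition rescale :: "real \<Rightarrow> real \<Rightarrow> real \<Rightarrow> ('a::euclidean_space \<Rightarrow> real) \<Rightarrow> 'a \<Rightarrow> real" where
  "rescale s p r u = (\<lambda>x. r powr (- ((real DIM('a) - s * p) / p)) * u (x /\<^sub>R r))"

end

theory Submission
  imports Defs "HOL-Library.Diagonal_Subsequence"
begin

text \<open>
  Writing the Gagliardo seminorm, the Hardy term and the critical term as \<open>\<integral>|T u|\<^sup>r\<close> for three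
  linear maps \<open>T\<close> turns every convergence statement into one about \<open>L\<^sup>r\<close> spaces.  Along a
  bounded sequence converging almost everywhere, the energy and its derivative split by Brezis-Lieb,
  so subtracting the limit from a Palais-Smale sequence leaves a Palais-Smale sequence of the
  homogeneous functional.  Almost everywhere convergence comes from a Rellich argument with ball
  averages, and weak continuity of \<open>f\<close> from uniform convexity.

  The hypothesis on \<open>\<mu>\<close> provides a Hardy inequality; translating it and averaging over balls of
  optimal radius gives the Sobolev inequality.  The same averaging shows that the critical term of a
  bounded sequence can only survive if, at some scales \<open>r\<^sub>n\<close>, the rescaled functions keep
  \<open>L\<^sup>p\<close> mass on a fixed ball; the rescaled limit is then a nontrivial solution.  Every
  nontrivial solution costs at least a fixed amount of energy, so a decomposition with the largest
  number of bubbles exists, and its remainder tends to zero.  Two scales that did not separate would see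
  the mass of the new bubble at the old scale, where the previous remainder vanishes.
\<close>

section \<open>Elementary inequalities for powers\<close>

text \<open>The obstacle is dilation invariance: \<open>rescale\<close> leaves all three terms
  unchanged, so a bounded sequence may concentrate at the origin or spread out to infinity.
  Translations add no bubbles: \<open>0 < \<alpha>\<close> and \<open>\<alpha> < s * p\<close> put
  \<open>q\<close> strictly between \<open>p\<close> and the Sobolev exponent. In the invariant
  variable \<open>\<bar>u x\<bar> powr p * norm x powr (d - s * p)\<close> the critical density is
  then an intermediate power, whose small and large values are absorbed by the Hardy and Sobolev
  integrals, and only balls centred at the origin are tested for mass. As the operator is nonlinear,
  splitting the derivative means splitting signed powers in the conjugate Lebesgue space, which
  makes the error uniform over test functions. The pointwise inequalities behind this, and behind
  uniform convexity, come from homogeneity and compactness of the unit circle. One combination, the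
  energy minus \<open>1 / q\<close> times the derivative applied to the function itself, contains no
  critical term. It bounds Palais-Smale sequences, makes levels nonnegative, gives bubbles positive
  energy and shows that a remainder tending to zero has level zero, which is the energy
  identity.\<close>

definition signed_pow :: "real \<Rightarrow> real \<Rightarrow> real" where
  "signed_pow r t = \<bar>t\<bar> powr (r - 2) * t"

lemma abs_signed_pow: "\<bar>signed_pow r t\<bar> = \<bar>t\<bar> powr (r - 1)"
proof (cases "t = 0")
  case False
  then have "\<bar>t\<bar> powr (r - 1) = \<bar>t\<bar> powr (r - 2) * \<bar>t\<bar> powr 1"
    by (subst powr_add[symmetric]) simp
  with False show ?thesis by (simp add: signed_pow_def abs_mult)
qed (simp add: signed_pow_def)

lemma signed_pow_mult_self: "signed_pow r t * t = \<bar>t\<bar> powr r"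
proof (cases "t = 0")
  case False
  have "\<bar>t\<bar> powr r = \<bar>t\<bar> powr (r - 2) * (\<bar>t\<bar> powr 1 * \<bar>t\<bar> powr 1)"
    by (simp only: powr_add[symmetric]) simp
  also have "\<dots> = \<bar>t\<bar> powr (r - 2) * (t * t)"
    using False by simp
  finally show ?thesis by (simp add: signed_pow_def)
qed (simp add: signed_pow_def)

lemma signed_pow_zero [simp]: "signed_pow r 0 = 0"
  by (simp add: signed_pow_def)

lemma signed_pow_scale:
  assumes "0 \<le> c" shows "signed_pow r (c * t) = c powr (r - 1) * signed_pow r t"
proof (cases "c = 0")
  case False
  with assms have "c powr (r - 1) = c powr (r - 2) * c powr 1"
    by (subst powr_add[symmetric]) simp
  with False assms show ?thesis by (simp add: signed_pow_def abs_mult powr_mult)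
qed simp

text \<open>The factor \<open>\<bar>t\<bar> powr (r - 2)\<close> is singular at the origin when
  \<open>r < 2\<close>. Written with positive parts, only the positive exponent \<open>r - 1\<close>
  occurs, so continuity at \<open>0\<close> becomes visible.\<close>

lemma signed_pow_eq: "signed_pow r t = max t 0 powr (r - 1) - max (-t) 0 powr (r - 1)"
proof -
  have "signed_pow r t = sgn t * \<bar>signed_pow r t\<bar>"
    by (simp add: signed_pow_def abs_mult sgn_if)
  then show ?thesis unfolding abs_signed_pow by (auto simp: sgn_if max_def)
qed

lemma continuous_on_signed_pow [continuous_intros]:
  assumes "continuous_on S f" "1 < r" shows "continuous_on S (\<lambda>x. signed_pow r (f x))"
  unfolding signed_pow_eq using assms
  by (intro continuous_intros continuous_on_powr') auto

lemma borel_measurable_signed_pow [measurable]: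
  assumes [measurable]: "f \<in> borel_measurable M" shows "(\<lambda>x. signed_pow r (f x)) \<in> borel_measurable M"
  unfolding signed_pow_def by measurable

lemma tendsto_signed_pow:
  assumes "(f \<longlongrightarrow> l) F" "1 < r" shows "((\<lambda>x. signed_pow r (f x)) \<longlongrightarrow> signed_pow r l) F"
proof -
  have "continuous_on UNIV (\<lambda>x. signed_pow r x)"
    by (intro continuous_intros \<open>1 < r\<close>)
  then have "isCont (\<lambda>x. signed_pow r x) l" by (simp add: continuous_on_eq_continuous_at)
  from isCont_tendsto_compose[OF this assms(1)] show ?thesis .
qed

lemma tendsto_abs_powr:
  fixes f :: "'a \<Rightarrow> real"
  assumes "(f \<longlongrightarrow> l) F" "0 < r" shows "((\<lambda>x. \<bar>f x\<bar> powr r) \<longlongrightarrow> \<bar>l\<bar> powr r) F"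
  using assms by (intro tendsto_powr' tendsto_intros) auto

lemma add_powr_le:
  fixes a b r :: real
  assumes "0 \<le> a" "0 \<le> b" "0 < r" shows "(a + b) powr r \<le> 2 powr r * (a powr r + b powr r)"
proof -
  have "(a + b) powr r \<le> (2 * max a b) powr r" using assms by (intro powr_mono2) auto
  also have "\<dots> = 2 powr r * max a b powr r" using assms by (simp add: powr_mult)
  also have "\<dots> \<le> 2 powr r * (a powr r + b powr r)" by (intro mult_left_mono) (auto simp: max_def)
  finally show ?thesis .
qed

lemma abs_add_powr_le:
  fixes a b r :: real
  assumes "0 < r" shows "\<bar>a + b\<bar> powr r \<le> 2 powr r * (\<bar>a\<bar> powr r + \<bar>b\<bar> powr r)"
proof -
  have "\<bar>a + b\<bar> powr r \<le> (\<bar>a\<bar> + \<bar>b\<bar>) powr r" using assms by (intro powr_mono2) auto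
  also note add_powr_le[of "\<bar>a\<bar>" "\<bar>b\<bar>" r]
  finally show ?thesis using assms by simp
qed

lemma abs_diff_powr_le:
  fixes a b r :: real
  assumes "0 < r" shows "\<bar>a - b\<bar> powr r \<le> 2 powr r * (\<bar>a\<bar> powr r + \<bar>b\<bar> powr r)"
  using abs_add_powr_le[OF assms, of a "-b"] by simp

text \<open>Homogeneity reduces the claim to the unit sphere. On the compact part where
  \<open>\<Psi>\<close> is at least a positive threshold, \<open>h\<close> cannot vanish, so it has
  a positive minimum there, and the maximum of \<open>\<Psi>\<close> over that minimum serves as
  \<open>C\<close>. All pointwise inequalities of this section with an \<open>\<epsilon>\<close> and
  an unspecified constant are instances.\<close>

lemma homogeneous_bound:
  fixes \<Psi> h :: "real \<times> real \<Rightarrow> real"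
  assumes r: "0 < r" and cont: "continuous_on UNIV \<Psi>" "continuous_on UNIV h"
    and hom: "\<And>c z. 0 \<le> c \<Longrightarrow> \<Psi> (c *\<^sub>R z) = c powr r * \<Psi> z"
      "\<And>c z. 0 \<le> c \<Longrightarrow> h (c *\<^sub>R z) = c powr r * h z"
    and h: "\<And>z. 0 \<le> h z" "\<And>z. h z = 0 \<Longrightarrow> \<Psi> z \<le> 0" and e: "0 < \<epsilon>"
  shows "\<exists>C\<ge>0. \<forall>a b. \<Psi> (a, b) \<le> \<epsilon> * (\<bar>a\<bar> powr r + \<bar>b\<bar> powr r) + C * h (a, b)"
proof -
  \<comment> \<open>The factor \<open>2 powr r\<close> pays for passing from
    \<open>norm z powr r\<close> to the sum of the powers of the coordinates.\<close>
  define \<epsilon>' where "\<epsilon>' = \<epsilon> / 2 powr r"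
  have e': "0 < \<epsilon>'" using e by (simp add: \<epsilon>'_def)
  define K where "K = sphere 0 1 \<inter> \<Psi> -` {\<epsilon>'..}"
  have K: "compact K" unfolding K_def
    by (intro compact_Int_closed closed_vimage) (use cont in \<open>auto intro: continuous_on_subset\<close>)
  have "\<exists>C\<ge>0. \<forall>z\<in>sphere 0 1. \<Psi> z \<le> \<epsilon>' + C * h z"
  proof (cases "K = {}")
    case True
    then show ?thesis by (intro exI[of _ 0]) (fastforce simp: K_def)
  next
    case False
    obtain z0 where z0: "z0 \<in> K" "\<And>z. z \<in> K \<Longrightarrow> h z0 \<le> h z"
      using continuous_attains_inf[OF K False, of h] cont by (meson continuous_on_subset subset_UNIV)
    obtain z1 where z1: "z1 \<in> K" "\<And>z. z \<in> K \<Longrightarrow> \<Psi> z \<le> \<Psi> z1"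
      using continuous_attains_sup[OF K False, of \<Psi>] cont by (meson continuous_on_subset subset_UNIV)
    have p1: "\<Psi> z1 \<ge> \<epsilon>'" and p0: "\<Psi> z0 \<ge> \<epsilon>'" using z0 z1 by (auto simp: K_def)
    have h0: "h z0 > 0" using h[of z0] p0 e' by (cases "h z0 = 0") auto
    define C where "C = \<Psi> z1 / h z0"
    have C: "C \<ge> 0" using p1 e' h0 by (simp add: C_def)
    have "\<Psi> z \<le> \<epsilon>' + C * h z" if "z \<in> sphere 0 1" for z
    proof (cases "z \<in> K")
      case True
      have "\<Psi> z \<le> \<Psi> z1" using z1 True by auto
      also have "\<dots> = C * h z0" using h0 by (simp add: C_def)
      also have "\<dots> \<le> C * h z" using z0 True C by (intro mult_left_mono) auto
      finally show ?thesis using e' by simp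
    next
      case False
      then have "\<Psi> z \<le> \<epsilon>'" using that by (auto simp: K_def)
      then show ?thesis using C h(1)[of z] by (simp add: add_increasing2)
    qed
    with C show ?thesis by blast
  qed
  then obtain C where C: "C \<ge> 0" "\<And>z. z \<in> sphere 0 1 \<Longrightarrow> \<Psi> z \<le> \<epsilon>' + C * h z" by blast
  have "\<Psi> (a, b) \<le> \<epsilon> * (\<bar>a\<bar> powr r + \<bar>b\<bar> powr r) + C * h (a, b)" for a b
  proof (cases "(a, b) = 0")
    case True
    have "\<Psi> (0 *\<^sub>R 0) = 0" using hom(1)[of 0 0] r by simp
    with True h(1)[of "(a,b)"] C(1) e show ?thesis by simp
  next
    case False
    define z where "z = (a, b)"
    define w where "w = z /\<^sub>R norm z"
    have nz: "norm z > 0" using False by (simp add: z_def)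
    have zw: "z = norm z *\<^sub>R w" using nz by (simp add: w_def)
    have w: "w \<in> sphere 0 1" using nz by (simp add: w_def)
    have nle: "norm z \<le> \<bar>a\<bar> + \<bar>b\<bar>"
      unfolding z_def norm_Pair using real_sqrt_sum_squares_triangle_ineq[of a 0 0 b] by simp
    have "norm z powr r \<le> (\<bar>a\<bar> + \<bar>b\<bar>) powr r" using nle r nz by (intro powr_mono2) auto
    also have "\<dots> \<le> 2 powr r * (\<bar>a\<bar> powr r + \<bar>b\<bar> powr r)" using r by (intro add_powr_le) auto
    finally have *: "\<epsilon>' * norm z powr r \<le> \<epsilon> * (\<bar>a\<bar> powr r + \<bar>b\<bar> powr r)"
      using mult_left_mono[OF _ less_imp_le[OF e'], of "norm z powr r" "2 powr r * (\<bar>a\<bar> powr r + \<bar>b\<bar> powr r)"]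
      by (simp add: \<epsilon>'_def)
    have "\<Psi> z = norm z powr r * \<Psi> w" using hom(1)[of "norm z" w] zw nz by simp
    also have "\<dots> \<le> norm z powr r * (\<epsilon>' + C * h w)" using C(2)[OF w] by (intro mult_left_mono) auto
    also have "\<dots> = \<epsilon>' * norm z powr r + C * h z" using hom(2)[of "norm z" w] zw nz by (simp add: algebra_simps)
    finally show ?thesis using * by (simp add: z_def)
  qed
  with C(1) show ?thesis by blast
qed

text \<open>Here \<open>h\<close> is the power of the second coordinate alone, so its zero set is
  the axis \<open>b = 0\<close>; the leftover \<open>\<epsilon>\<close> times that power is moved
  into the constant.\<close>

lemma homogeneous_bound_snd:
  fixes \<Psi> :: "real \<times> real \<Rightarrow> real"
  assumes r: "0 < r" and cont: "continuous_on UNIV \<Psi>"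
    and hom: "\<And>c z. 0 \<le> c \<Longrightarrow> \<Psi> (c *\<^sub>R z) = c powr r * \<Psi> z"
    and z: "\<And>a. \<Psi> (a, 0) \<le> 0" and e: "0 < \<epsilon>"
  shows "\<exists>C\<ge>0. \<forall>a b. \<Psi> (a, b) \<le> \<epsilon> * \<bar>a\<bar> powr r + C * \<bar>b\<bar> powr r"
proof -
  have "\<exists>C\<ge>0. \<forall>a b. \<Psi> (a, b) \<le> \<epsilon> * (\<bar>a\<bar> powr r + \<bar>b\<bar> powr r) + C * (\<lambda>z. \<bar>snd z\<bar> powr r) (a, b)"
  proof (rule homogeneous_bound[OF r cont _ hom])
    show "continuous_on UNIV (\<lambda>z::real\<times>real. \<bar>snd z\<bar> powr r)"
      using r by (intro continuous_on_powr' continuous_intros) auto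
  qed (use z e in \<open>auto simp: abs_mult powr_mult\<close>)
  then obtain C where "C \<ge> 0" "\<And>a b. \<Psi> (a, b) \<le> \<epsilon> * (\<bar>a\<bar> powr r + \<bar>b\<bar> powr r) + C * \<bar>b\<bar> powr r" by auto
  then show ?thesis using e by (intro exI[of _ "C + \<epsilon>"]) (auto simp: algebra_simps)
qed

text \<open>The left side vanishes on the axis \<open>b = 0\<close>. The small coefficient falls on
  \<open>a\<close>, which will be the bounded but possibly nonconvergent difference, while the large
  constant falls on the fixed limit \<open>b\<close>.\<close>

lemma brezis_lieb_pointwise:
  fixes r \<epsilon> :: real
  assumes r: "1 < r" and e: "0 < \<epsilon>"
  shows "\<exists>C\<ge>0. \<forall>a b. \<bar>\<bar>a + b\<bar> powr r - \<bar>a\<bar> powr r - \<bar>b\<bar> powr r\<bar> \<le> \<epsilon> * \<bar>a\<bar> powr r + C * \<bar>b\<bar> powr r"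
proof -
  let ?P = "\<lambda>z. \<bar>\<bar>fst z + snd z\<bar> powr r - \<bar>fst z\<bar> powr r - \<bar>snd z\<bar> powr r\<bar>"
  have "\<exists>C\<ge>0. \<forall>a b. ?P (a, b) \<le> \<epsilon> * \<bar>a\<bar> powr r + C * \<bar>b\<bar> powr r"
  proof (rule homogeneous_bound_snd)
    show "continuous_on UNIV ?P"
      using r by (intro continuous_on_powr' continuous_intros) auto
    fix c :: real and z :: "real \<times> real" assume c: "0 \<le> c"
    have "\<bar>c * fst z + c * snd z\<bar> powr r = c powr r * \<bar>fst z + snd z\<bar> powr r"
      using c by (subst distrib_left[symmetric]) (simp add: abs_mult powr_mult)
    then have "?P (c *\<^sub>R z) = \<bar>c powr r * (\<bar>fst z + snd z\<bar> powr r - \<bar>fst z\<bar> powr r - \<bar>snd z\<bar> powr r)\<bar>"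
      using c by (simp add: abs_mult powr_mult algebra_simps)
    also have "\<dots> = c powr r * ?P z" by (simp add: abs_mult)
    finally show "?P (c *\<^sub>R z) = c powr r * ?P z" .
  qed (use r e in auto)
  then show ?thesis by simp
qed

text \<open>Signed powers are homogeneous of degree \<open>r - 1\<close>; raising to the conjugate
  exponent \<open>r / (r - 1)\<close> restores degree \<open>r\<close>, the degree of the right
  side.\<close>

lemma brezis_lieb_signed_pow_pointwise:
  fixes r \<epsilon> :: real
  assumes r: "1 < r" and e: "0 < \<epsilon>"
  shows "\<exists>C\<ge>0. \<forall>a b. \<bar>signed_pow r (a + b) - signed_pow r a - signed_pow r b\<bar> powr (r / (r - 1))
            \<le> \<epsilon> * \<bar>a\<bar> powr r + C * \<bar>b\<bar> powr r"
proof -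
  let ?P = "\<lambda>z. \<bar>signed_pow r (fst z + snd z) - signed_pow r (fst z) - signed_pow r (snd z)\<bar> powr (r / (r - 1))"
  have "\<exists>C\<ge>0. \<forall>a b. ?P (a, b) \<le> \<epsilon> * \<bar>a\<bar> powr r + C * \<bar>b\<bar> powr r"
  proof (rule homogeneous_bound_snd)
    show "continuous_on UNIV ?P"
      using r by (intro continuous_on_powr' continuous_intros) auto
    fix c :: real and z :: "real \<times> real" assume c: "0 \<le> c"
    have "signed_pow r (c * fst z + c * snd z) = c powr (r - 1) * signed_pow r (fst z + snd z)"
      using c by (subst distrib_left[symmetric]) (simp add: signed_pow_scale)
    then have "?P (c *\<^sub>R z) = \<bar>c powr (r - 1) * (signed_pow r (fst z + snd z) - signed_pow r (fst z)
        - signed_pow r (snd z))\<bar> powr (r / (r - 1))"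
      using c by (simp add: signed_pow_scale algebra_simps)
    also have "\<dots> = c powr r * ?P z" using r by (simp add: abs_mult powr_mult powr_powr)
    finally show "?P (c *\<^sub>R z) = c powr r * ?P z" .
  qed (use r e in auto)
  then show ?thesis by simp
qed

section \<open>Strict convexity of powers in quantitative form\<close>

lemma powr_above_tangent:
  fixes x c r :: real
  assumes r: "1 < r" and c: "0 < c" and x: "0 \<le> x" and ne: "x \<noteq> c"
  shows "c powr r + r * c powr (r - 1) * (x - c) < x powr r"
proof -
  have cc: "c powr r = c * c powr (r - 1)"
    using c by (simp add: powr_diff)
  consider "x = 0" | "0 < x" "x < c" | "c < x" using x ne by linarith
  then show ?thesis
  proof cases
    \<comment> \<open>The endpoint is computed directly, since differentiating \<open>powr\<close>
      calls for a positive base; the claim becomes \<open>(1 - r) * c powr r < 0\<close>.\<close>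
    case 1
    have "c powr (r - 1) * (c - r * c) < 0"
      using c r by (intro mult_pos_neg) auto
    then show ?thesis using 1 r by (simp add: cc algebra_simps)
  next
    case 2
    have "\<exists>z. x < z \<and> z < c \<and> c powr r - x powr r = (c - x) * (r * z powr (r - 1))"
      using 2 by (intro MVT2) (auto intro!: derivative_eq_intros simp: powr_diff)
    then obtain z where z: "x < z" "z < c" "c powr r - x powr r = (c - x) * (r * z powr (r - 1))" by blast
    have "z powr (r - 1) < c powr (r - 1)" using z 2 r by (intro powr_less_mono2) auto
    then have "(c - x) * (r * z powr (r - 1)) < (c - x) * (r * c powr (r - 1))"
      using 2 r by (intro mult_strict_left_mono) auto
    with z(3) show ?thesis by (simp add: algebra_simps)
  next
    case 3
    have "\<exists>z. c < z \<and> z < x \<and> x powr r - c powr r = (x - c) * (r * z powr (r - 1))"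
      using 3 c by (intro MVT2) (auto intro!: derivative_eq_intros simp: powr_diff)
    then obtain z where z: "c < z" "z < x" "x powr r - c powr r = (x - c) * (r * z powr (r - 1))" by blast
    have "c powr (r - 1) < z powr (r - 1)" using z 3 c r by (intro powr_less_mono2) auto
    then have "(x - c) * (r * c powr (r - 1)) < (x - c) * (r * z powr (r - 1))"
      using 3 r by (intro mult_strict_left_mono) auto
    with z(3) show ?thesis by (simp add: algebra_simps)
  qed
qed

text \<open>Adding the tangent inequalities at the midpoint for the two endpoints cancels the linear
  terms.\<close>

lemma powr_midpoint_strict:
  fixes x y r :: real
  assumes r: "1 < r" and xy: "0 \<le> x" "0 \<le> y" "x \<noteq> y"
  shows "((x + y) / 2) powr r < (x powr r + y powr r) / 2"
proof -
  define c where "c = (x + y) / 2"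
  have c: "0 < c" "x \<noteq> c" "y \<noteq> c" using xy by (auto simp: c_def)
  have *: "r * c powr (r - 1) * (x - c) + r * c powr (r - 1) * (y - c) = 0"
    unfolding distrib_left[symmetric] by (simp add: c_def)
  from powr_above_tangent[OF r c(1) xy(1) c(2)] powr_above_tangent[OF r c(1) xy(2) c(3)]
  have "c powr r + r * c powr (r - 1) * (x - c) + (c powr r + r * c powr (r - 1) * (y - c))
      < x powr r + y powr r"
    by (rule add_strict_mono)
  with * show ?thesis unfolding c_def[symmetric] by (simp add: algebra_simps)
qed

text \<open>The equality case supplies the hypothesis of \<open>homogeneous_bound\<close> that the
  convexity defect vanishes only where \<open>a - b\<close> does.\<close>

lemma abs_powr_midpoint:
  fixes a b r :: real
  assumes r: "1 < r"
  shows "\<bar>(a + b) / 2\<bar> powr r \<le> (\<bar>a\<bar> powr r + \<bar>b\<bar> powr r) / 2"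
    and "\<bar>(a + b) / 2\<bar> powr r = (\<bar>a\<bar> powr r + \<bar>b\<bar> powr r) / 2 \<Longrightarrow> a = b"
proof -
  have 1: "\<bar>(a + b) / 2\<bar> powr r \<le> ((\<bar>a\<bar> + \<bar>b\<bar>) / 2) powr r"
    using r by (intro powr_mono2) auto
  have 2: "((\<bar>a\<bar> + \<bar>b\<bar>) / 2) powr r < (\<bar>a\<bar> powr r + \<bar>b\<bar> powr r) / 2" if "\<bar>a\<bar> \<noteq> \<bar>b\<bar>"
    using that r by (intro powr_midpoint_strict) auto
  show "\<bar>(a + b) / 2\<bar> powr r \<le> (\<bar>a\<bar> powr r + \<bar>b\<bar> powr r) / 2"
    using 1 2 by (cases "\<bar>a\<bar> = \<bar>b\<bar>") auto
  assume *: "\<bar>(a + b) / 2\<bar> powr r = (\<bar>a\<bar> powr r + \<bar>b\<bar> powr r) / 2"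
  then have "\<bar>a\<bar> = \<bar>b\<bar>" using 1 2 by linarith
  then consider "a = b" | "a = - b" by linarith
  then show "a = b" using * r by cases auto
qed

text \<open>In \<open>homogeneous_bound\<close> the function \<open>h\<close> is the midpoint
  defect. Since it is zero only on the diagonal, it controls \<open>\<bar>a - b\<bar> powr r\<close>
  up to \<open>\<epsilon>\<close>, in one form for all \<open>r > 1\<close>; integration then gives
  uniform convexity.\<close>

lemma powr_uniform_convexity:
  fixes r \<epsilon> :: real
  assumes r: "1 < r" and e: "0 < \<epsilon>"
  shows "\<exists>C\<ge>0. \<forall>a b. \<bar>a - b\<bar> powr r \<le> \<epsilon> * (\<bar>a\<bar> powr r + \<bar>b\<bar> powr r)
            + C * ((\<bar>a\<bar> powr r + \<bar>b\<bar> powr r) / 2 - \<bar>(a + b) / 2\<bar> powr r)"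
proof -
  let ?P = "\<lambda>z. \<bar>fst z - snd z\<bar> powr r"
  let ?h = "\<lambda>z. (\<bar>fst z\<bar> powr r + \<bar>snd z\<bar> powr r) / 2 - \<bar>(fst z + snd z) / 2\<bar> powr r"
  have "\<exists>C\<ge>0. \<forall>a b. ?P (a, b) \<le> \<epsilon> * (\<bar>a\<bar> powr r + \<bar>b\<bar> powr r) + C * ?h (a, b)"
  proof (rule homogeneous_bound)
    show "continuous_on UNIV ?P" "continuous_on UNIV ?h"
      using r by (intro continuous_on_powr' continuous_intros; auto)+
    fix c :: real and z :: "real \<times> real" assume c: "0 \<le> c"
    show "?P (c *\<^sub>R z) = c powr r * ?P z"
      using c by (simp add: abs_mult powr_mult right_diff_distrib[symmetric])
    have *: "\<bar>(c * fst z + c * snd z) / 2\<bar> powr r = c powr r * \<bar>(fst z + snd z) / 2\<bar> powr r"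
    proof -
      have "(c * fst z + c * snd z) / 2 = c * ((fst z + snd z) / 2)" by (simp add: field_simps)
      then show ?thesis using c by (simp only: abs_mult powr_mult abs_ge_zero)
    qed
    show "?h (c *\<^sub>R z) = c powr r * ?h z"
      using c * by (simp add: abs_mult powr_mult algebra_simps)
  next
    fix z :: "real \<times> real"
    show "0 \<le> ?h z" using abs_powr_midpoint(1)[OF r, of "fst z" "snd z"] by simp
    assume "?h z = 0"
    then have "fst z = snd z" using abs_powr_midpoint(2)[OF r, of "fst z" "snd z"] by simp
    then show "?P z \<le> 0" by simp
  qed (use r e in auto)
  then show ?thesis by simp
qed

section \<open>Brezis-Lieb lemmas and convexity in Lebesgue spaces\<close>

definition Lfun :: "real \<Rightarrow> 'b measure \<Rightarrow> ('b \<Rightarrow> real) set" where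
  "Lfun r M = {f \<in> borel_measurable M. integrable M (\<lambda>x. \<bar>f x\<bar> powr r)}"

text \<open>This is the \<open>r\<close>-th power of the norm: the power, not the norm, is what
  splits additively along almost everywhere convergent sequences.\<close>

definition Lint :: "real \<Rightarrow> 'b measure \<Rightarrow> ('b \<Rightarrow> real) \<Rightarrow> real" where
  "Lint r M f = (LINT x|M. \<bar>f x\<bar> powr r)"

lemma LfunD: "f \<in> Lfun r M \<Longrightarrow> f \<in> borel_measurable M" "f \<in> Lfun r M \<Longrightarrow> integrable M (\<lambda>x. \<bar>f x\<bar> powr r)"
  by (auto simp: Lfun_def)

lemma Lint_nonneg [simp]: "0 \<le> Lint r M f"
  by (simp add: Lint_def)

lemma nn_integral_Lint: "f \<in> Lfun r M \<Longrightarrow> (\<integral>\<^sup>+x. ennreal (\<bar>f x\<bar> powr r) \<partial>M) = ennreal (Lint r M f)"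
  unfolding Lint_def by (intro nn_integral_eq_integral) (auto dest: LfunD)

lemma LfunI_nn_integral:
  assumes "f \<in> borel_measurable M" "(\<integral>\<^sup>+x. ennreal (\<bar>f x\<bar> powr r) \<partial>M) \<le> ennreal K" "0 \<le> K"
  shows "f \<in> Lfun r M" "Lint r M f \<le> K"
proof -
  have "integrable M (\<lambda>x. \<bar>f x\<bar> powr r)"
    using assms by (intro integrableI_nonneg) (auto simp: le_less_trans ennreal_less_top)
  then show *: "f \<in> Lfun r M" using assms by (simp add: Lfun_def)
  show "Lint r M f \<le> K" using nn_integral_Lint[OF *] assms by simp
qed

lemma Lfun_add:
  assumes "0 < r" "f \<in> Lfun r M" "g \<in> Lfun r M"
  shows "(\<lambda>x. f x + g x) \<in> Lfun r M"
proof -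
  note [measurable] = LfunD(1)[OF assms(2)] LfunD(1)[OF assms(3)]
  have "integrable M (\<lambda>x. 2 powr r * (\<bar>f x\<bar> powr r + \<bar>g x\<bar> powr r))" using assms by (auto dest: LfunD)
  then have "integrable M (\<lambda>x. \<bar>f x + g x\<bar> powr r)"
    by (rule Bochner_Integration.integrable_bound)
       (auto intro!: AE_I2 order_trans[OF abs_add_powr_le[OF assms(1)]])
  then show ?thesis by (simp add: Lfun_def)
qed

lemma Lfun_cmult:
  assumes "f \<in> Lfun r M" shows "(\<lambda>x. c * f x) \<in> Lfun r M"
  using assms by (auto simp: Lfun_def abs_mult powr_mult)

lemma Lint_cmult: "Lint r M (\<lambda>x. c * f x) = \<bar>c\<bar> powr r * Lint r M f"
  by (simp add: Lint_def abs_mult powr_mult)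

lemma Lfun_diff:
  assumes "0 < r" "f \<in> Lfun r M" "g \<in> Lfun r M"
  shows "(\<lambda>x. f x - g x) \<in> Lfun r M"
  using Lfun_add[OF assms(1,2) Lfun_cmult[OF assms(3), of "-1"]] by simp

lemma Lint_add_le:
  assumes "0 < r" "f \<in> Lfun r M" "g \<in> Lfun r M"
  shows "Lint r M (\<lambda>x. f x + g x) \<le> 2 powr r * (Lint r M f + Lint r M g)"
proof -
  have "(LINT x|M. \<bar>f x + g x\<bar> powr r) \<le> (LINT x|M. 2 powr r * (\<bar>f x\<bar> powr r + \<bar>g x\<bar> powr r))"
    using assms LfunD(2)[OF Lfun_add[OF assms]]
    by (intro integral_mono) (auto dest: LfunD intro!: abs_add_powr_le)
  also have "\<dots> = 2 powr r * (Lint r M f + Lint r M g)"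
    using assms by (simp add: Lint_def LfunD)
  finally show ?thesis by (simp add: Lint_def)
qed

lemma Lint_eq_0_iff:
  assumes "f \<in> Lfun r M" shows "Lint r M f = 0 \<longleftrightarrow> (AE x in M. f x = 0)"
  unfolding Lint_def using assms
  by (subst integral_nonneg_eq_0_iff_AE) (auto dest: LfunD)

text \<open>Lower semicontinuity under almost everywhere convergence; it takes the place of weak
  lower semicontinuity throughout and also yields membership of the limit.\<close>

lemma Lfun_Fatou:
  assumes f: "\<And>n. f n \<in> Lfun r M" "\<And>n. Lint r M (f n) \<le> K" and g: "g \<in> borel_measurable M"
    and r: "0 < r" and lim: "AE x in M. (\<lambda>n. f n x) \<longlonglongrightarrow> g x"
  shows "g \<in> Lfun r M" "Lint r M g \<le> K"
proof -
  have K: "0 \<le> K" using f(2)[of 0] Lint_nonneg order_trans by blast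
  have "(\<integral>\<^sup>+x. ennreal (\<bar>g x\<bar> powr r) \<partial>M) = (\<integral>\<^sup>+x. liminf (\<lambda>n. ennreal (\<bar>f n x\<bar> powr r)) \<partial>M)"
  proof (rule nn_integral_cong_AE, use lim in eventually_elim)
    case (elim x)
    have "(\<lambda>n. ennreal (\<bar>f n x\<bar> powr r)) \<longlonglongrightarrow> ennreal (\<bar>g x\<bar> powr r)"
      by (intro tendsto_ennrealI tendsto_abs_powr elim r)
    then show ?case by (intro lim_imp_Liminf[symmetric]) auto
  qed
  also have "\<dots> \<le> liminf (\<lambda>n. \<integral>\<^sup>+x. ennreal (\<bar>f n x\<bar> powr r) \<partial>M)"
    using LfunD(1)[OF f(1)] by (intro nn_integral_liminf) auto
  also have "\<dots> = liminf (\<lambda>n. ennreal (Lint r M (f n)))"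
    using f(1) by (simp add: nn_integral_Lint)
  also have "\<dots> \<le> liminf (\<lambda>n. ennreal K)"
    by (intro Liminf_mono always_eventually allI ennreal_leI f(2))
  also have "\<dots> = ennreal K" by (simp add: Liminf_const)
  finally show "g \<in> Lfun r M" "Lint r M g \<le> K" using LfunI_nn_integral[OF g _ K] by auto
qed

lemma Hoelder_inequality:
  fixes f g :: "'b \<Rightarrow> real"
  assumes r: "1 < r" and f: "f \<in> Lfun (r / (r - 1)) M" and g: "g \<in> Lfun r M"
  shows "integrable M (\<lambda>x. f x * g x)"
    and "\<bar>LINT x|M. f x * g x\<bar> \<le> Lint (r / (r - 1)) M f powr ((r - 1) / r) * Lint r M g powr (1 / r)"
proof -
  define r' where "r' = r / (r - 1)"
  have r': "1 < r'" "1 / r' + 1 / r = 1" using r by (auto simp: r'_def field_simps)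
  note f = f[folded r'_def]
  note [measurable] = LfunD(1)[OF f] LfunD(1)[OF g]
  have Y: "\<bar>a * b\<bar> \<le> \<bar>a\<bar> powr r' / r' + \<bar>b\<bar> powr r / r" for a b :: real
    unfolding abs_mult using Youngs_inequality[OF r'(1) r r'(2), of "\<bar>a\<bar>" "\<bar>b\<bar>"] by simp
  have int: "integrable M (\<lambda>x. \<bar>f x\<bar> powr r' / r' + \<bar>g x\<bar> powr r / r)"
    using f g by (simp add: LfunD)
  show fg: "integrable M (\<lambda>x. f x * g x)"
    by (rule Bochner_Integration.integrable_bound[OF int])
       (auto intro!: AE_I2 order_trans[OF Y])
  have ex: "(r - 1) / r = 1 / r'" by (simp add: r'_def)
  show "\<bar>LINT x|M. f x * g x\<bar> \<le> Lint (r / (r - 1)) M f powr ((r - 1) / r) * Lint r M g powr (1 / r)"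
    unfolding r'_def[symmetric] ex
  proof (cases "Lint r' M f = 0 \<or> Lint r M g = 0")
    case True
    then have "AE x in M. f x * g x = 0" using Lint_eq_0_iff[OF f] Lint_eq_0_iff[OF g] by auto
    then have "(LINT x|M. f x * g x) = 0" by (rule integral_eq_zero_AE)
    then show "\<bar>LINT x|M. f x * g x\<bar> \<le> Lint r' M f powr (1 / r') * Lint r M g powr (1 / r)" by simp
  next
    case False
    define F G where "F = Lint r' M f" and "G = Lint r M g"
    have FG: "0 < F" "0 < G" using False by (auto simp: F_def G_def less_le)
    \<comment> \<open>The two norms: Young's inequality is applied to \<open>f / a\<close> and
      \<open>g / b\<close>, whose powers integrate to one.\<close>
    define a b where "a = F powr (1 / r')" and "b = G powr (1 / r)"
    have ab: "0 < a" "0 < b" "a powr r' = F" "b powr r = G"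
      using FG r r' by (auto simp: a_def b_def powr_powr)
    have "\<bar>LINT x|M. f x * g x\<bar> \<le> (LINT x|M. \<bar>f x * g x\<bar>)" by (rule integral_abs_bound)
    also have "\<dots> \<le> (LINT x|M. a * b * (\<bar>f x\<bar> powr r' / (F * r') + \<bar>g x\<bar> powr r / (G * r)))"
    proof (rule integral_mono)
      show "integrable M (\<lambda>x. a * b * (\<bar>f x\<bar> powr r' / (F * r') + \<bar>g x\<bar> powr r / (G * r)))"
        using f g by (simp add: LfunD)
      fix x
      have "\<bar>f x * g x\<bar> = a * b * \<bar>(f x / a) * (g x / b)\<bar>" using ab by (simp add: abs_mult)
      also have "\<dots> \<le> a * b * (\<bar>f x / a\<bar> powr r' / r' + \<bar>g x / b\<bar> powr r / r)"
        using ab by (intro mult_left_mono Y) auto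
      also have "\<dots> = a * b * (\<bar>f x\<bar> powr r' / (F * r') + \<bar>g x\<bar> powr r / (G * r))"
        using ab by (simp add: abs_divide powr_divide)
      finally show "\<bar>f x * g x\<bar> \<le> a * b * (\<bar>f x\<bar> powr r' / (F * r') + \<bar>g x\<bar> powr r / (G * r))" .
    qed (use fg in auto)
    also have "\<dots> = a * b * (F / (F * r') + G / (G * r))"
      unfolding F_def G_def Lint_def using f g by (simp add: LfunD)
    also have "\<dots> = a * b * (1 / r' + 1 / r)" using FG by simp
    finally show "\<bar>LINT x|M. f x * g x\<bar> \<le> Lint r' M f powr (1 / r') * Lint r M g powr (1 / r)"
      unfolding r'(2) by (simp add: a_def b_def F_def G_def)
  qed
qed

lemma Lfun_signed_pow:
  assumes "1 < r" "f \<in> Lfun r M"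
  shows "(\<lambda>x. signed_pow r (f x)) \<in> Lfun (r / (r - 1)) M"
    and "Lint (r / (r - 1)) M (\<lambda>x. signed_pow r (f x)) = Lint r M f"
  using assms by (auto simp: Lfun_def Lint_def abs_signed_pow powr_powr)

text \<open>No fixed majorant exists because \<open>A n\<close> moves with \<open>n\<close>. The
  part of \<open>h n\<close> above \<open>\<epsilon> * A n\<close> does have the fixed majorant
  \<open>C * B\<close>, so dominated convergence removes it; the rest integrates to at most
  \<open>\<epsilon> * K\<close>.\<close>

lemma integral_tendsto_0_eps_dominated:
  fixes h A :: "nat \<Rightarrow> 'b \<Rightarrow> real"
  assumes h[measurable]: "\<And>n. h n \<in> borel_measurable M" and A: "\<And>n. integrable M (A n)"
    and K: "\<And>n. (LINT x|M. A n x) \<le> K" and nn: "\<And>n x. 0 \<le> A n x" "\<And>n x. 0 \<le> h n x"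
    and B: "integrable M B" and lim: "AE x in M. (\<lambda>n. h n x) \<longlonglongrightarrow> 0"
    and dom: "\<And>\<epsilon>. 0 < \<epsilon> \<Longrightarrow> \<exists>C\<ge>0. \<forall>n x. h n x \<le> \<epsilon> * A n x + C * B x"
  shows "integrable M (h n)" and "(\<lambda>n. LINT x|M. h n x) \<longlonglongrightarrow> 0"
proof -
  have int: "integrable M (h n)" for n
  proof -
    obtain C where C: "C \<ge> 0" "\<And>n x. h n x \<le> 1 * A n x + C * B x" using dom[of 1] by auto
    have "integrable M (\<lambda>x. 1 * A n x + C * B x)" using A B by auto
    then show ?thesis by (rule Bochner_Integration.integrable_bound)
      (use C nn in \<open>auto intro!: AE_I2 intro: order_trans[OF _ abs_ge_self]\<close>)
  qed
  then show "integrable M (h n)" .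
  have K0: "0 \<le> K" using K[of 0] nn by (metis Bochner_Integration.integral_nonneg order_trans)
  show "(\<lambda>n. LINT x|M. h n x) \<longlonglongrightarrow> 0"
  proof (rule LIMSEQ_I)
    fix e :: real assume e: "0 < e"
    define \<epsilon> where "\<epsilon> = e / (2 * (K + 1))"
    have \<epsilon>: "0 < \<epsilon>" using e K0 by (simp add: \<epsilon>_def)
    have eK: "\<epsilon> * K \<le> e / 2" using e K0 by (simp add: \<epsilon>_def field_simps)
    obtain C where C: "C \<ge> 0" "\<And>n x. h n x \<le> \<epsilon> * A n x + C * B x" using dom[OF \<epsilon>] by auto
    have Bn: "0 \<le> C * B x \<or> h n x \<le> \<epsilon> * A n x" for n x using C(2)[of n x] by linarith
    note [measurable] = borel_measurable_integrable[OF A] borel_measurable_integrable[OF B]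
    \<comment> \<open>The excess of \<open>h n\<close> over the moving majorant; it is at most
      \<open>h n\<close>, hence tends to zero wherever \<open>h n\<close> does.\<close>
    define k where "k = (\<lambda>n x. max 0 (h n x - \<epsilon> * A n x))"
    have kle: "k n x \<le> \<bar>C * B x\<bar>" for n x using C(2)[of n x] by (auto simp: k_def)
    have k0: "0 \<le> k n x" for n x by (simp add: k_def)
    have kh: "k n x \<le> h n x" for n x using nn[of n x] \<epsilon> by (simp add: k_def)
    have [measurable]: "k n \<in> borel_measurable M" for n unfolding k_def by measurable
    have "(\<lambda>n. LINT x|M. k n x) \<longlonglongrightarrow> (LINT x|M. 0)"
    proof (rule integral_dominated_convergence[where w="\<lambda>x. \<bar>C * B x\<bar>"])
      show "AE x in M. (\<lambda>n. k n x) \<longlonglongrightarrow> 0" using lim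
      proof eventually_elim
        case (elim x)
        show ?case by (rule tendsto_sandwich[OF _ _ tendsto_const elim]) (auto simp: k0 kh)
      qed
    qed (use kle k0 B in \<open>auto intro!: AE_I2\<close>)
    then have k_lim: "(\<lambda>n. LINT x|M. k n x) \<longlonglongrightarrow> 0" by simp
    have k_int: "integrable M (k n)" for n
      by (rule Bochner_Integration.integrable_bound[OF int[of n]]) (use k0 kh nn in \<open>auto intro!: AE_I2\<close>)
    obtain N where N: "\<And>n. n \<ge> N \<Longrightarrow> \<bar>LINT x|M. k n x\<bar> < e / 2"
      using LIMSEQ_D[OF k_lim, of "e/2"] e by auto
    have "norm ((LINT x|M. h n x) - 0) < e" if "n \<ge> N" for n
    proof -
      have "(LINT x|M. h n x) \<le> (LINT x|M. k n x + \<epsilon> * A n x)"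
        using int k_int A by (intro integral_mono) (auto simp: k_def)
      also have "\<dots> = (LINT x|M. k n x) + \<epsilon> * (LINT x|M. A n x)" using k_int A by simp
      also have "\<dots> < e / 2 + e / 2"
        using N[OF that] mult_left_mono[OF K[of n], of \<epsilon>] \<epsilon> eK by linarith
      finally show ?thesis using nn(2) by simp
    qed
    then show "\<exists>N. \<forall>n\<ge>N. norm ((LINT x|M. h n x) - 0) < e" by blast
  qed
qed

lemma Lint_diff_bounded:
  assumes "1 < r" "\<And>n. f n \<in> Lfun r M" "\<And>n. Lint r M (f n) \<le> K" "g \<in> Lfun r M"
  shows "Lint r M (\<lambda>x. f n x - g x) \<le> 2 powr r * (K + Lint r M g)"
proof -
  have r: "0 < r" using assms by simp
  have m: "Lint r M (\<lambda>x. - 1 * g x) = Lint r M g" unfolding Lint_cmult by simp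
  have "Lint r M (\<lambda>x. f n x + - 1 * g x) \<le> 2 powr r * (Lint r M (f n) + Lint r M (\<lambda>x. - 1 * g x))"
    by (rule Lint_add_le[OF r assms(2) Lfun_cmult[OF assms(4)]])
  also have "\<dots> \<le> 2 powr r * (K + Lint r M g)"
    unfolding m using assms(3)[of n] by (intro mult_left_mono) auto
  finally show ?thesis by simp
qed

text \<open>With \<open>f n = (f n - g) + g\<close>, the pointwise inequality bounds the splitting
  error by a small multiple of the bounded \<open>\<bar>f n - g\<bar> powr r\<close> plus a constant
  times the fixed \<open>\<bar>g\<bar> powr r\<close>, which is the situation of
  \<open>integral_tendsto_0_eps_dominated\<close>.\<close>

lemma brezis_lieb:
  assumes r: "1 < r" and f: "\<And>n. f n \<in> Lfun r M" "\<And>n. Lint r M (f n) \<le> K" and g: "g \<in> Lfun r M"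
    and lim: "AE x in M. (\<lambda>n. f n x) \<longlonglongrightarrow> g x"
  shows "(\<lambda>n. Lint r M (f n) - Lint r M (\<lambda>x. f n x - g x)) \<longlonglongrightarrow> Lint r M g"
proof -
  have r0: "0 < r" using r by simp
  note [measurable] = LfunD(1)[OF f(1)] LfunD(1)[OF g]
  note dif = Lfun_diff[OF r0 f(1) g]
  define h where "h = (\<lambda>n x. \<bar>\<bar>f n x\<bar> powr r - \<bar>f n x - g x\<bar> powr r - \<bar>g x\<bar> powr r\<bar>)"
  have "(\<lambda>n. LINT x|M. h n x) \<longlonglongrightarrow> 0"
  proof (rule integral_tendsto_0_eps_dominated(2)[where A="\<lambda>n x. \<bar>f n x - g x\<bar> powr r" and B="\<lambda>x. \<bar>g x\<bar> powr r"
        and K="2 powr r * (K + Lint r M g)"])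
    show "(LINT x|M. \<bar>f n x - g x\<bar> powr r) \<le> 2 powr r * (K + Lint r M g)" for n
      using Lint_diff_bounded[OF r f g, where n=n] by (simp add: Lint_def)
    show "AE x in M. (\<lambda>n. h n x) \<longlonglongrightarrow> 0" using lim
    proof eventually_elim
      case (elim x)
      have "(\<lambda>n. h n x) \<longlonglongrightarrow> \<bar>\<bar>g x\<bar> powr r - \<bar>g x - g x\<bar> powr r - \<bar>g x\<bar> powr r\<bar>"
        unfolding h_def by (intro tendsto_rabs tendsto_diff tendsto_abs_powr elim tendsto_const r0)
      then show ?case using r by simp
    qed
    fix \<epsilon> :: real assume "0 < \<epsilon>"
    from brezis_lieb_pointwise[OF r this] obtain C where "C \<ge> 0"
      "\<And>a b. \<bar>\<bar>a + b\<bar> powr r - \<bar>a\<bar> powr r - \<bar>b\<bar> powr r\<bar> \<le> \<epsilon> * \<bar>a\<bar> powr r + C * \<bar>b\<bar> powr r" by blast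
    with this(2)[of "f n x - g x" "g x" for n x]
    show "\<exists>C\<ge>0. \<forall>n x. h n x \<le> \<epsilon> * \<bar>f n x - g x\<bar> powr r + C * \<bar>g x\<bar> powr r"
      unfolding h_def by (intro exI[of _ C]) simp
  qed (use dif g in \<open>auto simp: h_def dest: LfunD\<close>)
  moreover have "norm (Lint r M (f n) - Lint r M (\<lambda>x. f n x - g x) - Lint r M g) \<le> (LINT x|M. h n x)" for n
  proof -
    have "Lint r M (f n) - Lint r M (\<lambda>x. f n x - g x) - Lint r M g
        = (LINT x|M. \<bar>f n x\<bar> powr r - \<bar>f n x - g x\<bar> powr r - \<bar>g x\<bar> powr r)"
      unfolding Lint_def using f(1)[of n] dif[of n] g by (simp add: LfunD)
    then show ?thesis unfolding h_def real_norm_def by (simp only: integral_abs_bound)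
  qed
  ultimately have "(\<lambda>n. Lint r M (f n) - Lint r M (\<lambda>x. f n x - g x) - Lint r M g) \<longlonglongrightarrow> 0"
    by - (rule Lim_null_comparison[where g="\<lambda>n. LINT x|M. h n x"], auto)
  then show ?thesis by (simp add: LIM_zero_iff)
qed

text \<open>Same scheme one derivative lower. Smallness in the conjugate space, rather than against
  each test function separately, is what lets Palais-Smale sequences be split.\<close>

lemma brezis_lieb_signed_pow:
  assumes r: "1 < r" and f: "\<And>n. f n \<in> Lfun r M" "\<And>n. Lint r M (f n) \<le> K" and g: "g \<in> Lfun r M"
    and lim: "AE x in M. (\<lambda>n. f n x) \<longlonglongrightarrow> g x"
  shows "(\<lambda>x. signed_pow r (f n x) - signed_pow r (f n x - g x) - signed_pow r (g x)) \<in> Lfun (r / (r - 1)) M"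
    and "(\<lambda>n. Lint (r / (r - 1)) M (\<lambda>x. signed_pow r (f n x) - signed_pow r (f n x - g x)
        - signed_pow r (g x))) \<longlonglongrightarrow> 0"
proof -
  have r0: "0 < r" using r by simp
  note [measurable] = LfunD(1)[OF f(1)] LfunD(1)[OF g]
  note dif = Lfun_diff[OF r0 f(1) g]
  define h where "h = (\<lambda>n x. \<bar>signed_pow r (f n x) - signed_pow r (f n x - g x)
      - signed_pow r (g x)\<bar> powr (r / (r - 1)))"
  have "(\<lambda>n. LINT x|M. h n x) \<longlonglongrightarrow> 0 \<and> integrable M (h n)" for n
  proof (rule conjI; rule integral_tendsto_0_eps_dominated[where A="\<lambda>n x. \<bar>f n x - g x\<bar> powr r"
      and B="\<lambda>x. \<bar>g x\<bar> powr r"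
        and K="2 powr r * (K + Lint r M g)"])
    show "(LINT x|M. \<bar>f n x - g x\<bar> powr r) \<le> 2 powr r * (K + Lint r M g)"
      "(LINT x|M. \<bar>f n x - g x\<bar> powr r) \<le> 2 powr r * (K + Lint r M g)" for n
      using Lint_diff_bounded[OF r f g, where n=n] by (simp_all add: Lint_def)
    show "AE x in M. (\<lambda>n. h n x) \<longlonglongrightarrow> 0" using lim
    proof eventually_elim
      case (elim x)
      have "(\<lambda>n. h n x) \<longlonglongrightarrow> \<bar>signed_pow r (g x) - signed_pow r (g x - g x) - signed_pow r (g x)\<bar> powr (r / (r
          - 1))"
        unfolding h_def using r by (intro tendsto_diff tendsto_abs_powr tendsto_signed_pow elim tendsto_const)
            auto
      then show ?case using r by simp
    qed
    then show "AE x in M. (\<lambda>n. h n x) \<longlonglongrightarrow> 0" .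
    fix \<epsilon> :: real assume "0 < \<epsilon>"
    from brezis_lieb_signed_pow_pointwise[OF r this] obtain C where "C \<ge> 0"
      "\<And>a b. \<bar>signed_pow r (a + b) - signed_pow r a - signed_pow r b\<bar> powr (r / (r - 1))
          \<le> \<epsilon> * \<bar>a\<bar> powr r + C * \<bar>b\<bar> powr r" by blast
    with this(2)[of "f n x - g x" "g x" for n x]
    show "\<exists>C\<ge>0. \<forall>n x. h n x \<le> \<epsilon> * \<bar>f n x - g x\<bar> powr r + C * \<bar>g x\<bar> powr r"
      unfolding h_def by (intro exI[of _ C]) simp
    then show "\<exists>C\<ge>0. \<forall>n x. h n x \<le> \<epsilon> * \<bar>f n x - g x\<bar> powr r + C * \<bar>g x\<bar> powr r" .
  qed (use dif g in \<open>auto simp: h_def dest: LfunD\<close>)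
  then show "(\<lambda>x. signed_pow r (f n x) - signed_pow r (f n x - g x) - signed_pow r (g x))
      \<in> Lfun (r / (r - 1)) M"
    "(\<lambda>n. Lint (r / (r - 1)) M (\<lambda>x. signed_pow r (f n x) - signed_pow r (f n x - g x) - signed_pow r (g x)))
        \<longlonglongrightarrow> 0"
    by (simp_all add: Lfun_def Lint_def h_def)
qed

lemma integrable_signed_pow_mult:
  assumes "1 < r" "f \<in> Lfun r M" "g \<in> Lfun r M"
  shows "integrable M (\<lambda>x. signed_pow r (f x) * g x)"
  by (rule Hoelder_inequality(1)[OF assms(1) Lfun_signed_pow(1) assms(3)]) (use assms in auto)

text \<open>A weighted Young inequality puts an arbitrarily small coefficient on the bounded moving
  powers and the large one on the fixed test function, so the almost dominated convergence lemma
  applies again.\<close>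

lemma signed_pow_weak_tendsto:
  assumes r: "1 < r" and f: "\<And>n. f n \<in> Lfun r M" "\<And>n. Lint r M (f n) \<le> K" and g: "g \<in> Lfun r M"
    and lim: "AE x in M. (\<lambda>n. f n x) \<longlonglongrightarrow> g x" and \<phi>: "\<phi> \<in> Lfun r M"
  shows "(\<lambda>n. LINT x|M. signed_pow r (f n x) * \<phi> x) \<longlonglongrightarrow> (LINT x|M. signed_pow r (g x) * \<phi> x)"
proof -
  have r0: "0 < r" using r by simp
  note [measurable] = LfunD(1)[OF f(1)] LfunD(1)[OF g] LfunD(1)[OF \<phi>]
  define r' where "r' = r / (r - 1)"
  have r': "1 < r'" "1 / r' + 1 / r = 1" "(r - 1) * r' = r" using r by (auto simp: r'_def field_simps)
  define h where "h = (\<lambda>n x. \<bar>signed_pow r (f n x) - signed_pow r (g x)\<bar> * \<bar>\<phi> x\<bar>)"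
  have hA: "h n x \<le> \<epsilon> * (\<bar>f n x\<bar> powr r + \<bar>g x\<bar> powr r) + ((2 / \<epsilon> powr (1 / r')) powr r) * \<bar>\<phi> x\<bar> powr r"
    if e: "0 < \<epsilon>" for n x \<epsilon>
  proof -
    \<comment> \<open>Chosen so that \<open>c powr r' * 2 powr r'\<close> equals
      \<open>\<epsilon>\<close>, where \<open>2 powr r'\<close> comes from separating the two signed
      powers.\<close>
    define c where "c = \<epsilon> powr (1 / r') / 2"
    have c: "0 < c" using e by (simp add: c_def)
    have cr: "c powr r' * 2 powr r' = \<epsilon>" using e r' by (simp add: c_def powr_divide powr_powr)
    have "h n x = (c * \<bar>signed_pow r (f n x) - signed_pow r (g x)\<bar>) * (\<bar>\<phi> x\<bar> / c)"
      using c by (simp add: h_def)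
    also have "\<dots> \<le> (c * \<bar>signed_pow r (f n x) - signed_pow r (g x)\<bar>) powr r' / r' + (\<bar>\<phi> x\<bar> / c) powr r / r"
      using c by (intro Youngs_inequality r r') auto
    also have "\<dots> \<le> (c * \<bar>signed_pow r (f n x) - signed_pow r (g x)\<bar>) powr r' + (\<bar>\<phi> x\<bar> / c) powr r"
      using r r' by (intro add_mono) (simp_all add: divide_le_eq mult_le_cancel_left1)
    also have "(c * \<bar>signed_pow r (f n x) - signed_pow r (g x)\<bar>) powr r'
        = c powr r' * \<bar>signed_pow r (f n x) - signed_pow r (g x)\<bar> powr r'"
      using c by (simp add: powr_mult)
    also have "\<dots> \<le> c powr r' * (2 powr r' * (\<bar>signed_pow r (f n x)\<bar> powr r' + \<bar>signed_pow r (g x)\<bar> powr r'))"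
      using r' by (intro mult_left_mono abs_diff_powr_le) auto
    also have "\<dots> = \<epsilon> * (\<bar>f n x\<bar> powr r + \<bar>g x\<bar> powr r)"
      unfolding mult.assoc[symmetric] cr abs_signed_pow by (simp add: powr_powr r'(3))
    also have "(\<bar>\<phi> x\<bar> / c) powr r = ((2 / \<epsilon> powr (1 / r')) powr r) * \<bar>\<phi> x\<bar> powr r"
      using e by (subst powr_mult[symmetric]) (auto simp: c_def mult.commute)
    finally show ?thesis by simp
  qed
  have "(\<lambda>n. LINT x|M. h n x) \<longlonglongrightarrow> 0"
  proof (rule integral_tendsto_0_eps_dominated(2)[where A="\<lambda>n x. \<bar>f n x\<bar> powr r + \<bar>g x\<bar> powr r"
      and B="\<lambda>x. \<bar>\<phi> x\<bar> powr r"
        and K="K + Lint r M g"])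
    show "(LINT x|M. \<bar>f n x\<bar> powr r + \<bar>g x\<bar> powr r) \<le> K + Lint r M g" for n
      using f(2)[of n] f(1)[of n] g by (simp add: Lint_def LfunD)
    show "AE x in M. (\<lambda>n. h n x) \<longlonglongrightarrow> 0" using lim
    proof eventually_elim
      case (elim x)
      have "(\<lambda>n. h n x) \<longlonglongrightarrow> \<bar>signed_pow r (g x) - signed_pow r (g x)\<bar> * \<bar>\<phi> x\<bar>"
        unfolding h_def using r by (intro tendsto_intros tendsto_signed_pow elim) auto
      then show ?case by simp
    qed
    fix \<epsilon> :: real assume "0 < \<epsilon>"
    from hA[OF this] show "\<exists>C\<ge>0. \<forall>n x. h n x \<le> \<epsilon> * (\<bar>f n x\<bar> powr r + \<bar>g x\<bar> powr r) + C * \<bar>\<phi> x\<bar> powr r"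
      by (intro exI[of _ "(2 / \<epsilon> powr (1 / r')) powr r"]) auto
  qed (use f g \<phi> in \<open>auto simp: h_def LfunD\<close>)
  moreover have "norm ((LINT x|M. signed_pow r (f n x) * \<phi> x) - (LINT x|M. signed_pow r (g x) * \<phi> x))
      \<le> (LINT x|M. h n x)" for n
  proof -
    have "(LINT x|M. signed_pow r (f n x) * \<phi> x) - (LINT x|M. signed_pow r (g x) * \<phi> x)
      = (LINT x|M. (signed_pow r (f n x) - signed_pow r (g x)) * \<phi> x)"
      unfolding left_diff_distrib using integrable_signed_pow_mult[OF r f(1)[of n] \<phi>]
          integrable_signed_pow_mult[OF r g \<phi>] by simp
    then show ?thesis unfolding h_def abs_mult[symmetric] real_norm_def by (simp only: integral_abs_bound)
  qed
  ultimately have "(\<lambda>n. (LINT x|M. signed_pow r (f n x) * \<phi> x) - (LINT x|M. signed_pow r (g x) * \<phi> x)) \<longlonglongrightarrow> 0"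
    by - (rule Lim_null_comparison[where g="\<lambda>n. LINT x|M. h n x"], auto)
  then show ?thesis by (simp add: LIM_zero_iff)
qed

section \<open>Directional derivatives and uniform convexity of the integral functional\<close>

lemma has_real_derivative_abs_powr:
  assumes "1 < r" shows "((\<lambda>t. \<bar>t\<bar> powr r) has_real_derivative r * signed_pow r t) (at t)"
proof -
  consider "t > 0" | "t < 0" | "t = 0" by linarith
  then show ?thesis
  proof cases
    case 1
    have "((\<lambda>t. t powr r) has_real_derivative r * t powr (r - 1)) (at t)"
      using 1 by (auto intro!: derivative_eq_intros simp: powr_diff)
    then have "((\<lambda>t. \<bar>t\<bar> powr r) has_real_derivative r * t powr (r - 1)) (at t)"
      by (rule DERIV_cong_ev[THEN iffD1, rotated -1])
         (use 1 eventually_nhds_in_open[of "{0<..}" t] in \<open>auto elim: eventually_mono\<close>)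
    then show ?thesis using 1 by (simp add: signed_pow_eq)
  next
    case 2
    have "((\<lambda>t. (-t) powr r) has_real_derivative - (r * (-t) powr (r - 1))) (at t)"
      using 2 by (auto intro!: derivative_eq_intros simp: powr_diff)
    then have "((\<lambda>t. \<bar>t\<bar> powr r) has_real_derivative - (r * (-t) powr (r - 1))) (at t)"
      by (rule DERIV_cong_ev[THEN iffD1, rotated -1])
         (use 2 eventually_nhds_in_open[of "{..<0}" t] in \<open>auto elim: eventually_mono\<close>)
    then show ?thesis using 2 by (simp add: signed_pow_eq)
  next
    case 3
    \<comment> \<open>At the origin the difference quotient is itself a signed power, so its
      continuity gives the derivative \<open>0\<close>, also for \<open>r < 2\<close>.\<close>
    have "((\<lambda>h. signed_pow r h) \<longlongrightarrow> signed_pow r 0) (at 0)"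
      by (intro tendsto_signed_pow assms tendsto_ident_at)
    moreover have "eventually (\<lambda>h. signed_pow r h = \<bar>h\<bar> powr r / h) (at 0)"
      by (auto simp: eventually_at_filter signed_pow_mult_self[symmetric])
    ultimately have "((\<lambda>h. \<bar>h\<bar> powr r / h) \<longlongrightarrow> 0) (at 0)"
      using Lim_transform_eventually by fastforce
    then show ?thesis using 3 by (simp add: DERIV_def)
  qed
qed

lemma abs_powr_diff_le:
  fixes a b r :: real
  assumes "1 < r"
  shows "\<bar>\<bar>a + b\<bar> powr r - \<bar>a\<bar> powr r\<bar> \<le> r * \<bar>b\<bar> * (\<bar>a\<bar> + \<bar>b\<bar>) powr (r - 1)"
proof -
  have "norm (\<bar>a + b\<bar> powr r - \<bar>a\<bar> powr r) \<le> r * (\<bar>a\<bar> + \<bar>b\<bar>) powr (r - 1) * norm (a + b - a)"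
  proof (rule field_differentiable_bound[where S="closed_segment a (a + b)"])
    fix z assume "z \<in> closed_segment a (a + b)"
    then have z: "\<bar>z\<bar> \<le> \<bar>a\<bar> + \<bar>b\<bar>" by (auto simp: closed_segment_eq_real_ivl split: if_splits)
    show "((\<lambda>t. \<bar>t\<bar> powr r) has_field_derivative r * signed_pow r z) (at z within closed_segment a (a + b))"
      by (rule DERIV_subset[OF has_real_derivative_abs_powr[OF assms]]) auto
    show "norm (r * signed_pow r z) \<le> r * (\<bar>a\<bar> + \<bar>b\<bar>) powr (r - 1)"
      using assms z by (auto simp: abs_mult abs_signed_pow intro!: mult_left_mono powr_mono2)
  qed auto
  then show ?thesis by (simp add: mult_ac)
qed

text \<open>The mean value bound with \<open>\<bar>t n\<bar> \<le> 1\<close> gives a majorant of the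
  difference quotients that is independent of \<open>n\<close>. Directional derivatives suffice here
  because they only serve to identify a Frechet derivative that is already given.\<close>

lemma Lint_gateaux_derivative:
  assumes r: "1 < r" and f: "f \<in> Lfun r M" and g: "g \<in> Lfun r M"
    and t: "t \<longlonglongrightarrow> (0::real)" "\<And>n. t n \<noteq> 0" "\<And>n. \<bar>t n\<bar> \<le> 1"
  shows "(\<lambda>n. (Lint r M (\<lambda>x. f x + t n * g x) - Lint r M f) / t n) \<longlonglongrightarrow> r * (LINT x|M. signed_pow r (f x) * g x)"
proof -
  have r0: "0 < r" using r by simp
  note [measurable] = LfunD(1)[OF f] LfunD(1)[OF g]
  define w where "w = (\<lambda>x. r * (\<bar>f x\<bar> + \<bar>g x\<bar>) powr r)"
  have dom: "norm ((\<bar>f x + t n * g x\<bar> powr r - \<bar>f x\<bar> powr r) / t n) \<le> w x" for n x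
  proof -
    have tg: "\<bar>t n * g x\<bar> \<le> \<bar>g x\<bar>" using t(3)[of n] by (simp add: abs_mult mult_left_le_one_le)
    have "\<bar>\<bar>f x + t n * g x\<bar> powr r - \<bar>f x\<bar> powr r\<bar> \<le> r * \<bar>t n * g x\<bar> * (\<bar>f x\<bar> + \<bar>t n * g x\<bar>) powr (r - 1)"
      by (rule abs_powr_diff_le[OF r])
    also have "\<dots> \<le> r * \<bar>t n * g x\<bar> * (\<bar>f x\<bar> + \<bar>g x\<bar>) powr (r - 1)"
      using r tg by (intro mult_left_mono powr_mono2) auto
    also have "\<dots> = \<bar>t n\<bar> * (r * (\<bar>g x\<bar> * (\<bar>f x\<bar> + \<bar>g x\<bar>) powr (r - 1)))" by (simp add: abs_mult)
    also have "\<dots> \<le> \<bar>t n\<bar> * (r * ((\<bar>f x\<bar> + \<bar>g x\<bar>) * (\<bar>f x\<bar> + \<bar>g x\<bar>) powr (r - 1)))"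
      using r by (intro mult_left_mono mult_right_mono) auto
    also have "(\<bar>f x\<bar> + \<bar>g x\<bar>) * (\<bar>f x\<bar> + \<bar>g x\<bar>) powr (r - 1) = (\<bar>f x\<bar> + \<bar>g x\<bar>) powr r"
      using powr_mult_base[of "\<bar>f x\<bar> + \<bar>g x\<bar>" "r - 1"] by simp
    finally show ?thesis using t(2)[of n] by (simp add: w_def abs_divide divide_le_eq mult_ac)
  qed
  have "(\<lambda>n. LINT x|M. (\<bar>f x + t n * g x\<bar> powr r - \<bar>f x\<bar> powr r) / t n)
      \<longlonglongrightarrow> (LINT x|M. r * (signed_pow r (f x) * g x))"
  proof (rule integral_dominated_convergence[where w=w])
    have "(\<lambda>x. \<bar>f x\<bar>) \<in> Lfun r M" "(\<lambda>x. \<bar>g x\<bar>) \<in> Lfun r M" using f g by (auto simp: Lfun_def)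
    from Lfun_add[OF r0 this] show "integrable M w" by (auto simp: w_def Lfun_def)
    show "AE x in M. (\<lambda>n. (\<bar>f x + t n * g x\<bar> powr r - \<bar>f x\<bar> powr r) / t n) \<longlonglongrightarrow> r * (signed_pow r (f x) * g x)"
    proof (rule AE_I2)
      fix x
      have "((\<lambda>h. \<bar>f x + h * g x\<bar> powr r) has_real_derivative (r * signed_pow r (f x + 0 * g x)) * g x) (at 0)"
        by (rule DERIV_chain2[OF has_real_derivative_abs_powr[OF r]]) (auto intro!: derivative_eq_intros)
      then have "((\<lambda>h. (\<bar>f x + h * g x\<bar> powr r - \<bar>f x\<bar> powr r) / h) \<longlongrightarrow> r * signed_pow r (f x) * g x) (at 0)"
        by (simp add: DERIV_def)
      moreover have "filterlim t (at 0) sequentially" using t by (auto simp: filterlim_at)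
      ultimately have "(\<lambda>n. (\<bar>f x + t n * g x\<bar> powr r - \<bar>f x\<bar> powr r) / t n) \<longlonglongrightarrow> r * signed_pow r (f x) * g x"
        by (rule filterlim_compose)
      then show "(\<lambda>n. (\<bar>f x + t n * g x\<bar> powr r - \<bar>f x\<bar> powr r) / t n) \<longlonglongrightarrow> r * (signed_pow r (f x) * g x)"
        by (simp add: mult.assoc)
    qed
  qed (use dom in \<open>auto intro!: AE_I2\<close>)
  moreover have "(LINT x|M. (\<bar>f x + t n * g x\<bar> powr r - \<bar>f x\<bar> powr r) / t n)
      = (Lint r M (\<lambda>x. f x + t n * g x) - Lint r M f) / t n" for n
    unfolding Lint_def using LfunD(2)[OF Lfun_add[OF r0 f Lfun_cmult[OF g, of "t n"]]] LfunD(2)[OF f] by simp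
  ultimately show ?thesis by (simp only: integral_mult_right_zero)
qed

text \<open>The pointwise inequality is integrated; \<open>C\<close> depends on
  \<open>\<epsilon>\<close> but not on the functions, which is what makes nearly minimising
  sequences Cauchy later.\<close>

lemma Lint_uniform_convexity:
  assumes r: "1 < r" and e: "0 < \<epsilon>"
  shows "\<exists>C\<ge>0. \<forall>f\<in>Lfun r M. \<forall>g\<in>Lfun r M. Lint r M (\<lambda>x. f x - g x) \<le> \<epsilon> * (Lint r M f + Lint r M g)
            + C * ((Lint r M f + Lint r M g) / 2 - Lint r M (\<lambda>x. (f x + g x) / 2))"
proof -
  have r0: "0 < r" using r by simp
  obtain C where C: "C \<ge> 0" "\<And>a b. \<bar>a - b\<bar> powr r \<le> \<epsilon> * (\<bar>a\<bar> powr r + \<bar>b\<bar> powr r)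
            + C * ((\<bar>a\<bar> powr r + \<bar>b\<bar> powr r) / 2 - \<bar>(a + b) / 2\<bar> powr r)"
    using powr_uniform_convexity[OF r e] by blast
  have "Lint r M (\<lambda>x. f x - g x) \<le> \<epsilon> * (Lint r M f + Lint r M g)
            + C * ((Lint r M f + Lint r M g) / 2 - Lint r M (\<lambda>x. (f x + g x) / 2))"
    if f: "f \<in> Lfun r M" and g: "g \<in> Lfun r M" for f g
  proof -
    have i[simp]: "integrable M (\<lambda>x. \<bar>f x\<bar> powr r)" "integrable M (\<lambda>x. \<bar>g x\<bar> powr r)"
       "integrable M (\<lambda>x. \<bar>(f x + g x) / 2\<bar> powr r)" "integrable M (\<lambda>x. \<bar>f x - g x\<bar> powr r)"
      using LfunD(2)[OF f] LfunD(2)[OF g] LfunD(2)[OF Lfun_diff[OF r0 f g]]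
        LfunD(2)[OF Lfun_cmult[OF Lfun_add[OF r0 f g], of "1/2"]] by (simp_all add: mult.commute)
    have "(LINT x|M. \<bar>f x - g x\<bar> powr r) \<le> (LINT x|M. \<epsilon> * (\<bar>f x\<bar> powr r + \<bar>g x\<bar> powr r)
            + C * ((\<bar>f x\<bar> powr r + \<bar>g x\<bar> powr r) / 2 - \<bar>(f x + g x) / 2\<bar> powr r))"
      by (intro integral_mono C(2)) (use i in \<open>simp_all only: Bochner_Integration.integrable_add
          Bochner_Integration.integrable_diff integrable_mult_right integrable_divide\<close>)
    also have "\<dots> = \<epsilon> * (Lint r M f + Lint r M g)
            + C * ((Lint r M f + Lint r M g) / 2 - Lint r M (\<lambda>x. (f x + g x) / 2))"
      unfolding Lint_def using i by (simp del: abs_divide add: Bochner_Integration.integral_add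
          Bochner_Integration.integral_diff)
    finally show ?thesis by (simp add: Lint_def)
  qed
  with C(1) show ?thesis by blast
qed

section \<open>Scaling of the three quotients\<close>

lemma nn_integral_lborel_scale:
  fixes h :: "'b::euclidean_space \<Rightarrow> ennreal"
  assumes [measurable]: "h \<in> borel_measurable borel" and r: "0 < r"
  shows "(\<integral>\<^sup>+x. h (x /\<^sub>R r) \<partial>lborel) = ennreal (r ^ DIM('b)) * (\<integral>\<^sup>+x. h x \<partial>lborel)"
proof -
  have "(\<integral>\<^sup>+x. h (x /\<^sub>R r) \<partial>lborel) = (\<integral>\<^sup>+x. h (x /\<^sub>R r) \<partial>density (distr lborel borel (\<lambda>x. 0
      + r *\<^sub>R x)) (\<lambda>_. ennreal (\<bar>r\<bar> ^ DIM('b))))"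
    using r by (subst lborel_affine[of r 0]) auto
  also have "\<dots> = (\<integral>\<^sup>+x. ennreal (\<bar>r\<bar> ^ DIM('b)) * h x \<partial>lborel)"
    using r by (simp add: nn_integral_density nn_integral_distr)
  finally show ?thesis using r by (simp add: nn_integral_cmult)
qed

lemma integral_lborel_scale:
  fixes h :: "'b::euclidean_space \<Rightarrow> real"
  assumes [measurable]: "h \<in> borel_measurable borel" and r: "0 < r"
  shows "(LINT x|lborel. h (x /\<^sub>R r)) = r ^ DIM('b) * (LINT x|lborel. h x)"
proof -
  have "(LINT x|lborel. h (x /\<^sub>R r)) = (LINT x|density (distr lborel borel (\<lambda>x. 0
      + r *\<^sub>R x)) (\<lambda>_. ennreal (\<bar>r\<bar> ^ DIM('b))). h (x /\<^sub>R r))"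
    using r by (subst lborel_affine[of r 0]) auto
  also have "\<dots> = (LINT x|lborel. \<bar>r\<bar> ^ DIM('b) * h x)"
    using r by (subst integral_density) (auto simp: integral_distr)
  finally show ?thesis using r by simp
qed

lemma nn_integral_lborel_translate:
  fixes h :: "'b::euclidean_space \<Rightarrow> ennreal"
  assumes [measurable]: "h \<in> borel_measurable borel"
  shows "(\<integral>\<^sup>+x. h (c + x) \<partial>lborel) = (\<integral>\<^sup>+x. h x \<partial>lborel)"
proof -
  have "(\<integral>\<^sup>+x. h x \<partial>lborel) = (\<integral>\<^sup>+x. h x \<partial>distr lborel borel ((+) c))"
    by (simp add: lborel_distr_plus)
  then show ?thesis by (simp add: nn_integral_distr)
qed

text \<open>The prefactor is the one that compensates the Jacobian \<open>r ^ DIM('b)\<close> in the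
  power \<open>\<rho>\<close>. The dimension is left generic because the Gagliardo term lives on the
  product space.\<close>

lemma Lint_scale:
  fixes F :: "'b::euclidean_space \<Rightarrow> real"
  assumes r: "0 < r" and \<rho>: "0 < \<rho>" and F: "F \<in> borel_measurable borel"
  defines "c \<equiv> r powr (- (real DIM('b) / \<rho>))"
  shows "(\<lambda>x. c * F (x /\<^sub>R r)) \<in> Lfun \<rho> lborel \<longleftrightarrow> F \<in> Lfun \<rho> lborel"
    and "Lint \<rho> lborel (\<lambda>x. c * F (x /\<^sub>R r)) = Lint \<rho> lborel F"
proof -
  note [measurable] = F
  have "\<bar>c\<bar> powr \<rho> = r powr (- real DIM('b))"
    using \<rho> by (simp add: c_def powr_powr)
  then have c: "\<bar>c\<bar> powr \<rho> = 1 / r ^ DIM('b)"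
    using r by (simp add: powr_minus_divide powr_realpow)
  have n: "(\<integral>\<^sup>+x. ennreal (\<bar>c * F (x /\<^sub>R r)\<bar> powr \<rho>) \<partial>lborel) = (\<integral>\<^sup>+x. ennreal (\<bar>F x\<bar> powr \<rho>) \<partial>lborel)"
  proof -
    have "(\<integral>\<^sup>+x. ennreal (\<bar>c * F (x /\<^sub>R r)\<bar> powr \<rho>) \<partial>lborel)
        = (\<integral>\<^sup>+x. ennreal (1 / r ^ DIM('b)) * ennreal (\<bar>F (x /\<^sub>R r)\<bar> powr \<rho>) \<partial>lborel)"
      using r by (simp add: abs_mult powr_mult c ennreal_mult[symmetric])
    also have "\<dots> = ennreal (1 / r ^ DIM('b)) * (\<integral>\<^sup>+x. ennreal (\<bar>F (x /\<^sub>R r)\<bar> powr \<rho>) \<partial>lborel)"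
      by (intro nn_integral_cmult) measurable
    also have "\<dots> = ennreal (1 / r ^ DIM('b)) * (ennreal (r ^ DIM('b)) * (\<integral>\<^sup>+x. ennreal (\<bar>F x\<bar> powr \<rho>) \<partial>lborel))"
      using r by (subst nn_integral_lborel_scale[of "\<lambda>x. ennreal (\<bar>F x\<bar> powr \<rho>)"]) auto
    also have "\<dots> = (\<integral>\<^sup>+x. ennreal (\<bar>F x\<bar> powr \<rho>) \<partial>lborel)"
      using r by (simp add: mult.assoc[symmetric] ennreal_mult[symmetric])
    finally show ?thesis .
  qed
  show "(\<lambda>x. c * F (x /\<^sub>R r)) \<in> Lfun \<rho> lborel \<longleftrightarrow> F \<in> Lfun \<rho> lborel"
    using n by (simp add: Lfun_def integrable_iff_bounded)
  show "Lint \<rho> lborel (\<lambda>x. c * F (x /\<^sub>R r)) = Lint \<rho> lborel F"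
    unfolding Lint_def using n by (subst (1 2) integral_eq_nn_integral) auto
qed

lemma integral_signed_pow_scale:
  fixes F G :: "'b::euclidean_space \<Rightarrow> real"
  assumes r: "0 < r" and \<rho>: "0 < \<rho>" and [measurable]: "F \<in> borel_measurable borel" "G \<in> borel_measurable borel"
  defines "c \<equiv> r powr (- (real DIM('b) / \<rho>))"
  shows "(LINT x|lborel. signed_pow \<rho> (c * F (x /\<^sub>R r)) * (c * G (x /\<^sub>R r)))
      = (LINT x|lborel. signed_pow \<rho> (F x) * G x)"
proof -
  have c0: "0 < c" using r by (simp add: c_def)
  have "c powr \<rho> = r powr (- real DIM('b))"
    using \<rho> by (simp add: c_def powr_powr)
  then have c: "c powr \<rho> = 1 / r ^ DIM('b)"
    using r by (simp add: powr_minus_divide powr_realpow)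
  have c1: "c powr (\<rho> - 1) * c = 1 / r ^ DIM('b)"
    unfolding c[symmetric] using c0 by (simp add: powr_diff)
  have "signed_pow \<rho> (c * F y) * (c * G y) = c powr (\<rho> - 1) * c * (signed_pow \<rho> (F y) * G y)" for y
    using c0 by (simp add: signed_pow_scale)
  then have "(LINT x|lborel. signed_pow \<rho> (c * F (x /\<^sub>R r)) * (c * G (x /\<^sub>R r)))
      = 1 / r ^ DIM('b) * (LINT x|lborel. signed_pow \<rho> (F (x /\<^sub>R r)) * G (x /\<^sub>R r))"
    unfolding c1 by simp
  also have "\<dots> = (LINT x|lborel. signed_pow \<rho> (F x) * G x)"
    using r by (subst integral_lborel_scale[of "\<lambda>x. signed_pow \<rho> (F x) * G x"]) auto
  finally show ?thesis .
qed

section \<open>The difference quotient and the weighted quotients, and their behaviour under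
  dilation\<close>

definition gag_quot :: "real \<Rightarrow> real \<Rightarrow> ('a::euclidean_space \<Rightarrow> real) \<Rightarrow> 'a \<times> 'a \<Rightarrow> real" where
  "gag_quot s p u z = (u (fst z) - u (snd z)) / norm (fst z - snd z) powr ((real DIM('a) + s * p) / p)"

text \<open>The weight exponent is the one before the outer power is taken: \<open>a = s\<close>
  with power \<open>p\<close> gives the Hardy weight, \<open>a = \<alpha> / q\<close> with power
  \<open>q\<close> the critical weight.\<close>

definition wquot :: "real \<Rightarrow> ('a::euclidean_space \<Rightarrow> real) \<Rightarrow> 'a \<Rightarrow> real" where
  "wquot a u x = u x / norm x powr a"

lemma borel_measurable_gag_quot [measurable]:
  "u \<in> borel_measurable borel \<Longrightarrow> gag_quot s p u \<in> borel_measurable borel"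
proof -
  assume [measurable]: "u \<in> borel_measurable borel"
  have "gag_quot s p u \<in> borel_measurable (borel \<Otimes>\<^sub>M borel)"
    unfolding gag_quot_def[abs_def] by measurable
  then show ?thesis by (simp add: borel_prod)
qed

lemma borel_measurable_wquot [measurable]:
  "u \<in> borel_measurable borel \<Longrightarrow> wquot a u \<in> borel_measurable borel"
  unfolding wquot_def[abs_def]
  by (intro borel_measurable_divide powr_real_measurable borel_measurable_norm borel_measurable_const
      measurable_ident)

lemma gag_quot_powr:
  fixes u :: "'a::euclidean_space \<Rightarrow> real"
  assumes "0 < p"
  shows "\<bar>gag_quot s p u z\<bar> powr p = \<bar>u (fst z) - u (snd z)\<bar> powr p / norm (fst z - snd z) powr (real DIM('a)
      + s * p)"
  using assms by (simp add: gag_quot_def abs_divide powr_divide powr_powr)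

lemma signed_pow_gag_quot:
  fixes u \<phi> :: "'a::euclidean_space \<Rightarrow> real"
  assumes "0 < p"
  shows "signed_pow p (gag_quot s p u z) * gag_quot s p \<phi> z =
     \<bar>u (fst z) - u (snd z)\<bar> powr (p - 2) * (u (fst z) - u (snd z)) * (\<phi> (fst z) - \<phi> (snd z))
          / norm (fst z - snd z) powr (real DIM('a) + s * p)"
proof (cases "fst z = snd z")
  case False
  define k where "k = norm (fst z - snd z) powr ((real DIM('a) + s * p) / p)"
  have k: "0 < k" using False by (simp add: k_def)
  have "k powr p = norm (fst z - snd z) powr (real DIM('a) + s * p)"
    using assms by (simp add: k_def powr_powr)
  moreover have "k powr p = k powr (p - 2) * k * k"
    using k by (simp add: powr_diff powr_numeral power2_eq_square)
  ultimately show ?thesis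
    using k by (simp add: gag_quot_def k_def[symmetric] signed_pow_def abs_divide powr_divide)
qed (simp add: gag_quot_def)

lemma wquot_powr:
  assumes "0 < \<rho>" shows "\<bar>wquot a u x\<bar> powr \<rho> = \<bar>u x\<bar> powr \<rho> / norm x powr (a * \<rho>)"
  using assms by (simp add: wquot_def abs_divide powr_divide powr_powr)

lemma signed_pow_wquot:
  assumes "0 < \<rho>"
  shows "signed_pow \<rho> (wquot a u x) * wquot a \<phi> x = \<bar>u x\<bar> powr (\<rho> - 2) * u x / norm x powr (a * \<rho>) * \<phi> x"
proof (cases "x = 0")
  case False
  define k where "k = norm x powr a"
  have k: "0 < k" using False by (simp add: k_def)
  have "k powr \<rho> = norm x powr (a * \<rho>)"
    using assms by (simp add: k_def powr_powr)
  moreover have "k powr \<rho> = k powr (\<rho> - 2) * k * k"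
    using k by (simp add: powr_diff powr_numeral power2_eq_square)
  ultimately show ?thesis
    using k by (simp add: wquot_def k_def[symmetric] signed_pow_def abs_divide powr_divide)
qed (simp add: wquot_def)

lemma gag_quot_add: "gag_quot s p (\<lambda>x. u x + v x) z = gag_quot s p u z + gag_quot s p v z"
  by (simp add: gag_quot_def add_divide_distrib[symmetric] algebra_simps)

lemma gag_quot_diff: "gag_quot s p (\<lambda>x. u x - v x) z = gag_quot s p u z - gag_quot s p v z"
  by (simp add: gag_quot_def diff_divide_distrib[symmetric] algebra_simps)

lemma gag_quot_cmult: "gag_quot s p (\<lambda>x. c * u x) z = c * gag_quot s p u z"
  by (simp add: gag_quot_def right_diff_distrib[symmetric])

lemma wquot_add: "wquot a (\<lambda>x. u x + v x) z = wquot a u z + wquot a v z"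
  by (simp add: wquot_def add_divide_distrib)

lemma wquot_diff: "wquot a (\<lambda>x. u x - v x) z = wquot a u z - wquot a v z"
  by (simp add: wquot_def diff_divide_distrib)

lemma wquot_cmult: "wquot a (\<lambda>x. c * u x) z = c * wquot a u z"
  by (simp add: wquot_def)

text \<open>The exponents \<open>(d - s p) / p\<close> of the dilation and
  \<open>(d + s p) / p\<close> of the kernel add up to \<open>2 d / p\<close>, the scaling that
  preserves the power \<open>p\<close> on the product space.\<close>

lemma gag_quot_rescale:
  fixes u :: "'a::euclidean_space \<Rightarrow> real"
  assumes r: "0 < r" and p: "0 < p"
  shows "gag_quot s p (rescale s p r u) = (\<lambda>z. r powr (- (real DIM('a \<times> 'a) / p)) * gag_quot s p u (z /\<^sub>R r))"
proof
  fix z :: "'a \<times> 'a"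
  define e where "e = (real DIM('a) + s * p) / p"
  define n where "n = norm (fst z /\<^sub>R r - snd z /\<^sub>R r)"
  have n: "norm (fst z - snd z) = r * n"
    using r by (simp add: n_def scaleR_diff_right[symmetric])
  have e: "(r * n) powr e = r powr e * n powr e" by (simp only: powr_mult)
  define k where "k = - ((real DIM('a) - s * p) / p)"
  have "k - e = - (real DIM('a \<times> 'a) / p)"
    using p by (simp add: e_def k_def field_simps)
  then have c: "r powr (- (real DIM('a \<times> 'a) / p)) = r powr k / r powr e" by (metis powr_diff)
  show "gag_quot s p (rescale s p r u) z = r powr (- (real DIM('a \<times> 'a) / p)) * gag_quot s p u (z /\<^sub>R r)"
    unfolding gag_quot_def rescale_def n e_def[symmetric] fst_scaleR snd_scaleR n_def[symmetric] c e
        k_def[symmetric]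
      right_diff_distrib[symmetric] by simp
qed

text \<open>The hypothesis on exponents is the balance between dilation, weight and Jacobian; it
  holds for \<open>(s, p)\<close> and, by the choice of \<open>q\<close>, for
  \<open>(\<alpha> / q, q)\<close>.\<close>

lemma wquot_rescale:
  fixes u :: "'a::euclidean_space \<Rightarrow> real"
  assumes r: "0 < r" and e: "(real DIM('a) - s * p) / p + a = real DIM('a) / \<rho>"
  shows "wquot a (rescale s p r u) = (\<lambda>z. r powr (- (real DIM('a) / \<rho>)) * wquot a u (z /\<^sub>R r))"
proof
  fix z :: 'a
  define e where "e = - ((real DIM('a) - s * p) / p)"
  define n where "n = norm (z /\<^sub>R r)"
  have "norm z = r * n" using r by (simp add: n_def)
  then have n: "norm z powr a = r powr a * n powr a" using r by (simp only: powr_mult)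
  have "e - a = - (real DIM('a) / \<rho>)" using e by (simp add: e_def)
  then have c: "r powr (- (real DIM('a) / \<rho>)) = r powr e / r powr a" by (metis powr_diff)
  show "wquot a (rescale s p r u) z = r powr (- (real DIM('a) / \<rho>)) * wquot a u (z /\<^sub>R r)"
    unfolding wquot_def rescale_def e_def[symmetric] n_def[symmetric] n c by simp
qed

lemma rescale_rescale:
  fixes u :: "'a::euclidean_space \<Rightarrow> real"
  assumes "0 < a" "0 < b" shows "rescale s p a (rescale s p b u) = rescale s p (a * b) u"
proof
  fix x :: 'a
  define e where "e = - ((real DIM('a) - s * p) / p)"
  have "(a * b) powr e = a powr e * b powr e" using assms by (simp only: powr_mult)
  moreover have "x /\<^sub>R a /\<^sub>R b = x /\<^sub>R (a * b)"
    unfolding scaleR_scaleR by (metis inverse_mult_distrib mult.commute)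
  ultimately show "rescale s p a (rescale s p b u) x = rescale s p (a * b) u x"
    unfolding rescale_def e_def[symmetric] by (metis mult.assoc)
qed

lemma rescale_1: "rescale s p 1 u = u"
  by (simp add: rescale_def)

lemma rescale_diff: "rescale s p r (\<lambda>x. u x - v x) = (\<lambda>x. rescale s p r u x - rescale s p r v x)"
  by (simp add: rescale_def right_diff_distrib)

lemma borel_measurable_rescale [measurable]:
  fixes u :: "'a::euclidean_space \<Rightarrow> real"
  assumes "u \<in> borel_measurable borel" shows "rescale s p r u \<in> borel_measurable borel"
proof -
  have "(\<lambda>x::'a. x /\<^sub>R r) \<in> borel_measurable borel"
    by (intro borel_measurable_continuous_onI continuous_intros)
  from measurable_compose[OF this assms] show ?thesis unfolding rescale_def by simp
qed

text \<open>The exceptional set lies in two strips over a null set. This carries almost everywhere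
  convergence of functions over to their difference quotients.\<close>

lemma AE_lborel_fst_snd:
  fixes P :: "'a::euclidean_space \<Rightarrow> bool"
  assumes "AE x in lborel. P x"
  shows "AE z in (lborel :: ('a \<times> 'a) measure). P (fst z) \<and> P (snd z)"
proof -
  obtain N where N: "N \<in> null_sets lborel" "{x. \<not> P x} \<subseteq> N"
    using assms by (auto elim!: AE_E simp: null_sets_def)
  have 1: "N \<times> UNIV \<in> null_sets (lborel \<Otimes>\<^sub>M (lborel :: 'a measure))"
    using N by (auto simp: null_sets_def lborel.emeasure_pair_measure_Times)
  have 2: "UNIV \<times> N \<in> null_sets (lborel \<Otimes>\<^sub>M (lborel :: 'a measure))"
    using N by (auto simp: null_sets_def lborel.emeasure_pair_measure_Times)
  have "N \<times> UNIV \<union> UNIV \<times> N \<in> null_sets (lborel :: ('a \<times> 'a) measure)"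
    using null_sets.Un[OF 1 2] by (simp add: lborel_prod)
  then show ?thesis by (rule AE_I') (use N in auto)
qed

section \<open>Sobolev inequality from the Hardy inequality\<close>

lemma ball_sets_borel [measurable]: "ball (x::'b::metric_space) R \<in> sets borel" "cball (x::'b::metric_space) R
    \<in> sets borel"
  by (simp_all add: borel_open borel_closed)

text \<open>The hypothesis holds for every radius; inserting the best one eliminates
  \<open>R\<close> and leaves a power of \<open>a\<close>, with the exponent that becomes the
  Sobolev exponent.\<close>

lemma powr_balance:
  fixes a \<gamma> m \<sigma> d :: real
  assumes pos: "0 < a" "0 < m" "0 < \<sigma>" "\<sigma> < d"
    and le: "\<And>R. 0 < R \<Longrightarrow> R powr d * a \<le> R powr (d + \<sigma>) * \<gamma> + R powr \<sigma> / m"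
  shows "(m * a / 2) powr (d / (d - \<sigma>)) / m \<le> \<gamma>"
proof -
  define b where "b = m * a / 2"
  have b: "0 < b" using pos by (simp add: b_def)
  \<comment> \<open>At this radius the last term of the hypothesis is half of its left side, so the
    term with \<open>\<gamma>\<close> must account for the other half.\<close>
  define R where "R = b powr (- 1 / (d - \<sigma>))"
  have R: "0 < R" using b by (simp add: R_def)
  have "R powr (d - \<sigma>) = b powr - 1" using pos by (simp add: R_def powr_powr)
  then have R1: "R powr (d - \<sigma>) = 1 / b" using b by (simp add: powr_minus_divide)
  have R2: "R powr d = R powr \<sigma> / b"
    using R1 powr_add[of R \<sigma> "d - \<sigma>"] by simp
  have "R powr d = b powr (- (d / (d - \<sigma>)))"
    by (simp add: R_def powr_powr)
  then have R3: "R powr d = 1 / b powr (d / (d - \<sigma>))"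
    by (simp add: powr_minus_divide)
  have "R powr \<sigma> * (a / b) \<le> R powr \<sigma> * (R powr d * \<gamma> + 1 / m)"
    using le[OF R] by (simp add: powr_add R2 algebra_simps)
  then have "a / b \<le> R powr d * \<gamma> + 1 / m" using R by (simp only: mult_le_cancel_left_pos powr_gt_zero)
  moreover have "a / b = 2 / m" using pos by (simp add: b_def)
  ultimately have "1 / m \<le> R powr d * \<gamma>" by simp
  then have "1 / m \<le> \<gamma> / b powr (d / (d - \<sigma>))" by (simp add: R3)
  then show ?thesis using b pos unfolding b_def[symmetric] by (simp add: field_simps)
qed

text \<open>
  The exponents are parameters rather than abbreviations, since a term that mentions \<open>'a\<close> only through
  \<open>DIM('a)\<close> would turn into a function of \<open>'a itself\<close>.  Throughout, \<open>NN\<close>, \<open>HH\<close>, \<open>BB\<close> are the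
  \<open>p\<close>-th power of the Gagliardo seminorm, the Hardy integral and the critical integral; \<open>I0\<close> is the
  energy for \<open>f = 0\<close> and \<open>GG u\<close> its derivative at \<open>u\<close>.
\<close>

locale hardy_space =
  fixes s p \<alpha> \<mu> m :: real and ty :: "'a::euclidean_space itself" and d q ps :: real
  assumes d_def: "d = real DIM('a)" and q_def: "q = crit_exp d s p \<alpha>" and ps_def: "ps = crit_exp d s p 0"
    and p: "1 < p" and s: "0 < s" and \<alpha>: "0 < \<alpha>" "\<alpha> < s * p" and sp: "s * p < d"
    and \<mu>: "0 < \<mu>" "\<mu> < m"
    and hardy: "\<And>u::'a \<Rightarrow> real. u \<in> Dsp s p \<Longrightarrow>
      ennreal m * (\<integral>\<^sup>+ x. ennreal (\<bar>u x\<bar> powr p / norm x powr (s * p)) \<partial>lborel) \<le> gagliardo_energy s p u"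
begin

abbreviation D :: "('a \<Rightarrow> real) set" where "D \<equiv> Dsp s p"
abbreviation gq :: "('a \<Rightarrow> real) \<Rightarrow> 'a \<times> 'a \<Rightarrow> real" where "gq \<equiv> gag_quot s p"
abbreviation hq :: "('a \<Rightarrow> real) \<Rightarrow> 'a \<Rightarrow> real" where "hq \<equiv> wquot s"
abbreviation cq :: "('a \<Rightarrow> real) \<Rightarrow> 'a \<Rightarrow> real" where "cq \<equiv> wquot (\<alpha> / q)"

definition NN :: "('a \<Rightarrow> real) \<Rightarrow> real" where "NN u = Lint p lborel (gq u)"
definition HH :: "('a \<Rightarrow> real) \<Rightarrow> real" where "HH u = Lint p lborel (hq u)"
definition BB :: "('a \<Rightarrow> real) \<Rightarrow> real" where "BB u = Lint q lborel (cq u)"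

lemma p0: "0 < p" and sp0: "0 < s * p" and m0: "0 < m" and d0: "0 < d" and dsp: "0 < d - s * p"
  using p s \<mu> sp by (auto simp: d_def)

text \<open>The strict inequalities are where the two bounds on \<open>\<alpha>\<close> enter:
  \<open>\<alpha> < s * p\<close> separates \<open>q\<close> from \<open>p\<close>, and
  \<open>0 < \<alpha>\<close> separates it from \<open>ps\<close>.\<close>

lemma exponents: "p < q" "q < ps" "1 < q" "1 < ps" "0 < q" "0 < ps" "ps = p * (d / (d - s * p))"
  "q = p * ((d - \<alpha>) / (d - s * p))"
proof -
  show e1: "ps = p * (d / (d - s * p))" and e2: "q = p * ((d - \<alpha>) / (d - s * p))"
    by (simp_all add: crit_exp_def q_def ps_def)
  have "1 < (d - \<alpha>) / (d - s * p)" using \<alpha> dsp by simp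
  then have "p * 1 < p * ((d - \<alpha>) / (d - s * p))" by (rule mult_strict_left_mono) (use p0 in simp)
  then show 1: "p < q" unfolding e2 by simp
  have "(d - \<alpha>) / (d - s * p) < d / (d - s * p)" using \<alpha> dsp by (simp add: divide_strict_right_mono)
  then have "p * ((d - \<alpha>) / (d - s * p)) < p * (d / (d - s * p))"
      by (rule mult_strict_left_mono) (use p0 in simp)
  then show 2: "q < ps" unfolding e1 e2 by simp
  show "1 < q" "1 < ps" "0 < q" "0 < ps" using 1 2 p by auto
qed

lemma gagliardo_energy_eq: "gagliardo_energy s p (u :: 'a \<Rightarrow> real) = (\<integral>\<^sup>+z. ennreal (\<bar>gq u z\<bar> powr p) \<partial>lborel)"
  unfolding gagliardo_energy_def lborel_prod gag_quot_powr[OF p0] ..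

lemma Dsp_iff: "u \<in> D \<longleftrightarrow> u \<in> borel_measurable borel \<and> u \<in> Lfun ps lborel \<and> gq u \<in> Lfun p lborel"
proof (cases "u \<in> borel_measurable borel")
  case True
  note [measurable] = True
  have "gagliardo_energy s p u < \<infinity> \<longleftrightarrow> integrable lborel (\<lambda>z. \<bar>gq u z\<bar> powr p)"
    unfolding gagliardo_energy_eq integrable_iff_bounded by simp
  with True show ?thesis by (simp add: Dsp_def Lfun_def ps_def d_def)
qed (simp add: Dsp_def)

lemma DspD: assumes "u \<in> D" shows "u \<in> borel_measurable borel" "u \<in> Lfun ps lborel" "gq u \<in> Lfun p lborel"
  using assms by (auto simp: Dsp_iff)

lemma gagliardo_energy_NN: "u \<in> D \<Longrightarrow> gagliardo_energy s p u = ennreal (NN u)"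
  unfolding gagliardo_energy_eq NN_def by (intro nn_integral_Lint DspD)

lemma NN_nonneg [simp]: "0 \<le> NN u" and HH_nonneg [simp]: "0 \<le> HH u" and BB_nonneg [simp]: "0 \<le> BB u"
  by (simp_all add: NN_def HH_def BB_def)

lemma gagliardo_NN: "u \<in> D \<Longrightarrow> gagliardo s p u = NN u powr (1 / p)"
  by (simp add: gagliardo_def gagliardo_energy_NN)

lemma gagliardo_powr: "u \<in> D \<Longrightarrow> gagliardo s p u powr p = NN u"
  using p0 by (simp add: gagliardo_NN powr_powr)

lemma Dsp_add: assumes "u \<in> D" "v \<in> D" shows "(\<lambda>x. u x + v x) \<in> D"
  unfolding Dsp_iff gag_quot_add[abs_def]
  by (intro conjI Lfun_add borel_measurable_add exponents p0 DspD assms)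

lemma Dsp_cmult: assumes "u \<in> D" shows "(\<lambda>x. c * u x) \<in> D"
  unfolding Dsp_iff gag_quot_cmult[abs_def]
  by (intro conjI Lfun_cmult borel_measurable_times borel_measurable_const DspD assms)

lemma Dsp_diff: assumes "u \<in> D" "v \<in> D" shows "(\<lambda>x. u x - v x) \<in> D"
  using Dsp_add[OF assms(1) Dsp_cmult[OF assms(2), of "-1"]] by simp

lemma Dsp_zero: "(\<lambda>x. 0) \<in> D"
  using p0 by (simp add: Dsp_iff Lfun_def gag_quot_def)

lemma NN_cmult: "NN (\<lambda>x. c * u x) = \<bar>c\<bar> powr p * NN u"
  unfolding NN_def gag_quot_cmult[abs_def] by (rule Lint_cmult)

lemma gagliardo_cmult: "u \<in> D \<Longrightarrow> gagliardo s p (\<lambda>x. c * u x) = \<bar>c\<bar> * gagliardo s p u"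
  using p0 by (simp add: gagliardo_NN Dsp_cmult NN_cmult powr_mult powr_powr)

lemma NN_add_le: "u \<in> D \<Longrightarrow> v \<in> D \<Longrightarrow> NN (\<lambda>x. u x + v x) \<le> 2 powr p * (NN u + NN v)"
  unfolding NN_def gag_quot_add[abs_def] by (intro Lint_add_le p0 DspD)

lemma NN_diff_le: "u \<in> D \<Longrightarrow> v \<in> D \<Longrightarrow> NN (\<lambda>x. u x - v x) \<le> 2 powr p * (NN u + NN v)"
  using NN_add_le[of u "\<lambda>x. -1 * v x"] Dsp_cmult[of v "-1"] NN_cmult[of "-1" v] by simp

lemma hardy_nn: "u \<in> D \<Longrightarrow> (\<integral>\<^sup>+ x. ennreal (\<bar>u x\<bar> powr p / norm x powr (s * p)) \<partial>lborel) \<le> ennreal (NN u / m)"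
proof -
  assume u: "u \<in> D"
  let ?I = "\<integral>\<^sup>+ x. ennreal (\<bar>u x\<bar> powr p / norm x powr (s * p)) \<partial>lborel"
  have "ennreal (1 / m) * (ennreal m * ?I) \<le> ennreal (1 / m) * ennreal (NN u)"
    using hardy[OF u] u by (intro mult_left_mono) (auto simp: gagliardo_energy_NN)
  then show ?thesis using m0 by (simp add: mult.assoc[symmetric] ennreal_mult[symmetric])
qed

lemma Dsp_hardy: assumes "u \<in> D" shows "hq u \<in> Lfun p lborel" "HH u \<le> NN u / m"
proof -
  have [measurable]: "u \<in> borel_measurable borel" using assms by (rule DspD)
  have "(\<integral>\<^sup>+x. ennreal (\<bar>hq u x\<bar> powr p) \<partial>lborel) \<le> ennreal (NN u / m)"
    unfolding wquot_powr[OF p0] by (rule hardy_nn[OF assms])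
  then show "hq u \<in> Lfun p lborel" "HH u \<le> NN u / m" unfolding HH_def
    using m0 by (auto intro!: LfunI_nn_integral)
qed

lemma AE_zero_of_HH_zero: assumes "u \<in> D" "HH u = 0" shows "AE x in lborel. u x = 0"
proof -
  have "AE x in lborel. hq u x = 0"
    using assms Lint_eq_0_iff[OF Dsp_hardy(1)] by (simp add: HH_def)
  moreover have "AE x in lborel. x \<noteq> (0::'a)" by (rule AE_lborel_singleton)
  ultimately show ?thesis by eventually_elim (simp add: wquot_def)
qed

lemma Dsp_translate: assumes "u \<in> D" shows "(\<lambda>x. u (y + x)) \<in> D" "NN (\<lambda>x. u (y + x)) = NN u"
proof -
  have [measurable]: "u \<in> borel_measurable borel" using assms by (rule DspD)
  have 1: "(\<integral>\<^sup>+x. ennreal (\<bar>u (y + x)\<bar> powr ps) \<partial>lborel) = ennreal (Lint ps lborel u)"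
    using nn_integral_lborel_translate[of "\<lambda>x. ennreal (\<bar>u x\<bar> powr ps)" y] nn_integral_Lint[OF DspD(2)[OF
        assms]] by simp
  have g: "gq (\<lambda>x. u (y + x)) z = gq u ((y, y) + z)" for z
    by (simp add: gag_quot_def)
  have 2: "(\<integral>\<^sup>+x. ennreal (\<bar>gq (\<lambda>x. u (y + x)) x\<bar> powr p) \<partial>lborel) = ennreal (NN u)"
    unfolding g using nn_integral_lborel_translate[of "\<lambda>x. ennreal (\<bar>gq u x\<bar> powr p)" "(y, y)"]
        nn_integral_Lint[OF DspD(3)[OF assms]]
    by (simp add: NN_def)
  show *: "(\<lambda>x. u (y + x)) \<in> D"
    unfolding Dsp_iff using LfunI_nn_integral(1)[OF _ eq_refl[OF 1]] LfunI_nn_integral(1)[OF _ eq_refl[OF 2]]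
    by simp
  show "NN (\<lambda>x. u (y + x)) = NN u"
    using 2 nn_integral_Lint[OF DspD(3)[OF *]] by (simp add: NN_def[symmetric])
qed

text \<open>The Hardy inequality is centred at the origin but the seminorm is translation invariant,
  so it holds about every \<open>x\<close>; on the ball the weight is at least
  \<open>R powr (- (s * p))\<close>.\<close>

lemma hardy_ball:
  assumes u: "u \<in> D" and R: "0 < R"
  shows "(\<integral>\<^sup>+y. ennreal (\<bar>u y\<bar> powr p) * indicator (ball x R) y \<partial>lborel)
      \<le> ennreal (R powr (s * p) * (NN u / m))"
proof -
  have [measurable]: "u \<in> borel_measurable borel" using u by (rule DspD)
  have "(\<integral>\<^sup>+y. ennreal (\<bar>u y\<bar> powr p) * indicator (ball x R) y \<partial>lborel)
      = (\<integral>\<^sup>+y. ennreal (\<bar>u (x + y)\<bar> powr p) * indicator (ball x R) (x + y) \<partial>lborel)"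
    by (subst nn_integral_lborel_translate[of "\<lambda>y. ennreal (\<bar>u y\<bar> powr p) * indicator (ball x R) y" x,
        symmetric]) simp_all
  also have "\<dots> \<le> (\<integral>\<^sup>+y. ennreal (R powr (s * p)) * ennreal (\<bar>u (x + y)\<bar> powr p / norm y powr (s * p)) \<partial>lborel)"
  proof (rule nn_integral_mono_AE)
    have "AE y in lborel. y \<noteq> (0::'a)" by (rule AE_lborel_singleton)
    then show "AE y in lborel. ennreal (\<bar>u (x + y)\<bar> powr p) * indicator (ball x R) (x + y)
        \<le> ennreal (R powr (s * p)) * ennreal (\<bar>u (x + y)\<bar> powr p / norm y powr (s * p))"
    proof eventually_elim
      case (elim y)
      show ?case
      proof (cases "norm y < R")
        case True
        have "norm y powr (s * p) \<le> R powr (s * p)" using True sp0 by (intro powr_mono2) auto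
        then have "\<bar>u (x + y)\<bar> powr p * norm y powr (s * p) \<le> \<bar>u (x + y)\<bar> powr p * R powr (s * p)"
          by (intro mult_left_mono) auto
        then have "\<bar>u (x + y)\<bar> powr p \<le> R powr (s * p) * (\<bar>u (x + y)\<bar> powr p / norm y powr (s * p))"
          using elim by (simp add: field_simps)
        then show ?thesis using True by (simp add: ennreal_mult[symmetric] dist_norm ennreal_leI)
      next
        case False
        then have "x + y \<notin> ball x R" by (simp add: dist_norm)
        then show ?thesis by simp
      qed
    qed
  qed
  also have "\<dots> = ennreal (R powr (s * p)) * (\<integral>\<^sup>+y. ennreal (\<bar>u (x + y)\<bar> powr p / norm y powr (s * p)) \<partial>lborel)"
    by (intro nn_integral_cmult) measurable
  also have "\<dots> \<le> ennreal (R powr (s * p)) * ennreal (NN u / m)"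
    using hardy_nn[OF Dsp_translate(1)[OF u, of x]] Dsp_translate(2)[OF u, of x] by (intro mult_left_mono) auto
  also have "\<dots> = ennreal (R powr (s * p) * (NN u / m))" using m0 by (intro ennreal_mult[symmetric]) auto
  finally show ?thesis .
qed

text \<open>The power \<open>p\<close> of a local fractional derivative at \<open>x\<close>, whose
  integral is \<open>NN u\<close>. It takes values in \<open>ennreal\<close>, so pointwise bounds
  can be stated at every \<open>x\<close> and are trivial where it is infinite.\<close>

definition gx :: "('a \<Rightarrow> real) \<Rightarrow> 'a \<Rightarrow> ennreal" where
  "gx u x = (\<integral>\<^sup>+y. ennreal (\<bar>gq u (x, y)\<bar> powr p) \<partial>lborel)"

lemma gx_integral:
  assumes "u \<in> D" shows "gx u \<in> borel_measurable borel" "(\<integral>\<^sup>+x. gx u x \<partial>lborel) = ennreal (NN u)"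
proof -
  have [measurable]: "u \<in> borel_measurable borel" using assms by (rule DspD)
  have "gq u \<in> borel_measurable borel" by measurable
  then have *: "(\<lambda>z. ennreal (\<bar>gq u z\<bar> powr p)) \<in> borel_measurable (lborel \<Otimes>\<^sub>M lborel)"
    by (simp add: lborel_prod)
  from lborel.borel_measurable_nn_integral_fst[OF this]
  show "gx u \<in> borel_measurable borel" unfolding gx_def[abs_def] by simp
  have "(\<integral>\<^sup>+x. gx u x \<partial>lborel) = (\<integral>\<^sup>+z. ennreal (\<bar>gq u z\<bar> powr p) \<partial>(lborel \<Otimes>\<^sub>M lborel))"
    unfolding gx_def by (rule lborel.nn_integral_fst[OF *])
  also have "\<dots> = ennreal (NN u)" using nn_integral_Lint[OF DspD(3)[OF assms]] by (simp add: lborel_prod NN_def)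
  finally show "(\<integral>\<^sup>+x. gx u x \<partial>lborel) = ennreal (NN u)" .
qed

abbreviation \<omega> :: real where "\<omega> \<equiv> unit_ball_vol d"

text \<open>At distance at most \<open>R\<close> the kernel is bounded below by
  \<open>R powr (- (d + s * p))\<close>. The set \<open>S\<close> is kept general so that balls not
  centred at \<open>x\<close> are covered too.\<close>

lemma diff_ball_le:
  assumes u: "u \<in> D" and R: "0 < R" and sub: "S \<subseteq> cball x R" and S[measurable]: "S \<in> sets borel"
  shows "(\<integral>\<^sup>+y. ennreal (\<bar>u x - u y\<bar> powr p) * indicator S y \<partial>lborel) \<le> ennreal (R powr (d + s * p)) * gx u x"
proof -
  have [measurable]: "u \<in> borel_measurable borel" using u by (rule DspD)
  have "(\<lambda>y. gq u (x, y)) \<in> borel_measurable borel"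
    unfolding gag_quot_def fst_conv snd_conv by measurable
  note [measurable] = this
  have "(\<integral>\<^sup>+y. ennreal (\<bar>u x - u y\<bar> powr p) * indicator S y \<partial>lborel)
      \<le> (\<integral>\<^sup>+y. ennreal (R powr (d + s * p)) * ennreal (\<bar>gq u (x, y)\<bar> powr p) \<partial>lborel)"
  proof (rule nn_integral_mono)
    fix y
    show "ennreal (\<bar>u x - u y\<bar> powr p) * indicator S y \<le> ennreal (R powr (d
        + s * p)) * ennreal (\<bar>gq u (x, y)\<bar> powr p)"
    proof (cases "y \<in> S \<and> x \<noteq> y")
      case True
      then have n: "norm (x - y) \<le> R" "0 < norm (x - y)" using sub by (auto simp: dist_norm)
      have "norm (x - y) powr (d + s * p) \<le> R powr (d + s * p)" using n sp0 d0 by (intro powr_mono2) auto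
      then have "\<bar>u x - u y\<bar> powr p * norm (x - y) powr (d + s * p) \<le> \<bar>u x - u y\<bar> powr p * R powr (d + s * p)"
        by (intro mult_left_mono) auto
      then have "\<bar>u x - u y\<bar> powr p \<le> R powr (d + s * p) * (\<bar>u x - u y\<bar> powr p / norm (x - y) powr (d + s * p))"
        using n by (simp add: field_simps)
      then show ?thesis using True by (simp add: gag_quot_powr[OF p0] d_def ennreal_mult[symmetric] ennreal_leI)
    qed (use p0 in auto)
  qed
  also have "\<dots> = ennreal (R powr (d + s * p)) * gx u x"
    unfolding gx_def by (intro nn_integral_cmult) measurable
  finally show ?thesis .
qed

text \<open>\<open>u x\<close> is compared with \<open>u y\<close> and the result integrated over
  \<open>y\<close> in the ball. The mass on the ball is left as it stands: the Sobolev inequality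
  bounds it by \<open>hardy_ball\<close>, the vanishing lemma by smallness of local mass.\<close>

lemma ball_average_bound:
  assumes u: "u \<in> D" and R: "0 < R"
  shows "ennreal (\<omega> * R powr d * \<bar>u x\<bar> powr p)
     \<le> ennreal (2 powr p) * (ennreal (R powr (d + s * p)) * gx u x
         + (\<integral>\<^sup>+y. ennreal (\<bar>u y\<bar> powr p) * indicator (ball x R) y \<partial>lborel))"
proof -
  have [measurable]: "u \<in> borel_measurable borel" using u by (rule DspD)
  have "ennreal (\<omega> * R powr d * \<bar>u x\<bar> powr p) = ennreal (\<bar>u x\<bar> powr p) * emeasure lborel (ball x R)"
    using R by (simp add: emeasure_ball d_def powr_realpow ennreal_mult[symmetric] mult_ac)
  also have "\<dots> = (\<integral>\<^sup>+y. ennreal (\<bar>u x\<bar> powr p) * indicator (ball x R) y \<partial>lborel)"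
    by (subst nn_integral_cmult_indicator) auto
  also have "\<dots> \<le> (\<integral>\<^sup>+y. ennreal (2 powr p) * (ennreal (\<bar>u x - u y\<bar> powr p) * indicator (ball x R) y
      + ennreal (\<bar>u y\<bar> powr p) * indicator (ball x R) y) \<partial>lborel)"
  proof (rule nn_integral_mono)
    fix y
    have "\<bar>u x\<bar> powr p \<le> 2 powr p * (\<bar>u x - u y\<bar> powr p + \<bar>u y\<bar> powr p)"
      using abs_add_powr_le[OF p0, of "u x - u y" "u y"] by simp
    then show "ennreal (\<bar>u x\<bar> powr p) * indicator (ball x R) y
       \<le> ennreal (2 powr p) * (ennreal (\<bar>u x - u y\<bar> powr p) * indicator (ball x R) y
           + ennreal (\<bar>u y\<bar> powr p) * indicator (ball x R) y)"
      by (auto simp: indicator_def ennreal_mult[symmetric] ennreal_plus[symmetric] ennreal_leI simp del: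
          ennreal_plus)
  qed
  also have "\<dots> = ennreal (2 powr p) * ((\<integral>\<^sup>+y. ennreal (\<bar>u x - u y\<bar> powr p) * indicator (ball x R) y \<partial>lborel)
      + (\<integral>\<^sup>+y. ennreal (\<bar>u y\<bar> powr p) * indicator (ball x R) y \<partial>lborel))"
    by (subst nn_integral_cmult, simp, subst nn_integral_add) simp_all
  also have "\<dots> \<le> ennreal (2 powr p) * (ennreal (R powr (d + s * p)) * gx u x
      + (\<integral>\<^sup>+y. ennreal (\<bar>u y\<bar> powr p) * indicator (ball x R) y \<partial>lborel))"
    by (intro mult_left_mono add_mono diff_ball_le[OF u R]) auto
  finally show ?thesis .
qed

lemma omega_pos: "0 < \<omega>" by (simp add: unit_ball_vol_def d_def)

text \<open>Choosing the radius separately at each point gives a pointwise bound of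
  \<open>\<bar>u x\<bar> powr ps\<close> by a constant times \<open>gx u x\<close>; integration over
  \<open>x\<close> finishes.\<close>

lemma sobolev: "\<exists>C>0. \<forall>u\<in>D. NN u \<le> 1 \<longrightarrow> Lint ps lborel u \<le> C"
proof -
  \<comment> \<open>The constant that \<open>powr_balance\<close> returns for
    \<open>a = \<omega> / 2 powr p\<close>; the power of \<open>\<bar>u x\<bar>\<close> is split off
    below.\<close>
  define c where "c = (m * (\<omega> / 2 powr p) / 2) powr (d / (d - s * p)) / m"
  have c: "0 < c" using omega_pos m0 by (simp add: c_def)
  have "Lint ps lborel u \<le> 1 / c" if u: "u \<in> D" "NN u \<le> 1" for u
  proof -
    have pw: "ennreal (c * \<bar>u x\<bar> powr ps) \<le> gx u x" for x
    proof (cases "gx u x")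
      case (real \<gamma>)
      show ?thesis
      proof (cases "u x = 0")
        case False
        define a where "a = \<omega> / 2 powr p * \<bar>u x\<bar> powr p"
        have a: "0 < a" using False omega_pos by (simp add: a_def)
        have "(m * a / 2) powr (d / (d - s * p)) / m \<le> \<gamma>"
        proof (rule powr_balance[OF a m0 sp0 sp])
          fix R :: real assume R: "0 < R"
          have "R powr (s * p) * (NN u / m) \<le> R powr (s * p) / m"
            using u m0 by (simp add: mult_left_le divide_right_mono)
          then have "(\<integral>\<^sup>+y. ennreal (\<bar>u y\<bar> powr p) * indicator (ball x R) y \<partial>lborel)
              \<le> ennreal (R powr (s * p) / m)"
            using hardy_ball[OF u(1) R, of x] order_trans ennreal_leI by blast
          then have "ennreal (\<omega> * R powr d * \<bar>u x\<bar> powr p) \<le> ennreal (2 powr p) * (ennreal (R powr (d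
              + s * p)) * ennreal \<gamma> + ennreal (R powr (s * p) / m))"
            using ball_average_bound[OF u(1) R, of x] real
            by (elim order_trans) (auto intro!: mult_left_mono add_mono)
          also have "\<dots> = ennreal (2 powr p * (R powr (d + s * p) * \<gamma> + R powr (s * p) / m))"
            using real m0 by (simp add: ennreal_mult ennreal_plus)
          finally have "\<omega> * R powr d * \<bar>u x\<bar> powr p \<le> 2 powr p * (R powr (d + s * p) * \<gamma> + R powr (s * p) / m)"
            using real m0 by (subst (asm) ennreal_le_iff) auto
          then show "R powr d * a \<le> R powr (d + s * p) * \<gamma> + R powr (s * p) / m"
            by (simp add: a_def field_simps)
        qed
        moreover have "(m * a / 2) powr (d / (d - s * p)) / m = c * \<bar>u x\<bar> powr ps"
        proof -
          have "m * a / 2 = (m * (\<omega> / 2 powr p) / 2) * \<bar>u x\<bar> powr p" by (simp add: a_def)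
          then have "(m * a / 2) powr (d / (d - s * p)) = (m * (\<omega> / 2 powr p) / 2) powr (d / (d
              - s * p)) * (\<bar>u x\<bar> powr p) powr (d / (d - s * p))"
            by (simp only: powr_mult)
          then show ?thesis by (simp add: c_def powr_powr exponents(7))
        qed
        ultimately show ?thesis using real by (simp add: ennreal_leI)
      qed (use exponents in auto)
    qed simp
    have [measurable]: "u \<in> borel_measurable borel" using u by (auto dest: DspD)
    have "ennreal c * ennreal (Lint ps lborel u) = (\<integral>\<^sup>+x. ennreal (c * \<bar>u x\<bar> powr ps) \<partial>lborel)"
      using c nn_integral_Lint[OF DspD(2)[OF u(1)]] by (simp add: ennreal_mult nn_integral_cmult)
    also have "\<dots> \<le> (\<integral>\<^sup>+x. gx u x \<partial>lborel)" by (intro nn_integral_mono pw)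
    also have "\<dots> \<le> ennreal 1" unfolding gx_integral(2)[OF u(1)] using u by (intro ennreal_leI)
    finally have "ennreal (c * Lint ps lborel u) \<le> ennreal 1" using c by (simp add: ennreal_mult)
    then have "c * Lint ps lborel u \<le> 1" by (subst (asm) ennreal_le_iff) auto
    then show ?thesis using c by (simp add: field_simps)
  qed
  then show ?thesis using c by (intro exI[of _ "1 / c"]) auto
qed

end

section \<open>Hardy-Sobolev inequality and vanishing of the critical term\<close>

context hardy_space
begin

lemma Lint_ps_bounded: assumes M: "0 < M" shows "\<exists>C>0. \<forall>u\<in>D. NN u \<le> M \<longrightarrow> Lint ps lborel u \<le> C"
proof -
  obtain C where C: "0 < C" "\<And>u. u \<in> D \<Longrightarrow> NN u \<le> 1 \<Longrightarrow> Lint ps lborel u \<le> C" using sobolev by blast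
  define c where "c = M powr (- 1 / p)"
  have c: "0 < c" using M by (simp add: c_def)
  have "c powr p = M powr - 1" using p0 by (simp add: c_def powr_powr)
  then have cp: "c powr p = 1 / M" using M by (simp add: powr_minus_divide)
  have "Lint ps lborel u \<le> C / c powr ps" if u: "u \<in> D" "NN u \<le> M" for u
  proof -
    have "NN (\<lambda>x. c * u x) \<le> 1" using u c M by (simp add: NN_cmult cp)
    from C(2)[OF Dsp_cmult[OF u(1)] this] have "c powr ps * Lint ps lborel u \<le> C"
      using c by (simp add: Lint_cmult)
    then show ?thesis using c by (simp add: field_simps)
  qed
  then show ?thesis using C c by (intro exI[of _ "C / c powr ps"]) auto
qed

text \<open>\<open>w\<close> is invariant under the dilations and \<open>k\<close> is the density of
  the invariant measure. In these terms the Hardy, critical and Sobolev densities are the powers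
  \<open>1\<close>, \<open>q / p\<close> and \<open>ps / p\<close> of one number, so comparing
  integrals becomes comparing powers.\<close>

lemma weighted_powers:
  fixes u :: "'a \<Rightarrow> real"
  assumes x: "x \<noteq> 0"
  defines "w \<equiv> \<bar>u x\<bar> powr p * norm x powr (d - s * p)" and "k \<equiv> norm x powr (- d)"
  shows "\<bar>cq u x\<bar> powr q = w powr (q / p) * k" "\<bar>hq u x\<bar> powr p = w * k" "\<bar>u x\<bar> powr ps = w powr (ps / p) * k"
proof -
  have n: "0 < norm x" using x by simp
  have w: "w powr t = \<bar>u x\<bar> powr (p * t) * norm x powr ((d - s * p) * t)" for t
    by (simp add: w_def powr_mult powr_powr)
  have "(d - s * p) * (q / p) = d - \<alpha>" "(d - s * p) * (ps / p) = d"
    unfolding exponents(7) exponents(8) using dsp p0 by simp_all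
  then have e: "norm x powr ((d - s * p) * (q / p)) * k = norm x powr - \<alpha>"
      "norm x powr ((d - s * p) * (ps / p)) * k = norm x powr 0"
      "norm x powr (d - s * p) * k = norm x powr - (s * p)"
    unfolding k_def powr_add[symmetric] by simp_all
  have e2: "p * (q / p) = q" "p * (ps / p) = ps" using p0 by simp_all
  show "\<bar>cq u x\<bar> powr q = w powr (q / p) * k"
    using exponents(1-6) unfolding w e2 mult.assoc e by (simp add: wquot_powr powr_minus_divide)
  show "\<bar>hq u x\<bar> powr p = w * k"
    unfolding w_def mult.assoc e using p0 by (simp add: wquot_powr powr_minus_divide)
  show "\<bar>u x\<bar> powr ps = w powr (ps / p) * k"
    unfolding w e2 mult.assoc e using n by simp
qed

text \<open>The exponent \<open>q / p\<close> lies between \<open>1\<close> and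
  \<open>ps / p\<close>: for \<open>w \<le> 1\<close> the first power dominates, for larger
  \<open>w\<close> the last one.\<close>

lemma crit_pointwise: "\<bar>cq u x\<bar> powr q \<le> \<bar>hq u x\<bar> powr p + \<bar>u x\<bar> powr ps"
proof (cases "x = 0")
  case False
  define w where "w = \<bar>u x\<bar> powr p * norm x powr (d - s * p)"
  have w0: "0 \<le> w" by (simp add: w_def)
  have e: "1 < q / p" "q / p < ps / p" using exponents(1-6) p0 by (auto simp: divide_strict_right_mono)
  have "w powr (q / p) \<le> w + w powr (ps / p)"
  proof (cases "w \<le> 1")
    case True
    then have "w powr (q / p) \<le> w powr 1"
      using w0 e powr_mono'[of 1 "q / p" w] by linarith
    then show ?thesis using w0 by (simp add: add_increasing2)
  next
    case False
    then have "w powr (q / p) \<le> w powr (ps / p)" using e by (intro powr_mono) auto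
    then show ?thesis using w0 by simp
  qed
  then have "w powr (q / p) * norm x powr (- d) \<le> (w + w powr (ps / p)) * norm x powr (- d)"
    by (intro mult_right_mono) auto
  then show ?thesis unfolding w_def weighted_powers[OF False] by (simp add: distrib_right)
qed (use exponents(1-6) in \<open>simp add: wquot_def\<close>)

lemma Dsp_crit: assumes "u \<in> D" shows "cq u \<in> Lfun q lborel" "BB u \<le> HH u + Lint ps lborel u"
proof -
  have [measurable]: "u \<in> borel_measurable borel" using assms by (rule DspD)
  have i: "integrable lborel (\<lambda>x. \<bar>hq u x\<bar> powr p + \<bar>u x\<bar> powr ps)"
    using LfunD(2)[OF Dsp_hardy(1)[OF assms]] LfunD(2)[OF DspD(2)[OF assms]] by simp
  then have i2: "integrable lborel (\<lambda>x. \<bar>cq u x\<bar> powr q)"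
    by (rule Bochner_Integration.integrable_bound) (auto intro!: AE_I2 crit_pointwise)
  then show "cq u \<in> Lfun q lborel" by (simp add: Lfun_def)
  have "BB u \<le> (LINT x|lborel. \<bar>hq u x\<bar> powr p + \<bar>u x\<bar> powr ps)"
    unfolding BB_def Lint_def by (intro integral_mono i i2 crit_pointwise)
  also have "\<dots> = HH u + Lint ps lborel u"
    using LfunD(2)[OF Dsp_hardy(1)[OF assms]] LfunD(2)[OF DspD(2)[OF assms]] by (simp add: HH_def Lint_def)
  finally show "BB u \<le> HH u + Lint ps lborel u" .
qed

lemma BB_cmult: "BB (\<lambda>x. c * u x) = \<bar>c\<bar> powr q * BB u"
  unfolding BB_def wquot_cmult[abs_def] by (rule Lint_cmult)

text \<open>Normalising to \<open>NN = 1\<close> and using that \<open>BB\<close> has degree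
  \<open>q\<close> and \<open>NN\<close> degree \<open>p\<close> produces the exponent
  \<open>q / p\<close>. If \<open>NN u = 0\<close>, Hardy forces \<open>u\<close> to vanish almost
  everywhere.\<close>

lemma hardy_sobolev: "\<exists>C>0. \<forall>u\<in>D. BB u \<le> C * NN u powr (q / p)"
proof -
  obtain C where C: "0 < C" "\<And>u. u \<in> D \<Longrightarrow> NN u \<le> 1 \<Longrightarrow> Lint ps lborel u \<le> C" using sobolev by blast
  have "BB u \<le> (1 / m + C) * NN u powr (q / p)" if u: "u \<in> D" for u
  proof (cases "NN u = 0")
    case True
    then have "HH u = 0" using Dsp_hardy(2)[OF u] HH_nonneg[of u] by simp
    then have "AE x in lborel. cq u x = 0"
      using AE_zero_of_HH_zero[OF u] by (auto simp: wquot_def)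
    then have "BB u = 0" unfolding BB_def using Lint_eq_0_iff[OF Dsp_crit(1)[OF u]] by simp
    then show ?thesis using C m0 by simp
  next
    case False
    then have N: "0 < NN u" by (simp add: less_le)
    define c where "c = NN u powr (- 1 / p)"
    have c: "0 < c" using N by (simp add: c_def)
    have "c powr p = NN u powr - 1" using p0 by (simp add: c_def powr_powr)
    then have cp: "c powr p = 1 / NN u" using N by (simp add: powr_minus_divide)
    have cq: "c powr q = 1 / NN u powr (q / p)"
      using p0 by (simp add: c_def powr_powr powr_minus_divide[symmetric])
    let ?v = "\<lambda>x. c * u x"
    have v: "?v \<in> D" "NN ?v = 1" using Dsp_cmult[OF u] N c by (simp_all add: NN_cmult cp)
    have "BB ?v \<le> HH ?v + Lint ps lborel ?v" by (rule Dsp_crit(2)[OF v(1)])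
    also have "\<dots> \<le> 1 / m + C" using Dsp_hardy(2)[OF v(1)] C(2)[OF v(1)] v(2) by simp
    finally have "BB u / NN u powr (q / p) \<le> 1 / m + C" using c by (simp add: BB_cmult cq)
    then show ?thesis using N by (simp add: divide_le_eq)
  qed
  then show ?thesis using C m0 by (intro exI[of _ "1 / m + C"]) (auto intro: add_pos_pos)
qed

text \<open>Only balls about the origin occur since dilations about it are the only invariance to be
  tracked. The indicator sits inside the function so that the facts on \<open>Lint\<close>
  apply.\<close>

definition loc :: "real \<Rightarrow> ('a \<Rightarrow> real) \<Rightarrow> real" where
  "loc R u = Lint p lborel (\<lambda>x. indicator (cball 0 R) x * u x)"

lemma loc_nonneg [simp]: "0 \<le> loc R u"
  by (simp add: loc_def)

lemma Lfun_loc: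
  assumes u: "u \<in> D" shows "(\<lambda>x. indicator (cball 0 R) x * u x) \<in> Lfun p lborel"
proof -
  have [measurable]: "u \<in> borel_measurable borel" using u by (rule DspD)
  have i: "integrable lborel (\<lambda>x. R powr (s * p) * \<bar>hq u x\<bar> powr p)"
    using LfunD(2)[OF Dsp_hardy(1)[OF u]] by simp
  have "integrable lborel (\<lambda>x. \<bar>indicator (cball 0 R) x * u x\<bar> powr p)"
  proof (rule Bochner_Integration.integrable_bound[OF i])
    have "AE x in lborel. x \<noteq> (0::'a)" by (rule AE_lborel_singleton)
    then show "AE x in lborel. norm (\<bar>indicator (cball 0 R) x * u x\<bar> powr p)
        \<le> norm (R powr (s * p) * \<bar>hq u x\<bar> powr p)"
    proof eventually_elim
      case (elim x)
      show ?case
      proof (cases "norm x \<le> R")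
        case True
        have "norm x powr (s * p) \<le> R powr (s * p)" using True sp0 by (intro powr_mono2) auto
        then have "\<bar>u x\<bar> powr p * norm x powr (s * p) \<le> \<bar>u x\<bar> powr p * R powr (s * p)"
          by (intro mult_left_mono) auto
        then show ?thesis using True elim by (simp add: wquot_powr[OF p0] field_simps)
      qed (use p0 in simp)
    qed
  qed measurable
  then show ?thesis by (simp add: Lfun_def)
qed

lemma nn_integral_loc:
  assumes u: "u \<in> D" shows "(\<integral>\<^sup>+y. ennreal (\<bar>u y\<bar> powr p) * indicator (cball 0 R) y \<partial>lborel)
      = ennreal (loc R u)"
proof -
  have "(\<integral>\<^sup>+y. ennreal (\<bar>u y\<bar> powr p) * indicator (cball 0 R) y \<partial>lborel)
      = (\<integral>\<^sup>+y. ennreal (\<bar>indicator (cball 0 R) y * u y\<bar> powr p) \<partial>lborel)"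
    by (intro nn_integral_cong) (use p0 in \<open>auto simp: indicator_def\<close>)
  then show ?thesis using nn_integral_Lint[OF Lfun_loc[OF u]] by (simp add: loc_def)
qed

lemma loc_mono: assumes "u \<in> D" "R \<le> S" shows "loc R u \<le> loc S u"
proof -
  have "ennreal (loc R u) \<le> ennreal (loc S u)"
    unfolding nn_integral_loc[OF assms(1), symmetric] using assms(2)
    by (intro nn_integral_mono mult_left_mono) (auto simp: indicator_def)
  then show ?thesis by simp
qed

lemma loc_add_le: assumes "u \<in> D" "v \<in> D" shows "loc R (\<lambda>x. u x + v x) \<le> 2 powr p * (loc R u + loc R v)"
  using Lint_add_le[OF p0 Lfun_loc[OF assms(1)] Lfun_loc[OF assms(2)], of R R]
      by (simp add: loc_def distrib_left)

lemma loc_diff_le: assumes "u \<in> D" "v \<in> D" shows "loc R (\<lambda>x. u x - v x) \<le> 2 powr p * (loc R u + loc R v)"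
proof -
  have "loc R (\<lambda>x. -1 * v x) = loc R v" unfolding loc_def by (simp add: Lint_def)
  then show ?thesis using loc_add_le[OF assms(1) Dsp_cmult[OF assms(2), of "-1"], of R] by simp
qed

text \<open>Below \<open>\<kappa>\<close> the factor \<open>w powr a\<close> is small, above
  \<open>K\<close> the factor \<open>w powr (- b)\<close> is small. In between, the hypothesis can
  be solved for \<open>w\<close>, because \<open>\<kappa> / 2\<close> is less than half of
  \<open>w\<close>.\<close>

lemma middle_bound:
  fixes w t c \<kappa> K a b :: real
  assumes pos: "0 \<le> w" "0 \<le> t" "0 \<le> c" "0 < \<kappa>" "0 < K" "0 < a" "0 < b"
    and le: "w \<le> c * t + \<kappa> / 2"
  shows "w powr (1 + a) \<le> \<kappa> powr a * w + K powr (- b) * w powr (1 + a + b) + 2 * K powr a * c * t"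
proof -
  have t0: "0 \<le> 2 * K powr a * c * t" "0 \<le> K powr (- b) * w powr (1 + a + b)" "0 \<le> \<kappa> powr a * w"
    using pos by auto
  have w1: "w powr (1 + a) = w powr a * w" using pos by (simp add: powr_add)
  consider "w \<le> \<kappa>" | "K \<le> w" | "\<kappa> < w" "w < K" by linarith
  then show ?thesis
  proof cases
    case 1
    then have "w powr a * w \<le> \<kappa> powr a * w" using pos by (intro mult_right_mono powr_mono2) auto
    then show ?thesis using w1 t0 by linarith
  next
    case 2
    have "w powr (1 + a) = w powr (- b) * w powr (1 + a + b)"
      unfolding powr_add[symmetric] by simp
    also have "\<dots> \<le> K powr (- b) * w powr (1 + a + b)"
      using 2 pos by (intro mult_right_mono powr_mono2') auto
    finally show ?thesis using t0 by linarith
  next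
    case 3
    then have w2: "w \<le> 2 * (c * t)" using le by linarith
    have "w powr a * w \<le> K powr a * (2 * (c * t))" using 3 pos w2 by (intro mult_mono powr_mono2) auto
    also have "\<dots> = 2 * K powr a * c * t" by simp
    finally show ?thesis using w1 t0 by linarith
  qed
qed

text \<open>The mass in \<open>cball 0 (2 * norm x)\<close> controls the average of \<open>u\<close>
  over a small ball about \<open>x\<close>, hence \<open>w\<close> up to a multiple of
  \<open>gx u x\<close>. By \<open>middle_bound\<close> the critical density is then at most three
  terms, which integrate to small multiples of the Hardy integral, the Sobolev integral and the
  seminorm. Mass is tested at the origin only: the balls about \<open>x\<close> have radius
  proportional to \<open>norm x\<close>.\<close>

lemma crit_term_small:
  assumes M: "0 < M" and \<epsilon>: "0 < \<epsilon>"
  shows "\<exists>\<delta>>0. \<forall>u\<in>D. NN u \<le> M \<and> (\<forall>r>0. loc (2 * r) u \<le> \<delta> * r powr (s * p)) \<longrightarrow> BB u \<le> \<epsilon>"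
proof -
  obtain C where C: "0 < C" "\<And>u. u \<in> D \<Longrightarrow> NN u \<le> M \<Longrightarrow> Lint ps lborel u \<le> C" using Lint_ps_bounded[OF M] by blast
  define a b c where "a = q / p - 1" and "b = ps / p - q / p" and "c = 2 powr p / \<omega>"
  have a: "0 < a" and b: "0 < b" using exponents(1-6) p0 by (auto simp: a_def b_def divide_strict_right_mono)
  have c: "0 < c" using omega_pos by (simp add: c_def)
  \<comment> \<open>\<open>\<kappa>\<close> and \<open>K\<close> are chosen to make the Hardy and
    the Sobolev contribution \<open>\<epsilon> / 3\<close> each.\<close>
  define \<kappa> where "\<kappa> = (\<epsilon> * m / (3 * M)) powr (1 / a)"
  define K where "K = (3 * C / \<epsilon>) powr (1 / b)"
  have \<kappa>: "0 < \<kappa>" and K: "0 < K" using \<epsilon> M m0 C by (auto simp: \<kappa>_def K_def)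
  \<comment> \<open>The bound on \<open>l powr (s * p)\<close> that makes the seminorm contribution
    at most \<open>\<epsilon> / 3\<close>, although \<open>K\<close> is already fixed and may be
    large.\<close>
  define L where "L = \<epsilon> / (6 * K powr a * c * M)"
  have L: "0 < L" using \<epsilon> K c M by (simp add: L_def)
  \<comment> \<open>The relative radius; being at most \<open>1\<close>, it keeps the ball about
    \<open>x\<close> inside \<open>cball 0 (2 * norm x)\<close>.\<close>
  define l where "l = min 1 (L powr (1 / (s * p)))"
  have l: "0 < l" "l \<le> 1" using L by (auto simp: l_def)
  have "l powr (s * p) \<le> (L powr (1 / (s * p))) powr (s * p)"
    using l sp0 by (intro powr_mono2) (auto simp: l_def)
  also have "\<dots> = L" using L p0 s by (simp add: powr_powr)
  finally have lL: "l powr (s * p) \<le> L" .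
  \<comment> \<open>Fixed last, since the average over a ball of relative radius \<open>l\<close>
    costs \<open>l powr (- d)\<close>; the mass term then becomes exactly
    \<open>\<kappa> / 2\<close>.\<close>
  define \<delta> where "\<delta> = \<kappa> * l powr d / (2 * c)"
  have \<delta>: "0 < \<delta>" using \<kappa> l c by (simp add: \<delta>_def)
  have "\<kappa> powr a = \<epsilon> * m / (3 * M)" using a \<epsilon> M m0 by (simp add: \<kappa>_def powr_powr)
  then have \<kappa>a: "\<kappa> powr a * (M / m) = \<epsilon> / 3" using M m0 by simp
  have "K powr b = 3 * C / \<epsilon>" using b \<epsilon> C by (simp add: K_def powr_powr)
  then have Kb: "K powr (- b) * C = \<epsilon> / 3" using C by (simp add: powr_minus_divide)
  have La: "2 * K powr a * (c * L) * M = \<epsilon> / 3" using K c M by (simp add: L_def)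
  have "BB u \<le> \<epsilon>" if u: "u \<in> D" "NN u \<le> M" and van: "\<And>r. 0 < r \<Longrightarrow> loc (2 * r) u \<le> \<delta> * r powr (s * p)" for u
  proof -
    have [measurable]: "u \<in> borel_measurable borel" "gx u \<in> borel_measurable borel"
      using u by (auto dest: DspD gx_integral)
    let ?R = "\<lambda>x. ennreal (\<kappa> powr a) * ennreal (\<bar>hq u x\<bar> powr p)
        + ennreal (K powr (- b)) * ennreal (\<bar>u x\<bar> powr ps)
           + ennreal (2 * K powr a * (c * l powr (s * p))) * gx u x"
    have pw: "ennreal (\<bar>cq u x\<bar> powr q) \<le> ?R x" if x: "x \<noteq> 0" for x
    proof (cases "gx u x")
      case (real \<gamma>)
      define R where "R = l * norm x"
      have nx: "0 < norm x" using x by simp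
      have R: "0 < R" "R \<le> norm x" using x l by (auto simp: R_def mult_left_le_one_le)
      have "(\<integral>\<^sup>+y. ennreal (\<bar>u y\<bar> powr p) * indicator (ball x R) y \<partial>lborel)
         \<le> (\<integral>\<^sup>+y. ennreal (\<bar>u y\<bar> powr p) * indicator (cball 0 (2 * norm x)) y \<partial>lborel)"
      proof (intro nn_integral_mono mult_left_mono)
        fix y
        have "y \<in> ball x R \<Longrightarrow> y \<in> cball 0 (2 * norm x)"
          using R norm_triangle_ineq[of x "y - x"] by (auto simp: dist_norm norm_minus_commute)
        then show "indicator (ball x R) y \<le> (indicator (cball 0 (2 * norm x)) y :: ennreal)"
            by (simp add: indicator_def)
      qed simp
      also have "\<dots> = ennreal (loc (2 * norm x) u)" by (rule nn_integral_loc[OF u(1)])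
      also have "\<dots> \<le> ennreal (\<delta> * norm x powr (s * p))" by (intro ennreal_leI van nx)
      finally have "ennreal (\<omega> * R powr d * \<bar>u x\<bar> powr p) \<le> ennreal (2 powr p) * (ennreal (R powr (d
          + s * p)) * ennreal \<gamma> + ennreal (\<delta> * norm x powr (s * p)))"
        using ball_average_bound[OF u(1) R(1), of x] real
        by (elim order_trans) (auto intro!: mult_left_mono add_mono)
      also have "\<dots> = ennreal (2 powr p * (R powr (d + s * p) * \<gamma> + \<delta> * norm x powr (s * p)))"
        using real \<delta> by (simp add: ennreal_mult ennreal_plus)
      finally have "\<omega> * R powr d * \<bar>u x\<bar> powr p \<le> 2 powr p * (R powr (d + s * p) * \<gamma> + \<delta> * norm x powr (s * p))"
        using real \<delta> by (subst (asm) ennreal_le_iff) auto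
      then have *: "R powr d * \<bar>u x\<bar> powr p \<le> c * (R powr (d + s * p) * \<gamma> + \<delta> * norm x powr (s * p))"
        using omega_pos by (simp add: c_def field_simps)
      define n where "n = norm x"
      define w where "w = \<bar>u x\<bar> powr p * n powr (d - s * p)"
      define t where "t = n powr d * \<gamma>"
      have n: "0 < n" using x by (simp add: n_def)
      have nn: "n powr d = n powr (s * p) * n powr (d - s * p)" unfolding powr_add[symmetric] by simp
      \<comment> \<open>The averaged bound in invariant variables: both sides carry the common
        factor \<open>l powr d * n powr (s * p)\<close>, which is then cancelled.\<close>
      have "l powr d * n powr (s * p) * w = R powr d * \<bar>u x\<bar> powr p"
        unfolding R_def n_def[symmetric] powr_mult nn w_def by simp
      also have "\<dots> \<le> c * (l powr d * l powr (s * p) * (n powr d * n powr (s * p)) * \<gamma> + \<delta> * n powr (s * p))"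
        using * unfolding R_def n_def[symmetric] powr_mult powr_add by (simp add: mult_ac)
      also have "\<dots> = l powr d * n powr (s * p) * (c * l powr (s * p) * t + \<kappa> / 2)"
        using c by (simp add: t_def \<delta>_def algebra_simps)
      finally have wle: "w \<le> c * l powr (s * p) * t + \<kappa> / 2"
        by (rule mult_left_le_imp_le) (use l n in simp)
      have "w powr (1 + a) \<le> \<kappa> powr a * w + K powr (- b) * w powr (1 + a + b)
          + 2 * K powr a * (c * l powr (s * p)) * t"
        by (rule middle_bound) (use \<kappa> K a b c l n real wle in \<open>auto simp: w_def t_def\<close>)
      then have "w powr (1 + a) * n powr (- d) \<le> (\<kappa> powr a * w + K powr (- b) * w powr (1 + a + b)
          + 2 * K powr a * (c * l powr (s * p)) * t) * n powr (- d)"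
        by (intro mult_right_mono) auto
      moreover have "t * n powr (- d) = \<gamma>" using n by (simp add: t_def powr_minus_divide)
      moreover have "1 + a = q / p" "1 + a + b = ps / p" by (auto simp: a_def b_def)
      ultimately have "\<bar>cq u x\<bar> powr q \<le> \<kappa> powr a * \<bar>hq u x\<bar> powr p + K powr (- b) * \<bar>u x\<bar> powr ps
          + 2 * K powr a * (c * l powr (s * p)) * \<gamma>"
        unfolding weighted_powers[OF x] w_def[symmetric] n_def[symmetric]
            by (simp add: distrib_right mult.assoc)
      then have "ennreal (\<bar>cq u x\<bar> powr q) \<le> ennreal (\<kappa> powr a * \<bar>hq u x\<bar> powr p + K powr (- b) * \<bar>u x\<bar> powr ps
          + 2 * K powr a * (c * l powr (s * p)) * \<gamma>)"
        by (rule ennreal_leI)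
      also have "\<dots> = ?R x" using real c K by (simp add: ennreal_mult ennreal_plus)
      finally show ?thesis .
    next
      case top
      then show ?thesis using K c l by (simp add: ennreal_mult_top)
    qed
    have "ennreal (BB u) = (\<integral>\<^sup>+x. ennreal (\<bar>cq u x\<bar> powr q) \<partial>lborel)"
      using nn_integral_Lint[OF Dsp_crit(1)[OF u(1)]] by (simp add: BB_def)
    also have "\<dots> \<le> (\<integral>\<^sup>+x. ?R x \<partial>lborel)"
    proof (rule nn_integral_mono_AE)
      have "AE x in lborel. x \<noteq> (0::'a)" by (rule AE_lborel_singleton)
      then show "AE x in lborel. ennreal (\<bar>cq u x\<bar> powr q) \<le> ?R x" by eventually_elim (rule pw)
    qed
    also have "\<dots> = ennreal (\<kappa> powr a) * ennreal (HH u) + ennreal (K powr (- b)) * ennreal (Lint ps lborel u)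
           + ennreal (2 * K powr a * (c * l powr (s * p))) * ennreal (NN u)"
      using nn_integral_Lint[OF Dsp_hardy(1)[OF u(1)]] nn_integral_Lint[OF DspD(2)[OF u(1)]] gx_integral(2)[OF
          u(1)]
      by (simp add: nn_integral_add nn_integral_cmult HH_def)
    also have "\<dots> = ennreal (\<kappa> powr a * HH u + K powr (- b) * Lint ps lborel u
        + 2 * K powr a * (c * l powr (s * p)) * NN u)"
      using c K by (simp add: ennreal_mult ennreal_plus)
    finally have "BB u \<le> \<kappa> powr a * HH u + K powr (- b) * Lint ps lborel u
        + 2 * K powr a * (c * l powr (s * p)) * NN u"
      using c K by (subst (asm) ennreal_le_iff) (auto intro!: add_nonneg_nonneg mult_nonneg_nonneg)
    also have "\<dots> \<le> \<kappa> powr a * (M / m) + K powr (- b) * C + 2 * K powr a * (c * L) * M"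
    proof (intro add_mono mult_mono)
      have "NN u / m \<le> M / m" using u m0 by (simp add: divide_right_mono)
      then show "HH u \<le> M / m" using Dsp_hardy(2)[OF u(1)] by simp
    qed (use u C K c lL L M m0 in \<open>auto intro!: mult_nonneg_nonneg\<close>)
    also have "\<dots> = \<epsilon>" unfolding \<kappa>a Kb La by simp
    finally show ?thesis .
  qed
  with \<delta> show ?thesis by blast
qed

section \<open>Dilation invariance of the three terms and scaling of local mass\<close>

lemma rescale_invariants:
  fixes u :: "'a \<Rightarrow> real"
  assumes r: "0 < r" and u: "u \<in> D"
  shows "rescale s p r u \<in> D" "NN (rescale s p r u) = NN u" "HH (rescale s p r u) = HH u" "BB (rescale s p r u)
      = BB u"
proof -
  have [measurable]: "u \<in> borel_measurable borel" using u by (rule DspD)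
  have e1: "(real DIM('a) - s * p) / p + s = real DIM('a) / p" using p0 by (simp add: field_simps)
  have "(d - s * p) / p = (d - \<alpha>) / q" "(d - s * p) / p = d / ps"
    unfolding exponents(7) exponents(8) using dsp p0 d0 \<alpha> sp by (simp_all add: field_simps)
  then have e2: "(real DIM('a) - s * p) / p + \<alpha> / q = real DIM('a) / q"
    and e3: "(real DIM('a) - s * p) / p = real DIM('a) / ps"
    using exponents(1-6) by (simp_all add: d_def[symmetric] add_divide_distrib[symmetric])
  have g: "gq u \<in> borel_measurable borel" and w: "wquot a u \<in> borel_measurable borel" for a by measurable
  have "rescale s p r u = (\<lambda>z. r powr (- (real DIM('a) / ps)) * u (z /\<^sub>R r))"
    unfolding rescale_def e3 ..
  then have "rescale s p r u \<in> Lfun ps lborel" using Lint_scale(1)[OF r, of ps u] DspD[OF u] exponents(1-6)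
      by simp
  moreover have "gq (rescale s p r u) \<in> Lfun p lborel"
    using Lint_scale(1)[OF r p0 g] DspD(3)[OF u] unfolding gag_quot_rescale[OF r p0] by simp
  ultimately show "rescale s p r u \<in> D" by (simp add: Dsp_iff)
  show "NN (rescale s p r u) = NN u" unfolding NN_def gag_quot_rescale[OF r p0]
      by (rule Lint_scale(2)[OF r p0 g])
  show "HH (rescale s p r u) = HH u" unfolding HH_def wquot_rescale[OF r e1] by (rule Lint_scale(2)[OF r p0 w])
  show "BB (rescale s p r u) = BB u" unfolding BB_def wquot_rescale[OF r e2]
      by (rule Lint_scale(2)[OF r _ w]) (use exponents(1-6) in auto)
qed

text \<open>The dilation exponent equals \<open>s - d / p\<close>. The part \<open>- d / p\<close>
  preserves the power \<open>p\<close>, so a factor \<open>r powr s\<close> per function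
  survives.\<close>

lemma loc_rescale:
  assumes r: "0 < r" and u: "u \<in> D"
  shows "loc R (rescale s p r u) = r powr (s * p) * loc (R / r) u"
proof -
  have [measurable]: "u \<in> borel_measurable borel" using u by (rule DspD)
  let ?F = "\<lambda>y. indicator (cball 0 (R / r)) y * u y"
  have F: "?F \<in> borel_measurable borel" by measurable
  define c where "c = r powr (- (real DIM('a) / p))"
  have i: "indicator (cball 0 R) x = (indicator (cball 0 (R / r)) (x /\<^sub>R r) :: real)" for x :: 'a
    using r by (auto simp: indicator_def field_simps)
  have "- ((real DIM('a) - s * p) / p) = s + - (real DIM('a) / p)" using p0 by (simp add: field_simps)
  then have e: "r powr (- ((real DIM('a) - s * p) / p)) = r powr s * c"
    unfolding c_def by (simp only: powr_add)
  have "(\<lambda>x. indicator (cball 0 R) x * rescale s p r u x) = (\<lambda>x. r powr s * (c * ?F (x /\<^sub>R r)))"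
    unfolding rescale_def e by (rule ext) (subst i, simp)
  then have "loc R (rescale s p r u) = \<bar>r powr s\<bar> powr p * Lint p lborel (\<lambda>x. c * ?F (x /\<^sub>R r))"
    unfolding loc_def by (simp only: Lint_cmult)
  also have "Lint p lborel (\<lambda>x. c * ?F (x /\<^sub>R r)) = loc (R / r) u"
    unfolding loc_def c_def by (rule Lint_scale(2)[OF r p0 F])
  finally show ?thesis by (simp add: powr_powr)
qed

end

section \<open>Local compactness\<close>

lemma diagonal_convergent:
  fixes a :: "nat \<Rightarrow> nat \<Rightarrow> real"
  assumes "\<And>k. \<exists>B. \<forall>n. \<bar>a k n\<bar> \<le> B"
  shows "\<exists>\<sigma>. strict_mono \<sigma> \<and> (\<forall>k. convergent (\<lambda>n. a k (\<sigma> n)))"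
proof -
  interpret subseqs "\<lambda>k \<sigma>. convergent (\<lambda>n. a k (\<sigma> n))"
  proof
    fix k and s :: "nat \<Rightarrow> nat" assume "strict_mono s"
    obtain B where B: "\<And>n. \<bar>a k n\<bar> \<le> B" using assms by blast
    have "bounded (range (\<lambda>n. a k (s n)))" using B by (auto simp: bounded_iff)
    then obtain l r where "strict_mono r" "((\<lambda>n. a k (s n)) \<circ> r) \<longlonglongrightarrow> l"
      using bounded_imp_convergent_subsequence by blast
    then show "\<exists>r'. strict_mono r' \<and> convergent (\<lambda>n. a k ((s \<circ> r') n))"
      by (auto simp: convergent_def o_def)
  qed
  \<comment> \<open>From index \<open>Suc k\<close> on the diagonal runs inside the
    \<open>k\<close>-th extraction; the finitely many earlier terms are dropped afterwards.\<close>
  have "convergent (\<lambda>n. a k ((diagseq \<circ> (+) (Suc k)) n))" for k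
    by (rule diagseq_holds) (auto simp: o_def dest: convergent_subseq_convergent)
  then have "convergent (\<lambda>n. a k (diagseq n))" for k
  proof -
    have "convergent (\<lambda>n. a k (diagseq (n + Suc k)))"
      using \<open>\<And>k. convergent (\<lambda>n. a k ((diagseq \<circ> (+) (Suc k)) n))\<close>[of k] by (simp add: add.commute)
    then show ?thesis using convergent_ignore_initial_segment[of "\<lambda>n. a k (diagseq n)" "Suc k"]
      by blast
  qed
  then show ?thesis using subseq_diagseq by blast
qed

context hardy_space
begin

definition avg :: "'a \<Rightarrow> real \<Rightarrow> ('a \<Rightarrow> real) \<Rightarrow> real" where
  "avg c \<epsilon> u = (LINT y|lborel. indicator (ball c \<epsilon>) y * u y) / (\<omega> * \<epsilon> powr d)"

lemma Lfun_ball: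
  assumes u: "u \<in> D" and e: "0 < \<epsilon>"
  shows "(\<lambda>y. indicator (ball c \<epsilon>) y * u y) \<in> Lfun p lborel"
    and "Lint p lborel (\<lambda>y. indicator (ball c \<epsilon>) y * u y) \<le> \<epsilon> powr (s * p) * (NN u / m)"
proof -
  have [measurable]: "u \<in> borel_measurable borel" using u by (rule DspD)
  have "(\<integral>\<^sup>+y. ennreal (\<bar>indicator (ball c \<epsilon>) y * u y\<bar> powr p) \<partial>lborel)
      = (\<integral>\<^sup>+y. ennreal (\<bar>u y\<bar> powr p) * indicator (ball c \<epsilon>) y \<partial>lborel)"
    by (intro nn_integral_cong) (use p0 in \<open>auto simp: indicator_def\<close>)
  also have "\<dots> \<le> ennreal (\<epsilon> powr (s * p) * (NN u / m))" by (rule hardy_ball[OF u e])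
  finally show "(\<lambda>y. indicator (ball c \<epsilon>) y * u y) \<in> Lfun p lborel"
    "Lint p lborel (\<lambda>y. indicator (ball c \<epsilon>) y * u y) \<le> \<epsilon> powr (s * p) * (NN u / m)"
    using m0 by (auto intro!: LfunI_nn_integral)
qed

lemma measure_ball: "0 < \<epsilon> \<Longrightarrow> measure lborel (ball c \<epsilon>) = \<omega> * \<epsilon> powr d" for c :: 'a
  using content_ball[of \<epsilon> c] by (simp add: d_def powr_realpow)

lemma integrable_indicator_ball: "integrable lborel (indicator (ball c \<epsilon>) :: 'a \<Rightarrow> real)"
  using emeasure_bounded_finite[of "ball c \<epsilon>"] by (intro integrable_real_indicator) auto

lemma Lfun_ball_indicator:
  assumes e: "0 < \<epsilon>" and r: "0 < r"
  shows "(indicator (ball c \<epsilon>) :: 'a \<Rightarrow> real) \<in> Lfun r lborel" "Lint r lborel (indicator (ball c \<epsilon>) :: 'a \<Rightarrow>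
      real) = \<omega> * \<epsilon> powr d"
proof -
  have *: "(\<lambda>x. (indicator (ball c \<epsilon>) x :: real) powr r) = indicator (ball c \<epsilon>)"
    using r by (auto simp: indicator_def)
  show "(indicator (ball c \<epsilon>) :: 'a \<Rightarrow> real) \<in> Lfun r lborel" "Lint r lborel (indicator (ball c \<epsilon>) :: 'a \<Rightarrow> real)
      = \<omega> * \<epsilon> powr d"
    using measure_ball[OF e, of c] integrable_indicator_ball[of c \<epsilon>] by (simp_all add: Lfun_def Lint_def *)
qed

text \<open>Hoelder against the indicator of the ball. The bound depends on \<open>u\<close> only
  through \<open>NN u\<close>, so the averages of a bounded sequence stay bounded.\<close>

lemma avg_integrable:
  assumes u: "u \<in> D" and e: "0 < \<epsilon>"
  shows "integrable lborel (\<lambda>y. indicator (ball c \<epsilon>) y * u y)"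
    and "\<bar>avg c \<epsilon> u\<bar> \<le> (\<omega> * \<epsilon> powr d) powr ((p - 1) / p) * (\<epsilon> powr (s * p) * (NN u / m)) powr (1 / p) / (\<omega> * \<epsilon>
        powr d)"
proof -
  have p': "0 < p / (p - 1)" using p by simp
  note H = Hoelder_inequality[OF p Lfun_ball_indicator(1)[OF e p'] Lfun_ball(1)[OF u e], of c c]
  have eq: "(\<lambda>x. indicator (ball c \<epsilon>) x * (indicator (ball c \<epsilon>) x * u x)) = (\<lambda>y. indicator (ball c \<epsilon>) y * u y)"
    by (auto simp: indicator_def)
  show "integrable lborel (\<lambda>y. indicator (ball c \<epsilon>) y * u y)" using H(1) unfolding eq .
  have "\<bar>LINT y|lborel. indicator (ball c \<epsilon>) y * u y\<bar> \<le> (\<omega> * \<epsilon> powr d) powr ((p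
      - 1) / p) * Lint p lborel (\<lambda>y. indicator (ball c \<epsilon>) y * u y) powr (1 / p)"
    using H(2) unfolding eq Lfun_ball_indicator(2)[OF e p'] .
  also have "\<dots> \<le> (\<omega> * \<epsilon> powr d) powr ((p - 1) / p) * (\<epsilon> powr (s * p) * (NN u / m)) powr (1 / p)"
    using p0 Lfun_ball(2)[OF u e] by (intro mult_left_mono powr_mono2) auto
  finally show "\<bar>avg c \<epsilon> u\<bar> \<le> (\<omega> * \<epsilon> powr d) powr ((p - 1) / p) * (\<epsilon> powr (s * p) * (NN u / m)) powr (1 / p) /
      (\<omega> * \<epsilon> powr d)"
    unfolding avg_def using e omega_pos by (simp add: abs_divide divide_right_mono)
qed

text \<open>Hoelder plays the role of Jensen: the deviation from the average is at most the mean of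
  \<open>\<bar>u x - u y\<bar> powr p\<close>. As \<open>x\<close> need not be the centre, the ball
  of radius \<open>2 * \<epsilon>\<close> about \<open>x\<close> is used. The factor
  \<open>\<epsilon> powr (s * p)\<close> makes the error small uniformly on bounded sets.\<close>

lemma avg_approx:
  assumes u: "u \<in> D" and e: "0 < \<epsilon>" and x: "dist x c < \<epsilon>" and g: "gx u x = ennreal \<gamma>" "0 \<le> \<gamma>"
  shows "\<bar>u x - avg c \<epsilon> u\<bar> powr p \<le> 2 powr (d + s * p) / \<omega> * \<epsilon> powr (s * p) * \<gamma>"
proof -
  have [measurable]: "u \<in> borel_measurable borel" using u by (rule DspD)
  have p': "0 < p / (p - 1)" using p by simp
  define V where "V = \<omega> * \<epsilon> powr d"
  have V: "0 < V" using e omega_pos by (simp add: V_def)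
  define X where "X = (2 * \<epsilon>) powr (d + s * p) * \<gamma>"
  have X: "0 \<le> X" using g by (simp add: X_def)
  let ?f = "\<lambda>y. indicator (ball c \<epsilon>) y * (u x - u y)"
  have sub: "ball c \<epsilon> \<subseteq> cball x (2 * \<epsilon>)"
  proof
    fix y assume "y \<in> ball c \<epsilon>"
    then show "y \<in> cball x (2 * \<epsilon>)" using x dist_triangle[of x y c] by (simp add: dist_commute)
  qed
  have "(\<integral>\<^sup>+y. ennreal (\<bar>?f y\<bar> powr p) \<partial>lborel) = (\<integral>\<^sup>+y. ennreal (\<bar>u x
      - u y\<bar> powr p) * indicator (ball c \<epsilon>) y \<partial>lborel)"
    by (intro nn_integral_cong) (use p0 in \<open>auto simp: indicator_def\<close>)
  also have "\<dots> \<le> ennreal ((2 * \<epsilon>) powr (d + s * p)) * gx u x"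
    using e by (intro diff_ball_le[OF u _ sub]) auto
  also have "\<dots> = ennreal X" unfolding X_def g by (rule ennreal_mult[symmetric]) (use g in auto)
  finally have f: "?f \<in> Lfun p lborel" "Lint p lborel ?f \<le> X"
    using X by (auto intro!: LfunI_nn_integral)
  note H = Hoelder_inequality(2)[OF p Lfun_ball_indicator(1)[OF e p'] f(1), of c]
  have "(\<lambda>y. indicator (ball c \<epsilon>) y * ?f y) = (\<lambda>y. u x * indicator (ball c \<epsilon>) y - indicator (ball c \<epsilon>) y * u y)"
    by (auto simp: indicator_def)
  then have "(LINT y|lborel. indicator (ball c \<epsilon>) y * ?f y) = (LINT y|lborel. u x * indicator (ball c \<epsilon>) y
      - indicator (ball c \<epsilon>) y * u y)"
    by simp
  also have "\<dots> = u x * V - (LINT y|lborel. indicator (ball c \<epsilon>) y * u y)"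
    using avg_integrable(1)[OF u e, of c] integrable_indicator_ball[of c \<epsilon>] measure_ball[OF e, of c]
    by (subst Bochner_Integration.integral_diff) (auto simp: V_def)
  also have "\<dots> = V * (u x - avg c \<epsilon> u)" using V by (simp add: avg_def V_def[symmetric] algebra_simps)
  finally have "V * \<bar>u x - avg c \<epsilon> u\<bar> \<le> V powr ((p - 1) / p) * Lint p lborel ?f powr (1 / p)"
    using H V unfolding Lfun_ball_indicator(2)[OF e p'] V_def[symmetric] by (simp add: abs_mult)
  also have "\<dots> \<le> V powr ((p - 1) / p) * X powr (1 / p)"
    using p0 f by (intro mult_left_mono powr_mono2) auto
  finally have "(V * \<bar>u x - avg c \<epsilon> u\<bar>) powr p \<le> (V powr ((p - 1) / p) * X powr (1 / p)) powr p"
    using V p0 by (intro powr_mono2) auto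
  then have "V powr p * \<bar>u x - avg c \<epsilon> u\<bar> powr p \<le> V powr (p - 1) * X"
    using p0 X by (simp add: powr_mult powr_powr)
  moreover have "V powr p = V powr (p - 1) * V" using V by (simp add: powr_diff)
  ultimately have "V powr (p - 1) * (V * \<bar>u x - avg c \<epsilon> u\<bar> powr p) \<le> V powr (p - 1) * X"
      by (simp add: mult.assoc)
  then have "V * \<bar>u x - avg c \<epsilon> u\<bar> powr p \<le> X" using V by simp
  also have "X = V * (2 powr (d + s * p) / \<omega> * \<epsilon> powr (s * p) * \<gamma>)"
    unfolding X_def V_def powr_mult powr_add using omega_pos by simp
  finally show ?thesis using V by (simp only: mult_le_cancel_left_pos)
qed

lemma Dsp_Fatou:
  assumes U: "\<And>n. U n \<in> D" "\<And>n. NN (U n) \<le> M" and M: "0 < M"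
    and u: "u \<in> borel_measurable borel" and lim: "AE x in lborel. (\<lambda>n. U n x) \<longlonglongrightarrow> u x"
  shows "u \<in> D" "NN u \<le> M"
proof -
  obtain C where C: "0 < C" "\<And>u. u \<in> D \<Longrightarrow> NN u \<le> M \<Longrightarrow> Lint ps lborel u \<le> C" using Lint_ps_bounded[OF M] by blast
  note [measurable] = u
  have 1: "u \<in> Lfun ps lborel"
    by (rule Lfun_Fatou(1)[of U ps lborel C]) (use U C lim exponents(1-6) in \<open>auto dest: DspD\<close>)
  have "AE z in lborel. (\<lambda>n. gq (U n) z) \<longlonglongrightarrow> gq u z"
    using AE_lborel_fst_snd[OF lim]
  proof eventually_elim
    case (elim z)
    then show ?case unfolding gag_quot_def divide_inverse by (intro tendsto_intros) auto
  qed
  then have 2: "gq u \<in> Lfun p lborel" "NN u \<le> M" unfolding NN_def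
    using Lfun_Fatou[of "\<lambda>n. gq (U n)" p lborel M "gq u"] U p0 by (auto simp: NN_def dest: DspD)
  show "u \<in> D" using 1 2 by (simp add: Dsp_iff)
  show "NN u \<le> M" by fact
qed

text \<open>One scale is fixed at which replacing functions by ball averages costs at most
  \<open>e / 2\<close>, uniformly along the sequence. At that scale finitely many balls cover the
  compact ball, so convergence of finitely many averages gives the other half.\<close>

lemma averages_Cauchy:
  assumes U: "\<And>n. U n \<in> D" "\<And>n. NN (U n) \<le> M" and M: "0 < M"
    and dense: "\<And>x::'a. \<And>e. 0 < e \<Longrightarrow> \<exists>i. dist x (c i) < e"
    and conv: "\<And>i j. convergent (\<lambda>n. avg (c i) (1 / real (Suc j)) (U n))"
    and e: "0 < e"
  shows "\<exists>N. \<forall>n\<ge>N. \<forall>k\<ge>N. loc R (\<lambda>x. U n x - U k x) \<le> e"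
proof -
  define K where "K = 2 powr (d + s * p) / \<omega>"
  have K: "0 < K" using omega_pos by (simp add: K_def)
  define A where "A = 2 powr p * (2 powr p * 2) * K * M"
  have A: "0 < A" using K M by (simp add: A_def)
  have mR: "0 \<le> measure lborel (cball (0::'a) R)" by simp
  have "(\<lambda>j. A * (1 / real (Suc j)) powr (s * p)) \<longlonglongrightarrow> A * 0 powr (s * p)"
    using sp0 LIMSEQ_Suc[OF lim_1_over_n] by (intro tendsto_mult tendsto_const tendsto_powr') auto
  then have "eventually (\<lambda>j. A * (1 / real (Suc j)) powr (s * p) < e / 2) sequentially"
    using e by (intro order_tendstoD) auto
  then obtain j where j: "A * (1 / real (Suc j)) powr (s * p) < e / 2" by (auto simp: eventually_sequentially)
  define \<epsilon> where "\<epsilon> = 1 / real (Suc j)"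
  have \<epsilon>: "0 < \<epsilon>" by (simp add: \<epsilon>_def)
  have "cball (0::'a) R \<subseteq> (\<Union>i. ball (c i) \<epsilon>)" using dense[OF \<epsilon>] by (auto simp: dist_commute)
  then obtain F where F: "finite F" "cball (0::'a) R \<subseteq> (\<Union>i\<in>F. ball (c i) \<epsilon>)"
    using compactE_image[OF compact_cball, of UNIV "\<lambda>i. ball (c i) \<epsilon>" "0::'a" R] by auto
  \<comment> \<open>Summing over all centres gives one number that bounds the discrepancy of
    averages whichever ball contains \<open>x\<close>.\<close>
  define S where "S n k = (\<Sum>i\<in>F. \<bar>avg (c i) \<epsilon> (U n) - avg (c i) \<epsilon> (U k)\<bar> powr p)" for n k
  define B where "B = 2 powr p * (measure lborel (cball (0::'a) R) + 1)"
  have B: "0 < B" using mR by (simp add: B_def add_nonneg_pos)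
  \<comment> \<open>Makes \<open>B * S n k\<close> at most \<open>e / 2\<close>; the
    \<open>+ 1\<close> keeps the denominator positive when \<open>F\<close> is empty.\<close>
  define \<eta> where "\<eta> = (e / (2 * B * (real (card F) + 1))) powr (1 / p)"
  have \<eta>: "0 < \<eta>" using e B by (simp add: \<eta>_def)
  have \<eta>p: "\<eta> powr p = e / (2 * B * (real (card F) + 1))" using e B p0 by (simp add: \<eta>_def powr_powr)
  have "\<forall>i. \<exists>N. \<forall>n\<ge>N. \<forall>k\<ge>N. \<bar>avg (c i) \<epsilon> (U n) - avg (c i) \<epsilon> (U k)\<bar> < \<eta>"
  proof
    fix i
    have "Cauchy (\<lambda>n. avg (c i) \<epsilon> (U n))" using conv[of i j] by (simp add: \<epsilon>_def Cauchy_convergent_iff)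
    then show "\<exists>N. \<forall>n\<ge>N. \<forall>k\<ge>N. \<bar>avg (c i) \<epsilon> (U n) - avg (c i) \<epsilon> (U k)\<bar> < \<eta>"
      using \<eta> by (auto simp: Cauchy_def dist_real_def)
  qed
  then obtain N where N: "\<And>i n k. n \<ge> N i \<Longrightarrow> k \<ge> N i \<Longrightarrow> \<bar>avg (c i) \<epsilon> (U n) - avg (c i) \<epsilon> (U k)\<bar> < \<eta>" by metis
  define N0 where "N0 = Max (insert 0 (N ` F))"
  have N0: "N i \<le> N0" if "i \<in> F" for i using that F by (auto simp: N0_def intro!: Max_ge)
  have SB: "B * S n k \<le> e / 2" if "n \<ge> N0" "k \<ge> N0" for n k
  proof -
    have "S n k \<le> (\<Sum>i\<in>F. \<eta> powr p)" unfolding S_def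
    proof (intro sum_mono powr_mono2)
      fix i assume "i \<in> F"
      from N[OF order_trans[OF N0[OF this] that(1)] order_trans[OF N0[OF this] that(2)]]
      show "\<bar>avg (c i) \<epsilon> (U n) - avg (c i) \<epsilon> (U k)\<bar> \<le> \<eta>" by simp
    qed (use p0 in auto)
    also have "\<dots> = real (card F) * \<eta> powr p" by simp
    also have "\<dots> \<le> (real (card F) + 1) * \<eta> powr p" by (intro mult_right_mono) auto
    also have "\<dots> = e / (2 * B)"
    proof -
      have "0 < real (card F) + 1" by simp
      then show ?thesis unfolding \<eta>p by simp
    qed
    finally have "B * S n k \<le> B * (e / (2 * B))" using B by (intro mult_left_mono) auto
    then show ?thesis using B by simp
  qed
  have "loc R (\<lambda>x. U n x - U k x) \<le> e" if nk: "n \<ge> N0" "k \<ge> N0" for n k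
  proof -
    note [measurable] = gx_integral(1)[OF U(1)]
    \<comment> \<open>Two applications of the power triangle inequality: one separates the averages
      from the deviations, the other the two deviations.\<close>
    define B1 where "B1 = 2 powr p * (2 powr p * (K * \<epsilon> powr (s * p)))"
    have B1: "0 \<le> B1" using K by (simp add: B1_def)
    have pw: "ennreal (\<bar>U n x - U k x\<bar> powr p) * indicator (cball 0 R) x
       \<le> ennreal B1 * (gx (U n) x + gx (U k) x) + ennreal (2 powr p * S n k) * indicator (cball 0 R) x" for x
    proof (cases "x \<in> cball 0 R \<and> gx (U n) x \<noteq> top \<and> gx (U k) x \<noteq> top")
      case True
      then obtain g h where g: "gx (U n) x = ennreal g" "0 \<le> g" and h: "gx (U k) x = ennreal h" "0 \<le> h"
        by (metis ennreal_cases)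
      from True F obtain i where i: "i \<in> F" "dist x (c i) < \<epsilon>" by (auto simp: dist_commute)
      let ?a = "avg (c i) \<epsilon> (U n)" and ?b = "avg (c i) \<epsilon> (U k)"
      have 1: "\<bar>U n x - ?a\<bar> powr p \<le> K * \<epsilon> powr (s * p) * g"
        unfolding K_def by (rule avg_approx[OF U(1) \<epsilon> i(2) g])
      have 2: "\<bar>U k x - ?b\<bar> powr p \<le> K * \<epsilon> powr (s * p) * h"
        unfolding K_def by (rule avg_approx[OF U(1) \<epsilon> i(2) h])
      have 3: "\<bar>?a - ?b\<bar> powr p \<le> S n k" unfolding S_def
        by (rule member_le_sum[OF i(1)]) (use F in auto)
      have "\<bar>U n x - U k x\<bar> powr p = \<bar>((U n x - ?a) - (U k x - ?b)) + (?a - ?b)\<bar> powr p" by simp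
      also have "\<dots> \<le> 2 powr p * (\<bar>(U n x - ?a) - (U k x - ?b)\<bar> powr p + \<bar>?a - ?b\<bar> powr p)"
        by (rule abs_add_powr_le[OF p0])
      also have "\<dots> \<le> 2 powr p * (2 powr p * (\<bar>U n x - ?a\<bar> powr p + \<bar>U k x - ?b\<bar> powr p) + S n k)"
        using 3 by (intro mult_left_mono add_mono abs_diff_powr_le[OF p0]) auto
      also have "\<dots> \<le> 2 powr p * (2 powr p * (K * \<epsilon> powr (s * p) * g + K * \<epsilon> powr (s * p) * h) + S n k)"
        using 1 2 by (intro mult_left_mono add_mono) auto
      also have "\<dots> = B1 * (g + h) + 2 powr p * S n k" by (simp add: B1_def algebra_simps)
      finally have "ennreal (\<bar>U n x - U k x\<bar> powr p) \<le> ennreal (B1 * (g + h) + 2 powr p * S n k)"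
        by (rule ennreal_leI)
      also have "\<dots> = ennreal B1 * (gx (U n) x + gx (U k) x) + ennreal (2 powr p * S n k)"
        using B1 g h by (simp add: ennreal_mult ennreal_plus S_def sum_nonneg)
      finally show ?thesis using True by simp
    next
      case False
      have "B1 > 0" using K \<epsilon> by (simp add: B1_def)
      then show ?thesis using False by (auto simp: ennreal_mult_top indicator_def)
    qed
    have "ennreal (loc R (\<lambda>x. U n x - U k x)) = (\<integral>\<^sup>+x. ennreal (\<bar>U n x
        - U k x\<bar> powr p) * indicator (cball 0 R) x \<partial>lborel)"
      by (rule nn_integral_loc[symmetric, OF Dsp_diff[OF U(1) U(1)]])
    also have "\<dots> \<le> (\<integral>\<^sup>+x. ennreal B1 * (gx (U n) x + gx (U k) x)
        + ennreal (2 powr p * S n k) * indicator (cball 0 R) x \<partial>lborel)"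
      by (intro nn_integral_mono pw)
    also have "\<dots> = ennreal B1 * (ennreal (NN (U n)) + ennreal (NN (U k)))
        + ennreal (2 powr p * S n k) * emeasure lborel (cball (0::'a) R)"
      by (subst nn_integral_add; simp add: nn_integral_cmult nn_integral_add gx_integral(2) U
          nn_integral_cmult_indicator)
    also have "\<dots> = ennreal (B1 * (NN (U n) + NN (U k)) + 2 powr p * S n k * measure lborel (cball (0::'a) R))"
    proof -
      have "emeasure lborel (cball (0::'a) R) = ennreal (measure lborel (cball (0::'a) R))"
        using emeasure_bounded_finite[of "cball (0::'a) R"] by (intro emeasure_eq_ennreal_measure) auto
      then show ?thesis using B1 by (simp add: ennreal_mult ennreal_plus S_def sum_nonneg)
    qed
    finally have "loc R (\<lambda>x. U n x - U k x) \<le> B1 * (NN (U n) + NN (U k))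
        + 2 powr p * S n k * measure lborel (cball (0::'a) R)"
      using B1 by (subst (asm) ennreal_le_iff) (auto simp: S_def intro!: add_nonneg_nonneg mult_nonneg_nonneg
          sum_nonneg)
    also have "\<dots> \<le> B1 * (M + M) + B * S n k"
    proof (intro add_mono mult_left_mono U B1)
      have S0: "0 \<le> S n k" by (simp add: S_def sum_nonneg)
      have "2 powr p * S n k * measure lborel (cball (0::'a) R)
          \<le> 2 powr p * S n k * (measure lborel (cball (0::'a) R) + 1)"
        using S0 by (intro mult_left_mono) auto
      then show "2 powr p * S n k * measure lborel (cball (0::'a) R) \<le> B * S n k" by (simp add: B_def mult_ac)
    qed
    also have "B1 * (M + M) = A * \<epsilon> powr (s * p)" by (simp add: B1_def A_def)
    also have "\<dots> + B * S n k \<le> e / 2 + e / 2" using j SB[OF nk] by (intro add_mono) (auto simp: \<epsilon>_def)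
    finally show ?thesis by simp
  qed
  then show ?thesis by blast
qed

end

lemma convergent_of_geometric_increments:
  fixes f :: "nat \<Rightarrow> real"
  assumes "\<And>k. N \<le> k \<Longrightarrow> \<bar>f (Suc k) - f k\<bar> \<le> C * \<rho> ^ k" "0 \<le> \<rho>" "\<rho> < 1"
  shows "convergent f"
proof -
  have "summable (\<lambda>k. f (Suc k) - f k)"
    by (rule summable_comparison_test'[where g="\<lambda>k. C * \<rho> ^ k" and N=N])
       (use assms in \<open>auto intro!: summable_mult summable_geometric\<close>)
  then have "convergent (\<lambda>n. f n - f 0)"
    by (simp add: summable_iff_convergent sum_lessThan_telescope)
  from convergent_add[OF this convergent_const[of "f 0"]] show ?thesis by simp
qed

text \<open>Functions into the reals are not an instance of \<open>real_vector\<close>, so closure under midpoints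
  stands in for the convex hull of a tail of the sequence; it suffices for the Mazur-type argument.\<close>

inductive_set midpoints :: "(nat \<Rightarrow> 'b \<Rightarrow> real) \<Rightarrow> nat \<Rightarrow> ('b \<Rightarrow> real) set" for V n where
  base: "n \<le> k \<Longrightarrow> V k \<in> midpoints V n"
| step: "a \<in> midpoints V n \<Longrightarrow> b \<in> midpoints V n \<Longrightarrow> (\<lambda>x. (a x + b x) / 2) \<in> midpoints V n"

lemma midpoints_antimono: "w \<in> midpoints V n \<Longrightarrow> k \<le> n \<Longrightarrow> w \<in> midpoints V k"
  by (induction rule: midpoints.induct) (auto intro: midpoints.intros)

lemma midpoints_bound:
  assumes "w \<in> midpoints V n" "\<And>k. n \<le> k \<Longrightarrow> \<bar>V k x\<bar> \<le> \<delta>" shows "\<bar>w x\<bar> \<le> \<delta>"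
  using assms(1)
proof (induction rule: midpoints.induct)
  case (step a b)
  have "\<bar>(a x + b x) / 2\<bar> \<le> (\<bar>a x\<bar> + \<bar>b x\<bar>) / 2" by simp
  then show ?case using step.IH by simp
qed (use assms in auto)

context hardy_space
begin

text \<open>The Riesz-Fischer argument carried out on all balls at once: along a fast subsequence
  the increments are summable at almost every point, and Fatou upgrades the pointwise limit to local
  convergence in the power \<open>p\<close>.\<close>

lemma loc_Cauchy_imp_limit:
  assumes V: "\<And>n. V n \<in> D" "\<And>n. NN (V n) \<le> M" and M: "0 < M"
    and Cauchy: "\<And>R e. 0 < e \<Longrightarrow> \<exists>N. \<forall>n\<ge>N. \<forall>k\<ge>N. loc R (\<lambda>x. V n x - V k x) \<le> e"
  shows "\<exists>\<tau> u. strict_mono (\<tau> :: nat \<Rightarrow> nat) \<and> u \<in> D \<and> NN u \<le> M \<and> (AE x in lborel. (\<lambda>n. V (\<tau> n) x) \<longlonglongrightarrow> u x)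
     \<and> (\<forall>R. (\<lambda>n. loc R (\<lambda>x. V (\<tau> n) x - u x)) \<longlonglongrightarrow> 0)"
proof -
  \<comment> \<open>Radius and accuracy grow together. With the weight \<open>2 ^ k\<close> below,
    the integrals \<open>(1 / 4) ^ k\<close> are still summable, while the weight itself forces
    geometric decay of the increments at a point.\<close>
  have "\<forall>i. \<exists>N. \<forall>n\<ge>N. \<forall>k\<ge>N. loc (real i) (\<lambda>x. V n x - V k x) \<le> (1 / 4) ^ i"
    by (intro allI Cauchy) simp
  then obtain N where N: "\<And>i n k. N i \<le> n \<Longrightarrow> N i \<le> k \<Longrightarrow> loc (real i) (\<lambda>x. V n x - V k x) \<le> (1 / 4) ^ i" by metis
  define \<tau> where "\<tau> = rec_nat (N 0) (\<lambda>k t. max (Suc t) (N (Suc k)))"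
  have \<tau>S: "\<tau> (Suc k) = max (Suc (\<tau> k)) (N (Suc k))" for k by (simp add: \<tau>_def)
  have \<tau>: "strict_mono \<tau>" by (simp add: strict_mono_Suc_iff \<tau>S less_max_iff_disj)
  have \<tau>N: "N k \<le> \<tau> k" for k by (cases k) (simp_all add: \<tau>S, simp add: \<tau>_def)
  define W where "W k = V (\<tau> k)" for k
  have W: "W k \<in> D" "NN (W k) \<le> M" for k using V by (auto simp: W_def)
  have [measurable]: "W k \<in> borel_measurable borel" for k using W(1) by (rule DspD)
  define h where "h = (\<lambda>k x. ennreal (2 ^ k) * (ennreal (\<bar>W (Suc k) x
      - W k x\<bar> powr p) * indicator (cball 0 (real k)) x))"
  have [measurable]: "h k \<in> borel_measurable borel" for k unfolding h_def by measurable
  have hk: "(\<integral>\<^sup>+x. h k x \<partial>lborel) \<le> ennreal ((1 / 2) ^ k)" for k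
  proof -
    have "(\<integral>\<^sup>+x. h k x \<partial>lborel) = ennreal (2 ^ k) * ennreal (loc (real k) (\<lambda>x. W (Suc k) x - W k x))"
      unfolding h_def by (subst nn_integral_cmult) (auto simp: nn_integral_loc Dsp_diff W)
    also have "\<dots> \<le> ennreal (2 ^ k) * ennreal ((1 / 4) ^ k)"
      unfolding W_def using \<tau>N[of k] \<tau>S[of k]
      by (intro mult_left_mono ennreal_leI N) (auto simp: le_max_iff_disj le_Suc_eq)
    also have "\<dots> = ennreal ((1 / 2) ^ k)"
      by (simp add: ennreal_mult[symmetric] power_mult_distrib[symmetric])
    finally show ?thesis .
  qed
  have "(\<integral>\<^sup>+x. (\<Sum>k. h k x) \<partial>lborel) = (\<Sum>k. \<integral>\<^sup>+x. h k x \<partial>lborel)"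
    by (rule nn_integral_suminf) simp
  also have "\<dots> \<le> (\<Sum>k. ennreal ((1 / 2) ^ k))" by (intro suminf_le hk) auto
  also have "\<dots> = ennreal (\<Sum>k. (1 / 2) ^ k)"
    by (intro suminf_ennreal2 summable_geometric) auto
  finally have "(\<integral>\<^sup>+x. (\<Sum>k. h k x) \<partial>lborel) \<noteq> \<infinity>" by (auto simp: top_unique)
  then have "AE x in lborel. (\<Sum>k. h k x) \<noteq> \<infinity>"
    by (intro nn_integral_noteq_infinite) auto
  then have conv: "AE x in lborel. convergent (\<lambda>k. W k x)"
  proof eventually_elim
    case (elim x)
    then obtain C where C: "0 \<le> C" "(\<Sum>k. h k x) = ennreal C" by (cases "\<Sum>k. h k x") auto
    define \<rho> where "\<rho> = (1 / 2) powr (1 / p)"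
    have \<rho>: "0 < \<rho>" "\<rho> < 1" using p0 powr_less_mono2[of "1 / p" "1 / 2" 1] by (auto simp: \<rho>_def)
    show ?case
    proof (rule convergent_of_geometric_increments)
      \<comment> \<open>From here on \<open>x\<close> lies in the ball of radius \<open>k\<close>,
        so the indicator in \<open>h k\<close> is \<open>1\<close>.\<close>
      fix k assume k: "nat \<lceil>norm x\<rceil> \<le> k"
      then have x: "x \<in> cball 0 (real k)" by simp
      have "h k x = (\<Sum>i\<in>{k}. h i x)" by simp
      also have "\<dots> \<le> (\<Sum>i. h i x)" by (rule sum_le_suminf) auto
      also have "\<dots> = ennreal C" by (rule C)
      finally have "ennreal (2 ^ k * \<bar>W (Suc k) x - W k x\<bar> powr p) \<le> ennreal C"
        using x by (simp add: h_def ennreal_mult)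
      then have "\<bar>W (Suc k) x - W k x\<bar> powr p \<le> C * (1 / 2) ^ k"
        using C by (simp add: field_simps)
      then have "(\<bar>W (Suc k) x - W k x\<bar> powr p) powr (1 / p) \<le> (C * (1 / 2) ^ k) powr (1 / p)"
        using p0 by (intro powr_mono2) auto
      also have "\<dots> = C powr (1 / p) * ((1 / 2) ^ k) powr (1 / p)" by (simp only: powr_mult)
      also have "((1 / 2::real) ^ k) powr (1 / p) = \<rho> ^ k"
        unfolding \<rho>_def by (simp add: powr_realpow[symmetric] powr_powr mult.commute)
      finally show "\<bar>W (Suc k) x - W k x\<bar> \<le> C powr (1 / p) * \<rho> ^ k" using p0 by (simp add: powr_powr)
    qed (use \<rho> in auto)
  qed
  define u where "u x = lim (\<lambda>k. W k x)" for x
  have u[measurable]: "u \<in> borel_measurable borel" unfolding u_def by (rule borel_measurable_lim_metric) simp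
  have lim: "AE x in lborel. (\<lambda>k. W k x) \<longlonglongrightarrow> u x"
    using conv by eventually_elim (simp add: u_def convergent_LIMSEQ_iff)
  note uD = Dsp_Fatou[OF W M u lim]
  have "(\<lambda>n. loc R (\<lambda>x. W n x - u x)) \<longlonglongrightarrow> 0" for R
  proof (rule LIMSEQ_I)
    fix e :: real assume e: "0 < e"
    obtain N where N: "\<And>n k. N \<le> n \<Longrightarrow> N \<le> k \<Longrightarrow> loc R (\<lambda>x. V n x - V k x) \<le> e / 2"
      using Cauchy[of "e / 2" R] e by auto
    have "loc R (\<lambda>x. W n x - u x) \<le> e / 2" if n: "N \<le> n" for n
    proof -
      \<comment> \<open>Fatou acts in the second index only; the shift by \<open>N\<close> keeps it
        in the range of the Cauchy estimate from the start.\<close>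
      let ?f = "\<lambda>j x. indicator (cball 0 R) x * (W n x - W (j + N) x)"
      show ?thesis unfolding loc_def
      proof (rule Lfun_Fatou(2)[where f="?f"])
        fix j
        show "?f j \<in> Lfun p lborel" by (intro Lfun_loc Dsp_diff W)
        have "N \<le> \<tau> n" "N \<le> \<tau> (j + N)"
          using n seq_suble[OF \<tau>, of n] seq_suble[OF \<tau>, of "j + N"] by auto
        then show "Lint p lborel (?f j) \<le> e / 2" using N by (simp add: loc_def[symmetric] W_def)
      next
        show "AE x in lborel. (\<lambda>j. ?f j x) \<longlonglongrightarrow> indicator (cball 0 R) x * (W n x - u x)"
          using lim by eventually_elim (intro tendsto_intros LIMSEQ_ignore_initial_segment)
      qed (use p0 in auto)
    qed
    then show "\<exists>N. \<forall>n\<ge>N. norm (loc R (\<lambda>x. W n x - u x) - 0) < e" using e by (intro exI[of _ N]) fastforce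
  qed
  with \<tau> uD lim show ?thesis unfolding W_def by blast
qed

text \<open>Countably many averages, over balls with centres in a dense set and radii
  \<open>1 / (j + 1)\<close>, are made convergent by one diagonal extraction; these suffice for the
  local Cauchy property.\<close>

lemma rellich:
  assumes U: "\<And>n. U n \<in> D" "\<And>n. NN (U n) \<le> M" and M: "0 < M"
  shows "\<exists>\<sigma> u. strict_mono (\<sigma> :: nat \<Rightarrow> nat) \<and> u \<in> D \<and> NN u \<le> M \<and> (AE x in lborel. (\<lambda>n. U (\<sigma> n) x) \<longlonglongrightarrow> u x)
     \<and> (\<forall>R. (\<lambda>n. loc R (\<lambda>x. U (\<sigma> n) x - u x)) \<longlonglongrightarrow> 0)"
proof -
  obtain X :: "'a set" where X: "countable X" "\<And>S. open S \<Longrightarrow> S \<noteq> {} \<Longrightarrow> \<exists>x\<in>X. x \<in> S"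
    using countable_dense_exists by blast
  have X0: "X \<noteq> {}" using X(2)[of UNIV] by auto
  define c where "c = from_nat_into X"
  have dense: "\<exists>i. dist x (c i) < e" if e: "0 < e" for x e
  proof -
    obtain y where "y \<in> X" "y \<in> ball x e" using X(2)[of "ball x e"] e by auto
    then show ?thesis using from_nat_into_surj[OF X(1)] by (auto simp: c_def)
  qed
  define a where "a k n = avg (c (fst (prod_decode k))) (1 / real (Suc (snd (prod_decode k)))) (U n)" for k n
  have "\<exists>B. \<forall>n. \<bar>a k n\<bar> \<le> B" for k
  proof -
    let ?c = "c (fst (prod_decode k))" and ?e = "1 / real (Suc (snd (prod_decode k)))"
    have e: "0 < ?e" by simp
    have "\<bar>a k n\<bar> \<le> (\<omega> * ?e powr d) powr ((p - 1) / p) * (?e powr (s * p) * (M / m)) powr (1 / p) / (\<omega> * ?e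
        powr d)" for n
    proof -
      show ?thesis unfolding a_def using omega_pos p0 m0 M U(2)[of n]
        by (intro order_trans[OF avg_integrable(2)[OF U(1) e]] divide_right_mono mult_left_mono powr_mono2) auto
    qed
    then show ?thesis by blast
  qed
  from diagonal_convergent[of a, OF this] obtain \<sigma> where \<sigma>: "strict_mono \<sigma>" "\<And>k. convergent (\<lambda>n. a k (\<sigma> n))"
      by blast
  have "convergent (\<lambda>n. avg (c i) (1 / real (Suc j)) (U (\<sigma> n)))" for i j
    using \<sigma>(2)[of "prod_encode (i, j)"] by (simp add: a_def)
  from averages_Cauchy[of "\<lambda>n. U (\<sigma> n)", OF U M dense this]
  have "\<And>R e. 0 < e \<Longrightarrow> \<exists>N. \<forall>n\<ge>N. \<forall>k\<ge>N. loc R (\<lambda>x. U (\<sigma> n) x - U (\<sigma> k) x) \<le> e" by blast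
  from loc_Cauchy_imp_limit[of "\<lambda>n. U (\<sigma> n)", OF U M this] obtain \<tau> u where
    "strict_mono (\<tau> :: nat \<Rightarrow> nat)" "u \<in> D \<and> NN u \<le> M \<and> (AE x in lborel. (\<lambda>n. U (\<sigma> (\<tau> n)) x) \<longlonglongrightarrow> u x)
     \<and> (\<forall>R. (\<lambda>n. loc R (\<lambda>x. U (\<sigma> (\<tau> n)) x - u x)) \<longlonglongrightarrow> 0)" by blast
  then show ?thesis using strict_mono_o[OF \<sigma>(1)] by (intro exI[of _ "\<sigma> \<circ> \<tau>"] exI[of _ u]) auto
qed

section \<open>Weak continuity of bounded functionals\<close>

abbreviation dual :: "(('a \<Rightarrow> real) \<Rightarrow> real) set" where "dual \<equiv> Dsp_dual s p"

lemma dualD: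
  assumes "f \<in> dual"
  shows "u \<in> D \<Longrightarrow> v \<in> D \<Longrightarrow> f (\<lambda>x. u x + v x) = f u + f v"
    and "u \<in> D \<Longrightarrow> f (\<lambda>x. c * u x) = c * f u"
    and "\<exists>C\<ge>0. \<forall>u\<in>D. \<bar>f u\<bar> \<le> C * gagliardo s p u"
proof -
  show "u \<in> D \<Longrightarrow> v \<in> D \<Longrightarrow> f (\<lambda>x. u x + v x) = f u + f v" "u \<in> D \<Longrightarrow> f (\<lambda>x. c * u x) = c * f u"
    using assms by (auto simp: Dsp_dual_def)
  obtain C where C: "\<And>u. u \<in> D \<Longrightarrow> \<bar>f u\<bar> \<le> C * gagliardo s p u" using assms unfolding Dsp_dual_def by blast
  have "\<bar>f u\<bar> \<le> max 0 C * gagliardo s p u" if "u \<in> D" for u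
    using C[OF that] mult_right_mono[of C "max 0 C" "gagliardo s p u"] by (simp add: gagliardo_def)
  then show "\<exists>C\<ge>0. \<forall>u\<in>D. \<bar>f u\<bar> \<le> C * gagliardo s p u" by (intro exI[of _ "max 0 C"]) auto
qed

lemma dual_diff: "f \<in> dual \<Longrightarrow> u \<in> D \<Longrightarrow> v \<in> D \<Longrightarrow> f (\<lambda>x. u x - v x) = f u - f v"
  using dualD(1)[of f u "\<lambda>x. -1 * v x"] dualD(2)[of f v "-1"] Dsp_cmult[of v "-1"] by simp

text \<open>A midpoint of functions with \<open>\<epsilon> \<le> g\<close> keeps that bound by
  linearity, and midpoints of late terms still tend to zero pointwise. Elements of nearly least
  seminorm among the midpoints of each tail form a Cauchy sequence by uniform convexity; since they
  tend to zero almost everywhere, their seminorms become small, which contradicts boundedness of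
  \<open>g\<close>.\<close>

lemma dual_bounded_below_contradiction:
  assumes g: "g \<in> dual" and V: "\<And>n. V n \<in> D" "\<And>n. NN (V n) \<le> M" and M: "0 < M"
    and lim: "AE x in lborel. (\<lambda>n. V n x) \<longlonglongrightarrow> 0" and \<epsilon>: "0 < \<epsilon>" "\<And>n. \<epsilon> \<le> g (V n)"
  shows False
proof -
  have mid: "w \<in> D \<and> \<epsilon> \<le> g w" if "w \<in> midpoints V n" for w n
    using that
  proof (induction rule: midpoints.induct)
    case (step a b)
    have eq: "(\<lambda>x. (a x + b x) / 2) = (\<lambda>x. (1 / 2) * (a x + b x))" by auto
    have ab: "(\<lambda>x. a x + b x) \<in> D" using step.IH by (intro Dsp_add) auto
    have "g (\<lambda>x. (1 / 2) * (a x + b x)) = (1 / 2) * (g a + g b)"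
      using dualD(2)[OF g ab] dualD(1)[OF g, of a b] step.IH by metis
    then show ?case unfolding eq using step.IH Dsp_cmult[OF ab, of "1/2"] by simp
  qed (use V \<epsilon> in auto)
  \<comment> \<open>Shrinking tails make these infima increase, and \<open>M\<close> bounds them, so
    they form a Cauchy sequence.\<close>
  define I where "I n = Inf (NN ` midpoints V n)" for n
  have bdd: "bdd_below (NN ` midpoints V n)" for n by (rule bdd_belowI[of _ 0]) auto
  have ne: "midpoints V n \<noteq> {}" for n using midpoints.base[of n n V] by auto
  have Ile: "I n \<le> NN w" if "w \<in> midpoints V n" for n w
    unfolding I_def using that bdd by (intro cInf_lower) auto
  have IM: "I n \<le> M" for n using Ile[OF midpoints.base[of n n V]] V(2)[of n] by simp
  have Imono: "I n \<le> I k" if "n \<le> k" for n k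
    unfolding I_def using ne bdd midpoints_antimono[OF _ that]
        by (intro cInf_superset_mono image_mono subsetI) auto
  have I0: "0 \<le> I n" for n unfolding I_def using ne[of n] by (intro cInf_greatest) auto
  have "Bseq I" using I0 IM by (intro BseqI'[of _ M]) auto
  then have "convergent I" using Imono by (intro Bseq_mono_convergent) auto
  then have ICauchy: "Cauchy I" by (simp add: Cauchy_convergent_iff)
  have "\<exists>w. w \<in> midpoints V n \<and> NN w < I n + 1 / real (Suc n)" for n
  proof -
    have "Inf (NN ` midpoints V n) < I n + 1 / real (Suc n)" by (simp add: I_def)
    from cInf_lessD[OF _ this] ne show ?thesis by blast
  qed
  then obtain w where w: "\<And>n. w n \<in> midpoints V n" "\<And>n. NN (w n) < I n + 1 / real (Suc n)" by metis
  have wD: "w n \<in> D" for n using mid[OF w(1)] by auto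
  have wM: "NN (w n) \<le> M + 1" for n
  proof -
    have "1 / real (Suc n) \<le> 1" by simp
    then show ?thesis using w(2)[of n] IM[of n] by linarith
  qed
  have wlim: "AE x in lborel. (\<lambda>n. w n x) \<longlonglongrightarrow> 0"
    using lim
  proof eventually_elim
    case (elim x)
    show ?case
    proof (rule LIMSEQ_I)
      fix r :: real assume "0 < r"
      then obtain N where "\<And>n. n \<ge> N \<Longrightarrow> \<bar>V n x\<bar> \<le> r / 2" using LIMSEQ_D[OF elim, of "r/2"] by fastforce
      then have "\<bar>w n x\<bar> \<le> r / 2" if "n \<ge> N" for n
        using midpoints_bound[OF w(1), of n x "r/2"] that by auto
      then show "\<exists>N. \<forall>n\<ge>N. norm (w n x - 0) < r" using \<open>0 < r\<close> by (intro exI[of _ N]) fastforce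
    qed
  qed
  have small: "\<exists>n. NN (w n) \<le> e" if e: "0 < e" for e
  proof -
    define e1 where "e1 = e / (4 * (M + 1))"
    have e1: "0 < e1" using e M by (simp add: e1_def)
    obtain C where C: "C \<ge> 0" "\<And>f g. f \<in> Lfun p lborel \<Longrightarrow> g \<in> Lfun p lborel
        \<Longrightarrow> Lint p lborel (\<lambda>x. f x - g x) \<le> e1 * (Lint p lborel f + Lint p lborel g)
            + C * ((Lint p lborel f + Lint p lborel g) / 2 - Lint p (lborel::('a\<times>'a) measure) (\<lambda>x. (f x
                + g x) / 2))"
      using Lint_uniform_convexity[OF p e1] by blast
    \<comment> \<open>Bounds both the excess of \<open>w n\<close> over the infimum and the
      variation of the infima. The midpoint of \<open>w n\<close> and \<open>w (k + n)\<close> stays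
      in \<open>midpoints V n\<close>, so its \<open>NN\<close> is at least \<open>I n\<close> and
      the convexity defect is at most \<open>2 * e2\<close>.\<close>
    define e2 where "e2 = e / (4 * (C + 1))"
    have e2: "0 < e2" using e C(1) by (simp add: e2_def)
    obtain N1 where N1: "\<And>n k. n \<ge> N1 \<Longrightarrow> k \<ge> N1 \<Longrightarrow> \<bar>I n - I k\<bar> < e2"
      using ICauchy e2 unfolding Cauchy_def dist_real_def by blast
    obtain N2 where N2: "1 / real (Suc N2) < e2" using nat_approx_posE[OF e2] by blast
    define n where "n = max N1 N2"
    have n: "1 / real (Suc n) < e2"
    proof -
      have "1 / real (Suc n) \<le> 1 / real (Suc N2)" by (intro divide_left_mono) (auto simp: n_def)
      then show ?thesis using N2 by simp
    qed
    have d: "NN (\<lambda>x. w n x - w (k + n) x) \<le> e" for k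
    proof -
      let ?v = "w (k + n)"
      have k1: "1 / real (Suc (k + n)) \<le> 1 / real (Suc n)" by (intro divide_left_mono) auto
      have "?v \<in> midpoints V n" by (rule midpoints_antimono[OF w(1)]) simp
      from Ile[OF midpoints.step[OF w(1) this]] have m1: "I n \<le> NN (\<lambda>x. (w n x + ?v x) / 2)" .
      have mid_eq: "gq (\<lambda>x. (w n x + ?v x) / 2) = (\<lambda>z. (gq (w n) z + gq ?v z) / 2)"
        using gag_quot_cmult[of s p "1 / 2" "\<lambda>x. w n x + ?v x"] by (auto simp: gag_quot_add)
      have "NN (\<lambda>x. w n x - ?v x) \<le> e1 * (NN (w n) + NN ?v) + C * ((NN (w n) + NN ?v) / 2 - NN (\<lambda>x. (w n x
          + ?v x) / 2))"
        using C(2)[OF DspD(3)[OF wD[of n]] DspD(3)[OF wD[of "k + n"]]]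
        unfolding NN_def mid_eq gag_quot_diff[abs_def] .
      also have "\<dots> \<le> e1 * (2 * (M + 1)) + C * (2 * e2)"
      proof (intro add_mono mult_left_mono)
        show "NN (w n) + NN ?v \<le> 2 * (M + 1)" using wM[of n] wM[of "k + n"] by simp
        have "\<bar>I n - I (k + n)\<bar> < e2" by (rule N1) (auto simp: n_def)
        moreover have "NN (w n) < I n + e2"
          by (rule less_trans[OF w(2) add_strict_left_mono[OF n]])
        moreover have "NN ?v < I (k + n) + e2"
          by (rule less_trans[OF w(2) add_strict_left_mono[OF le_less_trans[OF k1 n]]])
        moreover have "x < a + e2 \<Longrightarrow> y < b + e2 \<Longrightarrow> \<bar>a - b\<bar> < e2 \<Longrightarrow> a \<le> z \<Longrightarrow> (x + y) / 2 - z \<le> 2 * e2"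
            for x y z a b :: real
          by (simp add: field_simps)
        ultimately show "(NN (w n) + NN ?v) / 2 - NN (\<lambda>x. (w n x + ?v x) / 2) \<le> 2 * e2" using m1 by blast
      qed (use e1 C in auto)
      also have "e1 * (2 * (M + 1)) = e / 2" using M by (simp add: e1_def field_simps)
      also have "C * (2 * e2) \<le> e / 2" using C(1) e by (simp add: e2_def field_simps)
      finally show ?thesis by simp
    qed
    have wb: "w n \<in> borel_measurable borel" by (rule DspD[OF wD])
    \<comment> \<open>Here \<open>n\<close> is fixed and \<open>k\<close> tends to infinity:
      \<open>w (k + n)\<close> disappears almost everywhere and the differences converge to
      \<open>w n\<close>.\<close>
    have "NN (w n) \<le> e"
    proof (rule Dsp_Fatou(2)[of "\<lambda>k x. w n x - w (k + n) x"])
      show "AE x in lborel. (\<lambda>k. w n x - w (k + n) x) \<longlonglongrightarrow> w n x"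
        using wlim
      proof eventually_elim
        case (elim x)
        have "(\<lambda>k. w n x - w (k + n) x) \<longlonglongrightarrow> w n x - 0"
          by (intro tendsto_intros LIMSEQ_ignore_initial_segment elim)
        then show ?case by simp
      qed
    qed (use d e wb in \<open>auto intro!: Dsp_diff wD\<close>)
    then show ?thesis by blast
  qed
  obtain C where C: "C \<ge> 0" "\<And>u. u \<in> D \<Longrightarrow> \<bar>g u\<bar> \<le> C * gagliardo s p u" using dualD(3)[OF g] by blast
  \<comment> \<open>A bound \<open>k\<close> on the seminorm makes \<open>\<bar>g\<bar>\<close> at
    most \<open>C * k\<close>, which is below \<open>\<epsilon>\<close>.\<close>
  define k where "k = \<epsilon> / (2 * (C + 1))"
  define e where "e = k powr p"
  have e0: "0 < k" using \<epsilon> C by (simp add: k_def)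
  then have "0 < e" by (simp add: e_def)
  from small[OF this] obtain n where n: "NN (w n) \<le> e" by blast
  have "\<epsilon> \<le> g (w n)" using mid[OF w(1)] by blast
  also have "\<dots> \<le> C * NN (w n) powr (1 / p)" using C(2)[OF wD[of n]] by (simp add: gagliardo_NN[OF wD])
  also have "\<dots> \<le> C * e powr (1 / p)" using C n p0 by (intro mult_left_mono powr_mono2) auto
  also have "e powr (1 / p) = k" using e0 p0 by (simp add: e_def powr_powr)
  also have "C * k < \<epsilon>" unfolding k_def using C(1) \<epsilon>(1) by (simp add: field_simps add_nonneg_pos)
  finally show False by simp
qed

text \<open>If convergence failed, the differences \<open>U n - u\<close>, along suitable indices
  and with suitable signs, would tend to zero almost everywhere while \<open>f\<close> stays above a
  positive constant on them, which the preceding lemma excludes.\<close>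

lemma dual_tendsto:
  assumes f: "f \<in> dual" and U: "\<And>n. U n \<in> D" "\<And>n. NN (U n) \<le> M" and M: "0 < M"
    and u: "u \<in> D" and lim: "AE x in lborel. (\<lambda>n. U n x) \<longlonglongrightarrow> u x"
  shows "(\<lambda>n. f (U n)) \<longlonglongrightarrow> f u"
proof (rule ccontr)
  assume "\<not> (\<lambda>n. f (U n)) \<longlonglongrightarrow> f u"
  then obtain \<epsilon> where \<epsilon>: "0 < \<epsilon>" "\<And>N. \<exists>n\<ge>N. \<epsilon> \<le> \<bar>f (U n) - f u\<bar>"
    unfolding LIMSEQ_iff by (force simp: not_less)
  \<comment> \<open>Not a subsequence in the strict sense; \<open>N \<le> \<sigma> N\<close> already
    transports the limits.\<close>
  define \<sigma> where "\<sigma> N = (SOME n. N \<le> n \<and> \<epsilon> \<le> \<bar>f (U n) - f u\<bar>)" for N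
  have \<sigma>: "N \<le> \<sigma> N" "\<epsilon> \<le> \<bar>f (U (\<sigma> N)) - f u\<bar>" for N
    using someI_ex[of "\<lambda>n. N \<le> n \<and> \<epsilon> \<le> \<bar>f (U n) - f u\<bar>"] \<epsilon>(2)[of N] unfolding \<sigma>_def by blast+
  \<comment> \<open>The sign turns a gap in absolute value into a lower bound, the form that
    averaging preserves.\<close>
  define c where "c N = sgn (f (U (\<sigma> N)) - f u)" for N
  have c: "\<bar>c N\<bar> \<le> 1" for N by (simp add: c_def sgn_if)
  define V where "V N = (\<lambda>x. c N * (U (\<sigma> N) x - u x))" for N
  have dif: "(\<lambda>x. U (\<sigma> N) x - u x) \<in> D" for N by (intro Dsp_diff U u)
  show False
  proof (rule dual_bounded_below_contradiction[OF f, of V "2 powr p * (M + NN u)"])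
    fix N
    show "V N \<in> D" unfolding V_def by (intro Dsp_cmult dif)
    have "NN (V N) = \<bar>c N\<bar> powr p * NN (\<lambda>x. U (\<sigma> N) x - u x)" unfolding V_def by (rule NN_cmult)
    also have "\<dots> \<le> 1 * NN (\<lambda>x. U (\<sigma> N) x - u x)" using c[of N] p0 by (intro mult_right_mono powr_le1) auto
    also have "\<dots> \<le> 2 powr p * (NN (U (\<sigma> N)) + NN u)" using NN_diff_le[OF U(1) u] by simp
    also have "\<dots> \<le> 2 powr p * (M + NN u)" using U by (intro mult_left_mono add_mono) auto
    finally show "NN (V N) \<le> 2 powr p * (M + NN u)" .
    have "f (V N) = c N * (f (U (\<sigma> N)) - f u)" unfolding V_def using dualD(2)[OF f dif] dual_diff[OF f U(1) u]
        by simp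
    also have "\<dots> = \<bar>f (U (\<sigma> N)) - f u\<bar>" by (simp add: c_def sgn_if)
    finally show "\<epsilon> \<le> f (V N)" using \<sigma>(2)[of N] by simp
  next
    have \<sigma>inf: "filterlim \<sigma> sequentially sequentially"
      by (rule filterlim_at_top_mono[OF filterlim_ident]) (use \<sigma> in auto)
    show "AE x in lborel. (\<lambda>n. V n x) \<longlonglongrightarrow> 0" using lim
    proof eventually_elim
      case (elim x)
      have "(\<lambda>N. U (\<sigma> N) x) \<longlonglongrightarrow> u x" by (rule filterlim_compose[OF elim \<sigma>inf])
      then have 1: "(\<lambda>N. \<bar>U (\<sigma> N) x - u x\<bar>) \<longlonglongrightarrow> 0" by (simp add: LIM_zero_iff tendsto_rabs_zero_iff)
      have 2: "norm (V N x) \<le> \<bar>U (\<sigma> N) x - u x\<bar>" for N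
        using mult_right_mono[OF c[of N], of "\<bar>U (\<sigma> N) x - u x\<bar>"] by (simp add: V_def abs_mult)
      show ?case by (rule Lim_null_comparison[OF always_eventually 1]) (use 2 in auto)
    qed
    show "0 < 2 powr p * (M + NN u)" using M by (simp add: add_pos_nonneg)
  qed (rule \<epsilon>)
qed

end

section \<open>Palais-Smale sequences\<close>

text \<open>Hoelder puts the whole dependence on the test function into its norm, so
  \<open>e n\<close> is common to all \<open>\<phi>\<close>: the derivative splits in the dual
  norm.\<close>

lemma brezis_lieb_pairing:
  assumes r: "1 < r" and f: "\<And>n. f n \<in> Lfun r M" "\<And>n. Lint r M (f n) \<le> K" and g: "g \<in> Lfun r M"
    and lim: "AE x in M. (\<lambda>n. f n x) \<longlonglongrightarrow> g x"
  shows "\<exists>e. e \<longlonglongrightarrow> 0 \<and> (\<forall>n. 0 \<le> e n) \<and> (\<forall>n. \<forall>\<phi>\<in>Lfun r M.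
     \<bar>(LINT x|M. signed_pow r (f n x) * \<phi> x) - (LINT x|M. signed_pow r (f n x - g x) * \<phi> x)
         - (LINT x|M. signed_pow r (g x) * \<phi> x)\<bar>
       \<le> e n * Lint r M \<phi> powr (1 / r))"
proof -
  let ?h = "\<lambda>n x. signed_pow r (f n x) - signed_pow r (f n x - g x) - signed_pow r (g x)"
  define e where "e n = Lint (r / (r - 1)) M (?h n) powr ((r - 1) / r)" for n
  have r0: "0 < r" using r by simp
  have "(\<lambda>n. e n) \<longlonglongrightarrow> 0 powr ((r - 1) / r)" unfolding e_def
    using r by (intro tendsto_powr' brezis_lieb_signed_pow(2)[OF r f g lim] tendsto_const) auto
  then have e0: "e \<longlonglongrightarrow> 0" by simp
  have "\<bar>(LINT x|M. signed_pow r (f n x) * \<phi> x) - (LINT x|M. signed_pow r (f n x - g x) * \<phi> x)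
      - (LINT x|M. signed_pow r (g x) * \<phi> x)\<bar>
       \<le> e n * Lint r M \<phi> powr (1 / r)" if \<phi>: "\<phi> \<in> Lfun r M" for n \<phi>
  proof -
    have i: "integrable M (\<lambda>x. signed_pow r (f n x) * \<phi> x)" "integrable M (\<lambda>x. signed_pow r (f n x
        - g x) * \<phi> x)" "integrable M (\<lambda>x. signed_pow r (g x) * \<phi> x)"
      by (intro integrable_signed_pow_mult r f g \<phi> Lfun_diff r0)+
    have "(LINT x|M. signed_pow r (f n x) * \<phi> x) - (LINT x|M. signed_pow r (f n x - g x) * \<phi> x)
        - (LINT x|M. signed_pow r (g x) * \<phi> x)
       = (LINT x|M. ?h n x * \<phi> x)"
      unfolding left_diff_distrib using i by simp
    then show ?thesis using Hoelder_inequality(2)[OF r brezis_lieb_signed_pow(1)[OF r f g lim] \<phi>, of n]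
        by (simp add: e_def)
  qed
  then show ?thesis using e0 by (intro exI[of _ e]) (auto simp: e_def)
qed

lemma superlinear_bound:
  fixes \<kappa> p K1 K2 x :: real
  assumes "0 < \<kappa>" "1 < p" "0 \<le> K1" "0 \<le> K2" "0 \<le> x" "\<kappa> * x powr p \<le> K1 + K2 * x"
  shows "x \<le> max 1 (((K1 + K2) / \<kappa>) powr (1 / (p - 1)))"
proof (cases "x \<le> 1")
  case False
  then have "K1 + K2 * x \<le> (K1 + K2) * x" using assms mult_left_mono[of 1 x K1] by (simp add: distrib_right)
  then have "\<kappa> * x powr (p - 1) * x \<le> (K1 + K2) * x"
    using assms False by (simp add: powr_diff)
  then have "\<kappa> * x powr (p - 1) \<le> K1 + K2" using False by simp
  then have "x powr (p - 1) \<le> (K1 + K2) / \<kappa>" using assms by (simp add: field_simps)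
  then have "(x powr (p - 1)) powr (1 / (p - 1)) \<le> ((K1 + K2) / \<kappa>) powr (1 / (p - 1))"
    using assms by (intro powr_mono2) auto
  then show ?thesis using assms False by (simp add: powr_powr)
qed simp

context hardy_space
begin

definition GG :: "('a \<Rightarrow> real) \<Rightarrow> ('a \<Rightarrow> real) \<Rightarrow> real" where
  "GG u \<phi> = (LINT z|lborel. signed_pow p (gq u z) * gq \<phi> z) - \<mu> * (LINT x|lborel. signed_pow p (hq u x) * hq \<phi>
      x)
     - (LINT x|lborel. signed_pow q (cq u x) * cq \<phi> x)"

definition I0 :: "('a \<Rightarrow> real) \<Rightarrow> real" where
  "I0 u = NN u / p - \<mu> / p * HH u - BB u / q"

lemma q_cancel: "\<alpha> / q * q = \<alpha>" using exponents(5) by simp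

lemma weak_solution_iff: "weak_solution s p \<mu> \<alpha> f u \<longleftrightarrow> u \<in> D \<and> (\<forall>\<phi>\<in>D. GG u \<phi> = f \<phi>)"
proof -
  have "frac_form s p u \<phi> = (LINT z|lborel. signed_pow p (gq u z) * gq \<phi> z)" for \<phi>
    unfolding frac_form_def lborel_prod signed_pow_gag_quot[OF p0] ..
  moreover have "(LINT x|lborel. \<bar>u x\<bar> powr (p - 2) * u x / norm x powr (s * p) * \<phi> x)
      = (LINT x|lborel. signed_pow p (hq u x) * hq \<phi> x)" for \<phi>
    unfolding signed_pow_wquot[OF p0] ..
  moreover have "(LINT x|lborel. \<bar>u x\<bar> powr (crit_exp (real DIM('a)) s p \<alpha> - 2) * u x / norm x powr \<alpha> * \<phi> x)
      = (LINT x|lborel. signed_pow q (cq u x) * cq \<phi> x)" for \<phi>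
    unfolding signed_pow_wquot[OF exponents(5)] q_cancel d_def[symmetric] q_def[symmetric] ..
  ultimately show ?thesis unfolding weak_solution_def GG_def by (simp add: algebra_simps)
qed

lemma energy_eq: "u \<in> D \<Longrightarrow> energy s p \<mu> \<alpha> f u = I0 u - f u"
proof -
  assume u: "u \<in> D"
  have "(LINT x|lborel. \<bar>u x\<bar> powr p / norm x powr (s * p)) = HH u"
    unfolding HH_def Lint_def wquot_powr[OF p0] ..
  moreover have "(LINT x|lborel. \<bar>u x\<bar> powr q / norm x powr \<alpha>) = BB u"
    unfolding BB_def Lint_def wquot_powr[OF exponents(5)] q_cancel ..
  ultimately show ?thesis unfolding energy_def d_def[symmetric] q_def[symmetric] I0_def
    using gagliardo_powr[OF u] by simp
qed

lemma GG_self: "GG u u = NN u - \<mu> * HH u - BB u"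
  by (simp add: GG_def NN_def HH_def BB_def Lint_def signed_pow_mult_self)

text \<open>Hardy absorbs the negative term; the strict gap between \<open>\<mu>\<close> and
  \<open>m\<close> leaves a positive fraction of the seminorm.\<close>

lemma coercive: assumes "u \<in> D" shows "(1 - \<mu> / m) * NN u \<le> NN u - \<mu> * HH u"
proof -
  have "\<mu> * HH u \<le> \<mu> * (NN u / m)" using Dsp_hardy(2)[OF assms] \<mu> by (intro mult_left_mono) auto
  then show ?thesis by (simp add: algebra_simps)
qed

lemma coercive_const: "0 < 1 - \<mu> / m" using \<mu> by simp

lemma pq_const: "0 < 1 / p - 1 / q" using exponents(1) p0 by (simp add: frac_less2)

text \<open>Subtracting the self-pairing with weight \<open>1 / q\<close> cancels the critical term,
  and \<open>p < q\<close> leaves a positive multiple of the coercive part.\<close>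

lemma I0_GG: "I0 u - GG u u / q = (1 / p - 1 / q) * (NN u - \<mu> * HH u)"
  unfolding I0_def GG_self by (simp add: algebra_simps diff_divide_distrib add_divide_distrib)

lemma zero_dual: "(\<lambda>_. 0) \<in> dual"
  by (auto simp: Dsp_dual_def intro!: exI[of _ 0])

lemma GG_rescale:
  assumes r: "0 < r" and u: "u \<in> D" and \<phi>: "\<phi> \<in> D"
  shows "GG (rescale s p r u) (rescale s p r \<phi>) = GG u \<phi>"
proof -
  have [measurable]: "u \<in> borel_measurable borel" "\<phi> \<in> borel_measurable borel" using u \<phi> by (auto dest: DspD)
  have e1: "(real DIM('a) - s * p) / p + s = real DIM('a) / p" using p0 by (simp add: field_simps)
  have "(d - s * p) / p = (d - \<alpha>) / q"
    unfolding exponents(8) using dsp p0 d0 \<alpha> sp by (simp_all add: field_simps)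
  then have e2: "(real DIM('a) - s * p) / p + \<alpha> / q = real DIM('a) / q"
    by (simp add: d_def[symmetric] add_divide_distrib[symmetric])
  have 1: "(LINT z|lborel. signed_pow p (gq (rescale s p r u) z) * gq (rescale s p r \<phi>) z)
      = (LINT z|lborel. signed_pow p (gq u z) * gq \<phi> z)"
    unfolding gag_quot_rescale[OF r p0] by (rule integral_signed_pow_scale[OF r p0]) measurable
  have 2: "(LINT z|lborel. signed_pow p (hq (rescale s p r u) z) * hq (rescale s p r \<phi>) z)
      = (LINT z|lborel. signed_pow p (hq u z) * hq \<phi> z)"
    unfolding wquot_rescale[OF r e1] by (rule integral_signed_pow_scale[OF r p0]) measurable
  have 3: "(LINT z|lborel. signed_pow q (cq (rescale s p r u) z) * cq (rescale s p r \<phi>) z)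
      = (LINT z|lborel. signed_pow q (cq u z) * cq \<phi> z)"
    unfolding wquot_rescale[OF r e2] by (rule integral_signed_pow_scale[OF r exponents(5)]) measurable
  show ?thesis unfolding GG_def 1 2 3 ..
qed

text \<open>A Palais-Smale sequence in terms of the explicit derivative. Any null sequence bounding
  the error uniformly over test functions is allowed in place of the dual norm, so errors can simply
  be added and reindexed.\<close>

definition ps_seq :: "(('a \<Rightarrow> real) \<Rightarrow> real) \<Rightarrow> real \<Rightarrow> (nat \<Rightarrow> 'a \<Rightarrow> real) \<Rightarrow> bool" where
  "ps_seq f c V \<longleftrightarrow> (\<forall>n. V n \<in> D) \<and> (\<lambda>n. I0 (V n) - f (V n)) \<longlonglongrightarrow> c \<and>
     (\<exists>e. e \<longlonglongrightarrow> 0 \<and> (\<forall>n. \<forall>\<phi>\<in>D. \<bar>GG (V n) \<phi> - f \<phi>\<bar> \<le> e n * gagliardo s p \<phi>))"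

lemma dual_norm_bound:
  assumes L: "L \<in> dual" and \<phi>: "\<phi> \<in> D"
  shows "\<bar>L \<phi>\<bar> \<le> dual_norm s p L * gagliardo s p \<phi>"
proof -
  obtain C where C: "C \<ge> 0" "\<And>u. u \<in> D \<Longrightarrow> \<bar>L u\<bar> \<le> C * gagliardo s p u" using dualD(3)[OF L] by blast
  \<comment> \<open>A supremum of reals says nothing about an unbounded set; continuity of
    \<open>L\<close> makes it meaningful.\<close>
  have bdd: "bdd_above ((\<lambda>u. \<bar>L u\<bar>) ` {u \<in> D. gagliardo s p u \<le> 1})"
  proof (rule bdd_aboveI2)
    fix u assume "u \<in> {u \<in> D. gagliardo s p u \<le> 1}"
    then show "\<bar>L u\<bar> \<le> C" using C(2)[of u] mult_left_mono[OF _ C(1), of "gagliardo s p u" 1] by auto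
  qed
  show ?thesis
  proof (cases "gagliardo s p \<phi> = 0")
    case True
    then show ?thesis using C(2)[OF \<phi>] by simp
  next
    case False
    then have g: "0 < gagliardo s p \<phi>" by (simp add: gagliardo_def less_le)
    let ?c = "1 / gagliardo s p \<phi>"
    have "gagliardo s p (\<lambda>x. ?c * \<phi> x) = 1" using g gagliardo_cmult[OF \<phi>, of ?c] by simp
    then have "\<bar>L (\<lambda>x. ?c * \<phi> x)\<bar> \<le> dual_norm s p L"
      unfolding dual_norm_def using Dsp_cmult[OF \<phi>, of ?c] by (intro cSUP_upper bdd) auto
    also have "L (\<lambda>x. ?c * \<phi> x) = ?c * L \<phi>" by (rule dualD(2)[OF L \<phi>])
    finally show ?thesis using g by (simp add: abs_mult field_simps)
  qed
qed

lemma energy_gateaux: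
  assumes f: "f \<in> dual" and u: "u \<in> D" and \<phi>: "\<phi> \<in> D"
    and t: "t \<longlonglongrightarrow> (0::real)" "\<And>n. t n \<noteq> 0" "\<And>n. \<bar>t n\<bar> \<le> 1"
  shows "(\<lambda>n. (energy s p \<mu> \<alpha> f (\<lambda>x. u x + t n * \<phi> x) - energy s p \<mu> \<alpha> f u) / t n) \<longlonglongrightarrow> GG u \<phi> - f \<phi>"
proof -
  have tphi: "(\<lambda>x. t n * \<phi> x) \<in> D" for n by (rule Dsp_cmult[OF \<phi>])
  have utphi: "(\<lambda>x. u x + t n * \<phi> x) \<in> D" for n by (rule Dsp_add[OF u tphi])
  have g: "gq (\<lambda>x. u x + t n * \<phi> x) = (\<lambda>z. gq u z + t n * gq \<phi> z)" for n
    by (rule ext) (simp add: gag_quot_add gag_quot_cmult)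
  have w: "wquot a (\<lambda>x. u x + t n * \<phi> x) = (\<lambda>z. wquot a u z + t n * wquot a \<phi> z)" for n a
    by (rule ext) (simp add: wquot_add wquot_cmult)
  define X Y Z where "X n = (NN (\<lambda>x. u x + t n * \<phi> x) - NN u) / t n"
    and "Y n = (HH (\<lambda>x. u x + t n * \<phi> x) - HH u) / t n" and "Z n = (BB (\<lambda>x. u x + t n * \<phi> x) - BB u) / t n"
        for n
  have X: "X \<longlonglongrightarrow> p * (LINT z|lborel. signed_pow p (gq u z) * gq \<phi> z)"
    unfolding X_def NN_def g by (rule Lint_gateaux_derivative[OF p _ _ t]) (intro DspD u \<phi>)+
  have Y: "Y \<longlonglongrightarrow> p * (LINT z|lborel. signed_pow p (hq u z) * hq \<phi> z)"
    unfolding Y_def HH_def w by (rule Lint_gateaux_derivative[OF p _ _ t]) (intro Dsp_hardy u \<phi>)+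
  have Z: "Z \<longlonglongrightarrow> q * (LINT z|lborel. signed_pow q (cq u z) * cq \<phi> z)"
    unfolding Z_def BB_def w by (rule Lint_gateaux_derivative[OF exponents(3) _ _ t]) (intro Dsp_crit u \<phi>)+
  have eq: "(energy s p \<mu> \<alpha> f (\<lambda>x. u x + t n * \<phi> x) - energy s p \<mu> \<alpha> f u) / t n
      = X n / p - \<mu> / p * Y n - Z n / q - f \<phi>" for n
    unfolding energy_eq[OF u] energy_eq[OF utphi] dualD(1)[OF f u tphi] dualD(2)[OF f \<phi>] I0_def X_def Y_def
        Z_def
    using t(2)[of n] p0 exponents(5) by (simp add: field_simps)
  have "(\<lambda>n. X n / p - \<mu> / p * Y n - Z n / q - f \<phi>) \<longlonglongrightarrow>
     (p * (LINT z|lborel. signed_pow p (gq u z) * gq \<phi> z)) / p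
         - \<mu> / p * (p * (LINT z|lborel. signed_pow p (hq u z) * hq \<phi> z))
        - (q * (LINT z|lborel. signed_pow q (cq u z) * cq \<phi> z)) / q - f \<phi>"
    using p0 exponents(5) by (intro tendsto_intros X Y Z) auto
  then show ?thesis unfolding eq GG_def using p0 exponents(5) by simp
qed

text \<open>The Frechet error along \<open>t * \<phi>\<close> is of smaller order than
  \<open>t\<close>, so the given derivative in direction \<open>\<phi>\<close> is the limit of the
  difference quotients, which \<open>energy_gateaux\<close> computes.\<close>

lemma frechet_derivative_eq:
  assumes f: "f \<in> dual" and u: "u \<in> D" and \<phi>: "\<phi> \<in> D"
    and L: "Dsp_has_derivative s p (energy s p \<mu> \<alpha> f) L u"
  shows "L \<phi> = GG u \<phi> - f \<phi>"
proof -
  have Ld: "L \<in> dual" using L by (simp add: Dsp_has_derivative_def)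
  define t where "t n = 1 / real (Suc n)" for n
  have t: "t \<longlonglongrightarrow> 0" "\<And>n. t n \<noteq> 0" "\<And>n. \<bar>t n\<bar> \<le> 1"
    unfolding t_def using LIMSEQ_Suc[OF lim_1_over_n] by auto
  define Q where "Q n = (energy s p \<mu> \<alpha> f (\<lambda>x. u x + t n * \<phi> x) - energy s p \<mu> \<alpha> f u) / t n" for n
  have Q: "Q \<longlonglongrightarrow> GG u \<phi> - f \<phi>" unfolding Q_def by (rule energy_gateaux[OF f u \<phi> t])
  define G where "G = gagliardo s p \<phi>"
  have G: "0 \<le> G" by (simp add: G_def gagliardo_def)
  have "Q \<longlonglongrightarrow> L \<phi>"
  proof (rule LIMSEQ_I)
    fix r :: real assume r: "0 < r"
    define \<epsilon> where "\<epsilon> = r / (2 * (G + 1))"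
    have \<epsilon>: "0 < \<epsilon>" using r G by (simp add: \<epsilon>_def)
    obtain \<delta> where \<delta>: "0 < \<delta>" "\<And>\<psi>. \<psi> \<in> D \<Longrightarrow> gagliardo s p \<psi> < \<delta> \<Longrightarrow>
        \<bar>energy s p \<mu> \<alpha> f (\<lambda>x. u x + \<psi> x) - energy s p \<mu> \<alpha> f u - L \<psi>\<bar> \<le> \<epsilon> * gagliardo s p \<psi>"
      using L \<epsilon> unfolding Dsp_has_derivative_def by blast
    have "(\<lambda>n. \<bar>t n\<bar> * G) \<longlonglongrightarrow> \<bar>0\<bar> * G" by (intro tendsto_intros t)
    then have "eventually (\<lambda>n. \<bar>t n\<bar> * G < \<delta>) sequentially" using \<delta> by (intro order_tendstoD) auto
    then obtain N where N: "\<And>n. n \<ge> N \<Longrightarrow> \<bar>t n\<bar> * G < \<delta>" by (auto simp: eventually_sequentially)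
    have "norm (Q n - L \<phi>) < r" if "n \<ge> N" for n
    proof -
      have g: "gagliardo s p (\<lambda>x. t n * \<phi> x) = \<bar>t n\<bar> * G" unfolding G_def by (rule gagliardo_cmult[OF \<phi>])
      have "\<bar>energy s p \<mu> \<alpha> f (\<lambda>x. u x + t n * \<phi> x) - energy s p \<mu> \<alpha> f u - L (\<lambda>x. t n * \<phi> x)\<bar> \<le> \<epsilon> * (\<bar>t n\<bar> * G)"
        unfolding g[symmetric] by (rule \<delta>(2)[OF Dsp_cmult[OF \<phi>]]) (use N[OF that] g in simp)
      also have "energy s p \<mu> \<alpha> f (\<lambda>x. u x + t n * \<phi> x) - energy s p \<mu> \<alpha> f u - L (\<lambda>x. t n * \<phi> x)
          = t n * (Q n - L \<phi>)"
        unfolding dualD(2)[OF Ld \<phi>] Q_def right_diff_distrib using t(2)[of n] by simp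
      finally have "\<bar>t n\<bar> * \<bar>Q n - L \<phi>\<bar> \<le> \<bar>t n\<bar> * (\<epsilon> * G)" by (simp add: abs_mult mult_ac)
      then have "\<bar>Q n - L \<phi>\<bar> \<le> \<epsilon> * G" using t(2)[of n] by simp
      also have "\<epsilon> * G < r" using r G by (simp add: \<epsilon>_def field_simps add_nonneg_pos add_pos_nonneg)
      finally show ?thesis by simp
    qed
    then show "\<exists>N. \<forall>n\<ge>N. norm (Q n - L \<phi>) < r" by blast
  qed
  from LIMSEQ_unique[OF this Q] show ?thesis .
qed

lemma palais_smale_imp_ps_seq:
  assumes f: "f \<in> dual" and P: "palais_smale s p (energy s p \<mu> \<alpha> f) \<eta> U"
  shows "ps_seq f \<eta> U"
proof -
  have U: "\<And>n. U n \<in> D" using P by (simp add: palais_smale_def)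
  obtain L where L: "\<And>n. Dsp_has_derivative s p (energy s p \<mu> \<alpha> f) (L n) (U n)" "(\<lambda>n. dual_norm s p (L n)) \<longlonglongrightarrow> 0"
    using P unfolding palais_smale_def by blast
  have "\<bar>GG (U n) \<phi> - f \<phi>\<bar> \<le> dual_norm s p (L n) * gagliardo s p \<phi>" if "\<phi> \<in> D" for n \<phi>
    using dual_norm_bound[of "L n" \<phi>] L(1)[of n] frechet_derivative_eq[OF f U that L(1)] that
    by (simp add: Dsp_has_derivative_def)
  moreover have "(\<lambda>n. I0 (U n) - f (U n)) \<longlonglongrightarrow> \<eta>" using P U by (simp add: palais_smale_def energy_eq)
  ultimately show ?thesis unfolding ps_seq_def using U L(2) by blast
qed

lemma ps_seq_subseq: "ps_seq f c V \<Longrightarrow> strict_mono \<sigma> \<Longrightarrow> ps_seq f c (\<lambda>n. V (\<sigma> n))"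
  unfolding ps_seq_def
proof (elim conjE exE, intro conjI)
  fix e assume \<sigma>: "strict_mono \<sigma>" and e: "e \<longlonglongrightarrow> 0" "\<forall>n. \<forall>\<phi>\<in>D. \<bar>GG (V n) \<phi> - f \<phi>\<bar> \<le> e n * gagliardo s p \<phi>"
    and l: "(\<lambda>n. I0 (V n) - f (V n)) \<longlonglongrightarrow> c"
  show "(\<lambda>n. I0 (V (\<sigma> n)) - f (V (\<sigma> n))) \<longlonglongrightarrow> c" using LIMSEQ_subseq_LIMSEQ[OF l \<sigma>] by (simp add: o_def)
  show "\<exists>e. e \<longlonglongrightarrow> 0 \<and> (\<forall>n. \<forall>\<phi>\<in>D. \<bar>GG (V (\<sigma> n)) \<phi> - f \<phi>\<bar> \<le> e n * gagliardo s p \<phi>)"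
    using LIMSEQ_subseq_LIMSEQ[OF e(1) \<sigma>] e(2) by (intro exI[of _ "e \<circ> \<sigma>"]) auto
qed auto

text \<open>The combination \<open>I0 - GG / q\<close> bounds a multiple of \<open>x powr p\<close>
  from above by a constant plus a multiple of \<open>x\<close>, with \<open>x\<close> the seminorm;
  as \<open>1 < p\<close>, this bounds \<open>x\<close>.\<close>

lemma ps_seq_bounded:
  assumes f: "f \<in> dual" and V: "ps_seq f c V"
  shows "\<exists>M>0. \<forall>n. NN (V n) \<le> M"
proof -
  have VD: "\<And>n. V n \<in> D" and lim: "(\<lambda>n. I0 (V n) - f (V n)) \<longlonglongrightarrow> c" using V by (auto simp: ps_seq_def)
  obtain e where e: "e \<longlonglongrightarrow> 0" "\<And>n \<phi>. \<phi> \<in> D \<Longrightarrow> \<bar>GG (V n) \<phi> - f \<phi>\<bar> \<le> e n * gagliardo s p \<phi>"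
    using V unfolding ps_seq_def by blast
  obtain K1 where K1: "0 < K1" "\<And>n. \<bar>I0 (V n) - f (V n)\<bar> \<le> K1"
    using convergent_imp_Bseq[OF convergentI[OF lim]] by (auto simp: Bseq_def)
  obtain E where E: "0 < E" "\<And>n. \<bar>e n\<bar> \<le> E"
    using convergent_imp_Bseq[OF convergentI[OF e(1)]] by (auto simp: Bseq_def)
  obtain C where C: "C \<ge> 0" "\<And>u. u \<in> D \<Longrightarrow> \<bar>f u\<bar> \<le> C * gagliardo s p u" using dualD(3)[OF f] by blast
  define \<kappa> where "\<kappa> = (1 / p - 1 / q) * (1 - \<mu> / m)"
  have \<kappa>: "0 < \<kappa>" unfolding \<kappa>_def using pq_const coercive_const by (rule mult_pos_pos)
  define X where "X = max 1 (((K1 + (E + C)) / \<kappa>) powr (1 / (p - 1)))"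
  have "NN (V n) \<le> X powr p" for n
  proof -
    define x where "x = gagliardo s p (V n)"
    have x: "0 \<le> x" by (simp add: x_def gagliardo_def)
    have xN: "x powr p = NN (V n)" unfolding x_def by (rule gagliardo_powr[OF VD])
    have "e n * x \<le> E * x" using E(2)[of n] x by (intro mult_right_mono) auto
    then have a: "\<bar>GG (V n) (V n) - f (V n)\<bar> \<le> E * x"
      using e(2)[OF VD[of n], of n] by (simp add: x_def)
    have b: "\<bar>f (V n)\<bar> \<le> C * x" using C(2)[OF VD[of n]] by (simp add: x_def)
    have q1: "1 < q" by (rule exponents)
    have "\<bar>(GG (V n) (V n) - f (V n)) / q\<bar> \<le> E * x / 1"
      unfolding abs_divide using a q1 x E by (intro frac_le) auto
    then have a': "\<bar>(GG (V n) (V n) - f (V n)) / q\<bar> \<le> E * x" by simp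
    have "\<bar>(1 - 1 / q) * f (V n)\<bar> \<le> 1 * (C * x)"
      unfolding abs_mult using b q1 by (intro mult_mono) auto
    then have b': "\<bar>(1 - 1 / q) * f (V n)\<bar> \<le> C * x" by simp
    have "\<kappa> * x powr p \<le> (1 / p - 1 / q) * (NN (V n) - \<mu> * HH (V n))"
      unfolding \<kappa>_def xN mult.assoc using pq_const coercive[OF VD] by (intro mult_left_mono) auto
    also have "\<dots> = (I0 (V n) - f (V n)) - (GG (V n) (V n) - f (V n)) / q + (1 - 1 / q) * f (V n)"
      unfolding I0_GG[symmetric] by (simp add: algebra_simps diff_divide_distrib)
    also have "\<dots> \<le> K1 + E * x + C * x" using K1(2)[of n] a' b' by linarith
    finally have "\<kappa> * x powr p \<le> K1 + (E + C) * x" by (simp add: distrib_right)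
    then have "x \<le> X" unfolding X_def using \<kappa> p K1 E C x by (intro superlinear_bound) auto
    then show ?thesis unfolding xN[symmetric] using x p0 by (intro powr_mono2) auto
  qed
  moreover have "0 < X powr p" by (simp add: X_def)
  ultimately show ?thesis by blast
qed

lemma ps_seq_split:
  assumes f: "f \<in> dual" and V: "ps_seq f c V" and M: "0 < M" "\<And>n. NN (V n) \<le> M"
    and u: "u \<in> D" and lim: "AE x in lborel. (\<lambda>n. V n x) \<longlonglongrightarrow> u x"
  shows "\<And>\<phi>. \<phi> \<in> D \<Longrightarrow> GG u \<phi> = f \<phi>" and "ps_seq (\<lambda>_. 0) (c - (I0 u - f u)) (\<lambda>n x. V n x - u x)"
proof -
  have VD: "\<And>n. V n \<in> D" and Ilim: "(\<lambda>n. I0 (V n) - f (V n)) \<longlonglongrightarrow> c" using V by (auto simp: ps_seq_def)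
  obtain e where e: "e \<longlonglongrightarrow> 0" "\<And>n \<phi>. \<phi> \<in> D \<Longrightarrow> \<bar>GG (V n) \<phi> - f \<phi>\<bar> \<le> e n * gagliardo s p \<phi>"
    using V unfolding ps_seq_def by blast
  obtain C where C: "0 < C" "\<And>u. u \<in> D \<Longrightarrow> BB u \<le> C * NN u powr (q / p)" using hardy_sobolev by blast
  have glim: "AE z in lborel. (\<lambda>n. gq (V n) z) \<longlonglongrightarrow> gq u z"
    using AE_lborel_fst_snd[OF lim]
  proof eventually_elim
    case (elim z)
    then show ?case unfolding gag_quot_def divide_inverse by (intro tendsto_intros) auto
  qed
  have wlim: "AE z in lborel. (\<lambda>n. wquot a (V n) z) \<longlonglongrightarrow> wquot a u z" for a
    using lim
  proof eventually_elim
    case (elim z)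
    then show ?case unfolding wquot_def divide_inverse by (intro tendsto_intros) auto
  qed
  have b1: "Lint p lborel (gq (V n)) \<le> M" for n using M(2)[of n] by (simp add: NN_def)
  have b2: "Lint p lborel (hq (V n)) \<le> M / m" for n
    using Dsp_hardy(2)[OF VD[of n]] M(2)[of n] m0 divide_right_mono[of "NN (V n)" M m] by (simp add: HH_def)
  have b3: "Lint q lborel (cq (V n)) \<le> C * M powr (q / p)" for n
  proof -
    have "C * NN (V n) powr (q / p) \<le> C * M powr (q / p)"
      using M(2)[of n] C(1) p0 exponents(5) by (intro mult_left_mono powr_mono2) auto
    then show ?thesis using C(2)[OF VD[of n]] by (simp add: BB_def)
  qed
  note T1 = p DspD(3)[OF VD] b1 DspD(3)[OF u] glim
  note T2 = p Dsp_hardy(1)[OF VD] b2 Dsp_hardy(1)[OF u] wlim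
  note T3 = exponents(3) Dsp_crit(1)[OF VD] b3 Dsp_crit(1)[OF u] wlim
  show weak: "GG u \<phi> = f \<phi>" if \<phi>: "\<phi> \<in> D" for \<phi>
  proof -
    have "(\<lambda>n. GG (V n) \<phi>) \<longlonglongrightarrow> GG u \<phi>" unfolding GG_def
      by (intro tendsto_diff tendsto_mult tendsto_const
          signed_pow_weak_tendsto[OF T1 DspD(3)[OF \<phi>]] signed_pow_weak_tendsto[OF T2 Dsp_hardy(1)[OF \<phi>]]
          signed_pow_weak_tendsto[OF T3 Dsp_crit(1)[OF \<phi>]])
    moreover have "(\<lambda>n. GG (V n) \<phi> - f \<phi>) \<longlonglongrightarrow> 0"
    proof (rule Lim_null_comparison[OF always_eventually])
      show "\<forall>n. norm (GG (V n) \<phi> - f \<phi>) \<le> e n * gagliardo s p \<phi>" using e(2)[OF \<phi>] by simp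
      show "(\<lambda>n. e n * gagliardo s p \<phi>) \<longlonglongrightarrow> 0" using tendsto_mult_left_zero[OF e(1)] by simp
    qed
    then have "(\<lambda>n. GG (V n) \<phi>) \<longlonglongrightarrow> f \<phi>" by (simp add: LIM_zero_iff)
    ultimately show ?thesis by (rule LIMSEQ_unique)
  qed
  have WD: "(\<lambda>x. V n x - u x) \<in> D" for n by (intro Dsp_diff VD u)
  have "(\<lambda>n. (NN (V n) - NN (\<lambda>x. V n x - u x)) / p - \<mu> / p * (HH (V n) - HH (\<lambda>x. V n x - u x)) - (BB (V n)
      - BB (\<lambda>x. V n x - u x)) / q)
     \<longlonglongrightarrow> NN u / p - \<mu> / p * HH u - BB u / q"
    unfolding NN_def HH_def BB_def gag_quot_diff[abs_def] wquot_diff[abs_def]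
    using p0 exponents(5)
    by (intro tendsto_diff tendsto_mult tendsto_divide tendsto_const brezis_lieb[OF T1] brezis_lieb[OF T2]
        brezis_lieb[OF T3]) auto
  then have "(\<lambda>n. I0 (V n) - I0 (\<lambda>x. V n x - u x)) \<longlonglongrightarrow> I0 u"
    unfolding I0_def by (simp add: diff_divide_distrib algebra_simps)
  \<comment> \<open>The functional leaves the level because \<open>f (V n)\<close> tends to
    \<open>f u\<close>; the remainder is measured by the homogeneous energy.\<close>
  from tendsto_diff[OF tendsto_add[OF Ilim dual_tendsto[OF f VD M(2) M(1) u lim]] this]
  have lev: "(\<lambda>n. I0 (\<lambda>x. V n x - u x)) \<longlonglongrightarrow> c - (I0 u - f u)" by (simp add: algebra_simps)
  obtain e1 where e1: "e1 \<longlonglongrightarrow> 0" "\<And>n. 0 \<le> e1 n" "\<And>n \<phi>. \<phi> \<in> Lfun p lborel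
      \<Longrightarrow> \<bar>(LINT x|lborel. signed_pow p (gq (V n) x) * \<phi> x) - (LINT x|lborel. signed_pow p (gq (V n) x
      - gq u x) * \<phi> x) - (LINT x|lborel. signed_pow p (gq u x) * \<phi> x)\<bar>
       \<le> e1 n * Lint p lborel \<phi> powr (1 / p)" using brezis_lieb_pairing[OF T1] by blast
  obtain e2 where e2: "e2 \<longlonglongrightarrow> 0" "\<And>n. 0 \<le> e2 n" "\<And>n \<phi>. \<phi> \<in> Lfun p lborel
      \<Longrightarrow> \<bar>(LINT x|lborel. signed_pow p (hq (V n) x) * \<phi> x) - (LINT x|lborel. signed_pow p (hq (V n) x
      - hq u x) * \<phi> x) - (LINT x|lborel. signed_pow p (hq u x) * \<phi> x)\<bar>
       \<le> e2 n * Lint p lborel \<phi> powr (1 / p)" using brezis_lieb_pairing[OF T2] by blast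
  obtain e3 where e3: "e3 \<longlonglongrightarrow> 0" "\<And>n. 0 \<le> e3 n" "\<And>n \<phi>. \<phi> \<in> Lfun q lborel
      \<Longrightarrow> \<bar>(LINT x|lborel. signed_pow q (cq (V n) x) * \<phi> x) - (LINT x|lborel. signed_pow q (cq (V n) x
      - cq u x) * \<phi> x) - (LINT x|lborel. signed_pow q (cq u x) * \<phi> x)\<bar>
       \<le> e3 n * Lint q lborel \<phi> powr (1 / q)" using brezis_lieb_pairing[OF T3] by blast
  \<comment> \<open>The four errors in terms of the Gagliardo seminorm: the Hardy and critical norms
    of the test function are converted by the constants \<open>1 / m\<close> and
    \<open>C\<close>.\<close>
  define E where "E n = e n + (e1 n + \<mu> * (e2 n * (1 / m) powr (1 / p)) + e3 n * C powr (1 / q))" for n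
  have "E \<longlonglongrightarrow> 0 + (0 + \<mu> * (0 * (1 / m) powr (1 / p)) + 0 * C powr (1 / q))"
    unfolding E_def by (intro tendsto_intros e(1) e1(1) e2(1) e3(1))
  then have E0: "E \<longlonglongrightarrow> 0" by simp
  have "\<bar>GG (\<lambda>x. V n x - u x) \<phi> - 0\<bar> \<le> E n * gagliardo s p \<phi>" if \<phi>: "\<phi> \<in> D" for n \<phi>
  proof -
    define G where "G = gagliardo s p \<phi>"
    have G: "G = NN \<phi> powr (1 / p)" unfolding G_def by (rule gagliardo_NN[OF \<phi>])
    have h: "HH \<phi> powr (1 / p) \<le> (1 / m) powr (1 / p) * G"
    proof -
      have "HH \<phi> powr (1 / p) \<le> (1 / m * NN \<phi>) powr (1 / p)" using Dsp_hardy(2)[OF \<phi>] p0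
          by (intro powr_mono2) auto
      then show ?thesis by (simp only: powr_mult G)
    qed
    have b: "BB \<phi> powr (1 / q) \<le> C powr (1 / q) * G"
    proof -
      have "BB \<phi> powr (1 / q) \<le> (C * NN \<phi> powr (q / p)) powr (1 / q)" using C(2)[OF \<phi>] exponents(5)
          by (intro powr_mono2) auto
      also have "\<dots> = C powr (1 / q) * (NN \<phi> powr (q / p)) powr (1 / q)" by (simp only: powr_mult)
      also have "(NN \<phi> powr (q / p)) powr (1 / q) = G" using exponents(5) by (simp add: powr_powr G)
      finally show ?thesis .
    qed
    let ?a = "\<lambda>w. LINT x|lborel. signed_pow p (gq w x) * gq \<phi> x"
        and ?b = "\<lambda>w. LINT x|lborel. signed_pow p (hq w x) * hq \<phi> x"
      and ?c = "\<lambda>w. LINT x|lborel. signed_pow q (cq w x) * cq \<phi> x"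
    let ?W = "\<lambda>x. V n x - u x"
    have A: "\<bar>?a (V n) - ?a ?W - ?a u\<bar> \<le> e1 n * G"
      using e1(3)[OF DspD(3)[OF \<phi>], of n] by (simp add: gag_quot_diff G NN_def)
    have B0: "\<bar>?b (V n) - ?b ?W - ?b u\<bar> \<le> e2 n * HH \<phi> powr (1 / p)"
      using e2(3)[OF Dsp_hardy(1)[OF \<phi>], of n] by (simp add: wquot_diff HH_def)
    have B: "\<bar>\<mu> * (?b (V n) - ?b ?W - ?b u)\<bar> \<le> \<mu> * (e2 n * ((1 / m) powr (1 / p) * G))"
      unfolding abs_mult using \<mu> order_trans[OF B0 mult_left_mono[OF h e2(2)[of n]]] by simp
    have K0: "\<bar>?c (V n) - ?c ?W - ?c u\<bar> \<le> e3 n * BB \<phi> powr (1 / q)"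
      using e3(3)[OF Dsp_crit(1)[OF \<phi>], of n] by (simp add: wquot_diff BB_def)
    note K = order_trans[OF K0 mult_left_mono[OF b e3(2)[of n]]]
    \<comment> \<open>Since \<open>u\<close> already solves the equation, \<open>GG u \<phi>\<close>
      replaces \<open>f \<phi>\<close> and the functional drops out.\<close>
    have "GG ?W \<phi> = (GG (V n) \<phi> - f \<phi>) - (?a (V n) - ?a ?W - ?a u) + \<mu> * (?b (V n) - ?b ?W - ?b u) + (?c (V n)
        - ?c ?W - ?c u)"
      unfolding weak[OF \<phi>, symmetric] GG_def by (simp add: algebra_simps)
    then have "\<bar>GG ?W \<phi>\<bar> \<le> e n * G + e1 n * G + \<mu> * (e2 n * ((1 / m) powr (1 / p) * G))
        + e3 n * (C powr (1 / q) * G)"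
      using e(2)[OF \<phi>, of n] A B K unfolding G_def[symmetric] by linarith
    also have "\<dots> = E n * G" by (simp add: E_def algebra_simps)
    finally show ?thesis by (simp add: G_def)
  qed
  then show "ps_seq (\<lambda>_. 0) (c - (I0 u - f u)) (\<lambda>n x. V n x - u x)"
    unfolding ps_seq_def using WD lev E0 by auto
qed

lemma gagliardo_rescale: "0 < r \<Longrightarrow> u \<in> D \<Longrightarrow> gagliardo s p (rescale s p r u) = gagliardo s p u"
  by (simp add: gagliardo_NN rescale_invariants)

lemma I0_rescale: "0 < r \<Longrightarrow> u \<in> D \<Longrightarrow> I0 (rescale s p r u) = I0 u"
  by (simp add: I0_def rescale_invariants)

text \<open>Dilations preserve seminorm and energy, and a dilation of the sequence can be moved to
  the test function by its inverse; the scale may therefore change with \<open>n\<close>.\<close>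

lemma ps_seq_rescale:
  assumes V: "ps_seq (\<lambda>_. 0) c V" and r: "\<And>n. 0 < r n"
  shows "ps_seq (\<lambda>_. 0) c (\<lambda>n. rescale s p (r n) (V n))"
proof -
  have VD: "\<And>n. V n \<in> D" and lim: "(\<lambda>n. I0 (V n)) \<longlonglongrightarrow> c" using V by (auto simp: ps_seq_def)
  obtain e where e: "e \<longlonglongrightarrow> 0" "\<And>n \<phi>. \<phi> \<in> D \<Longrightarrow> \<bar>GG (V n) \<phi>\<bar> \<le> e n * gagliardo s p \<phi>"
    using V unfolding ps_seq_def by auto
  have "\<bar>GG (rescale s p (r n) (V n)) \<phi>\<bar> \<le> e n * gagliardo s p \<phi>" if \<phi>: "\<phi> \<in> D" for n \<phi>
  proof -
    define \<psi> where "\<psi> = rescale s p (1 / r n) \<phi>"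
    have \<psi>: "\<psi> \<in> D" "gagliardo s p \<psi> = gagliardo s p \<phi>"
      using r[of n] \<phi> by (auto simp: \<psi>_def rescale_invariants gagliardo_rescale)
    have "rescale s p (r n) \<psi> = \<phi>" using r[of n] by (simp add: \<psi>_def rescale_rescale rescale_1)
    then have "GG (rescale s p (r n) (V n)) \<phi> = GG (V n) \<psi>" using GG_rescale[OF r VD \<psi>(1), of n n] by simp
    then show ?thesis using e(2)[OF \<psi>(1), of n] \<psi>(2) by simp
  qed
  moreover have "(\<lambda>n. I0 (rescale s p (r n) (V n))) \<longlonglongrightarrow> c" using lim r VD by (simp add: I0_rescale)
  ultimately show ?thesis unfolding ps_seq_def using e(1) VD r by (auto simp: rescale_invariants)
qed

end

section \<open>Bubbles and their scales\<close>

text \<open>The scale may oscillate between \<open>0\<close> and infinity; infinitely many terms lie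
  on one side of \<open>1\<close>, and along those the limit is determined.\<close>

lemma abs_ln_at_top_subseq:
  fixes \<rho> :: "nat \<Rightarrow> real"
  assumes pos: "\<And>n. 0 < \<rho> n" and lim: "filterlim (\<lambda>n. \<bar>ln (\<rho> n)\<bar>) at_top sequentially"
  shows "\<exists>\<theta>. strict_mono \<theta> \<and> ((\<lambda>n. \<rho> (\<theta> n)) \<longlonglongrightarrow> 0 \<or> filterlim (\<lambda>n. \<rho> (\<theta> n)) at_top sequentially)"
proof -
  have sub: "filterlim (\<lambda>n. \<bar>ln (\<rho> (\<theta> n))\<bar>) at_top sequentially" if "strict_mono \<theta>" for \<theta>
    using filterlim_compose[OF lim filterlim_subseq[OF that]] .
  have "infinite {n. 1 \<le> \<rho> n} \<or> infinite {n. \<rho> n < 1}"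
  proof (rule ccontr)
    assume "\<not> ?thesis"
    then have "finite ({n. 1 \<le> \<rho> n} \<union> {n. \<rho> n < 1})" by blast
    moreover have "{n. 1 \<le> \<rho> n} \<union> {n. \<rho> n < 1} = UNIV" by auto
    ultimately show False by simp
  qed
  then show ?thesis
  proof
    assume "infinite {n. 1 \<le> \<rho> n}"
    from infinite_enumerate[OF this] obtain \<theta> where \<theta>: "strict_mono (\<theta> :: nat \<Rightarrow> nat)" "\<And>n. 1 \<le> \<rho> (\<theta> n)"
        unfolding mem_Collect_eq by blast
    have "filterlim (\<lambda>n. exp \<bar>ln (\<rho> (\<theta> n))\<bar>) at_top sequentially"
      by (rule filterlim_compose[OF exp_at_top sub[OF \<theta>(1)]])
    moreover have "exp \<bar>ln (\<rho> (\<theta> n))\<bar> = \<rho> (\<theta> n)" for n using \<theta>(2)[of n] pos[of "\<theta> n"] by simp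
    ultimately show ?thesis using \<theta>(1) by auto
  next
    assume "infinite {n. \<rho> n < 1}"
    from infinite_enumerate[OF this] obtain \<theta> where \<theta>: "strict_mono (\<theta> :: nat \<Rightarrow> nat)" "\<And>n. \<rho> (\<theta> n) < 1"
        unfolding mem_Collect_eq by blast
    have "filterlim (\<lambda>n. - \<bar>ln (\<rho> (\<theta> n))\<bar>) at_bot sequentially"
      using sub[OF \<theta>(1)] by (simp add: filterlim_uminus_at_top)
    then have "(\<lambda>n. exp (- \<bar>ln (\<rho> (\<theta> n))\<bar>)) \<longlonglongrightarrow> 0" by (rule filterlim_compose[OF exp_at_bot])
    moreover have "exp (- \<bar>ln (\<rho> (\<theta> n))\<bar>) = \<rho> (\<theta> n)" for n using \<theta>(2)[of n] pos[of "\<theta> n"] by simp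
    ultimately show ?thesis using \<theta>(1) by auto
  qed
qed

lemma not_tendsto_0_subseq:
  fixes a :: "nat \<Rightarrow> real"
  assumes "\<not> a \<longlonglongrightarrow> 0" "\<And>n. 0 \<le> a n"
  shows "\<exists>\<epsilon>>0. \<exists>\<sigma>. strict_mono (\<sigma> :: nat \<Rightarrow> nat) \<and> (\<forall>n. \<epsilon> < a (\<sigma> n))"
proof -
  obtain r where r: "0 < r" "\<And>N. \<exists>n\<ge>N. r \<le> a n"
    using assms unfolding LIMSEQ_iff by (force simp: not_less)
  have "infinite {n. r / 2 < a n}" unfolding infinite_nat_iff_unbounded_le
  proof
    fix N
    obtain n where "n \<ge> N" "r \<le> a n" using r(2) by blast
    then show "\<exists>n\<ge>N. n \<in> {n. r / 2 < a n}" using r(1) by (intro exI[of _ n]) auto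
  qed
  from infinite_enumerate[OF this] obtain \<sigma> where "strict_mono (\<sigma> :: nat \<Rightarrow> nat)" "\<And>n. r / 2 < a (\<sigma> n)"
      unfolding mem_Collect_eq by blast
  then show ?thesis using r(1) by (intro exI[of _ "r / 2"]) auto
qed

context hardy_space
begin

text \<open>Testing a solution with itself bounds \<open>NN v\<close> by a multiple of
  \<open>NN v powr (q / p)\<close>. As \<open>p < q\<close>, a nonzero \<open>NN v\<close> cannot be
  small, and the energy of a solution is a multiple of its coercive part.\<close>

lemma bubble_energy_lower_bound:
  "\<exists>c0>0. \<forall>v\<in>D. (\<forall>\<phi>\<in>D. GG v \<phi> = 0) \<and> \<not> (AE x in lborel. v x = 0) \<longrightarrow> c0 \<le> I0 v"
proof -
  obtain C where C: "0 < C" "\<And>u. u \<in> D \<Longrightarrow> BB u \<le> C * NN u powr (q / p)" using hardy_sobolev by blast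
  define k where "k = 1 - \<mu> / m"
  have k: "0 < k" unfolding k_def by (rule coercive_const)
  define a where "a = q / p - 1"
  have a: "0 < a" using exponents(1) p0 by (simp add: a_def)
  \<comment> \<open>The value at which \<open>k\<close> equals \<open>C * n0 powr a\<close>, the
    smallest size that a nontrivial solution can have.\<close>
  define n0 where "n0 = (k / C) powr (1 / a)"
  have n0: "0 < n0" using k C by (simp add: n0_def)
  have "(1 / p - 1 / q) * (k * n0) \<le> I0 v"
    if v: "v \<in> D" "\<And>\<phi>. \<phi> \<in> D \<Longrightarrow> GG v \<phi> = 0" "\<not> (AE x in lborel. v x = 0)" for v
  proof -
    have G: "GG v v = 0" using v by blast
    have N: "0 < NN v"
    proof (rule ccontr)
      assume "\<not> 0 < NN v"
      then have "NN v = 0" using NN_nonneg[of v] by linarith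
      then have "HH v = 0" using Dsp_hardy(2)[OF v(1)] HH_nonneg[of v] by simp
      then show False using AE_zero_of_HH_zero[OF v(1)] v(3) by simp
    qed
    have "k * NN v \<le> BB v" using coercive[OF v(1)] G unfolding GG_self k_def by linarith
    also have "\<dots> \<le> C * NN v powr (q / p)" by (rule C(2)[OF v(1)])
    also have "NN v powr (q / p) = NN v powr a * NN v" using N by (simp add: a_def powr_diff)
    finally have "k * NN v \<le> C * NN v powr a * NN v" by simp
    then have "k \<le> C * NN v powr a" using N by simp
    then have "k / C \<le> NN v powr a" using C by (simp add: field_simps)
    then have "(k / C) powr (1 / a) \<le> (NN v powr a) powr (1 / a)" using k C a by (intro powr_mono2) auto
    then have "n0 \<le> NN v" using a N by (simp add: n0_def powr_powr)
    then have "k * n0 \<le> k * NN v" using k by (intro mult_left_mono) auto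
    also have "\<dots> \<le> NN v - \<mu> * HH v" unfolding k_def by (rule coercive[OF v(1)])
    finally have "(1 / p - 1 / q) * (k * n0) \<le> (1 / p - 1 / q) * (NN v - \<mu> * HH v)"
      using pq_const by (intro mult_left_mono) auto
    then show ?thesis using I0_GG[of v] G by simp
  qed
  moreover have "0 < (1 / p - 1 / q) * (k * n0)" using pq_const k n0 by simp
  ultimately show ?thesis by blast
qed

lemma ps_seq_self_pairing:
  assumes V: "ps_seq (\<lambda>_. 0) c V"
  shows "(\<lambda>n. GG (V n) (V n)) \<longlonglongrightarrow> 0"
proof -
  have VD: "\<And>n. V n \<in> D" using V by (auto simp: ps_seq_def)
  obtain e where e: "e \<longlonglongrightarrow> 0" "\<And>n \<phi>. \<phi> \<in> D \<Longrightarrow> \<bar>GG (V n) \<phi>\<bar> \<le> e n * gagliardo s p \<phi>"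
    using V unfolding ps_seq_def by auto
  obtain M where M: "0 < M" "\<And>n. NN (V n) \<le> M" using ps_seq_bounded[OF zero_dual V] by blast
  have "norm (GG (V n) (V n)) \<le> \<bar>e n\<bar> * M powr (1 / p)" for n
  proof -
    have "e n * gagliardo s p (V n) \<le> \<bar>e n\<bar> * M powr (1 / p)"
      unfolding gagliardo_NN[OF VD] using M(2)[of n] p0 by (intro mult_mono powr_mono2) auto
    then show ?thesis using e(2)[OF VD[of n], of n] by simp
  qed
  moreover have "(\<lambda>n. \<bar>e n\<bar> * M powr (1 / p)) \<longlonglongrightarrow> 0"
    by (intro tendsto_mult_left_zero tendsto_rabs_zero e(1))
  ultimately show ?thesis by - (rule Lim_null_comparison[where g="\<lambda>n. \<bar>e n\<bar> * M powr (1 / p)"], auto)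
qed

text \<open>The self-pairing tends to zero, so the level is the limit of the nonnegative combination
  \<open>I0 - GG / q\<close>. Applied to remainders, this limits the total energy of the
  bubbles.\<close>

lemma ps_seq_level_nonneg: assumes V: "ps_seq (\<lambda>_. 0) c V" shows "0 \<le> c"
proof -
  have VD: "\<And>n. V n \<in> D" and lim: "(\<lambda>n. I0 (V n)) \<longlonglongrightarrow> c" using V by (auto simp: ps_seq_def)
  have "(\<lambda>n. I0 (V n) - GG (V n) (V n) / q) \<longlonglongrightarrow> c - 0 / q"
    using exponents(5) by (intro tendsto_intros lim ps_seq_self_pairing[OF V]) auto
  moreover have "0 \<le> I0 (V n) - GG (V n) (V n) / q" for n
  proof -
    have "0 \<le> (1 - \<mu> / m) * NN (V n)" using coercive_const by (intro mult_nonneg_nonneg) auto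
    then show ?thesis unfolding I0_GG using pq_const coercive[OF VD[of n]] by (intro mult_nonneg_nonneg) auto
  qed
  ultimately show ?thesis using LIMSEQ_le_const[of _ "c - 0 / q" 0] by auto
qed

text \<open>Coercivity bounds the seminorm by the critical term plus the vanishing self-pairing, so
  the critical term is the only obstruction to strong convergence.\<close>

lemma ps_seq_strong:
  assumes V: "ps_seq (\<lambda>_. 0) c V" and B: "(\<lambda>n. BB (V n)) \<longlonglongrightarrow> 0"
  shows "(\<lambda>n. NN (V n)) \<longlonglongrightarrow> 0"
proof (rule Lim_null_comparison[OF always_eventually])
  let ?k = "1 - \<mu> / m"
  have VD: "\<And>n. V n \<in> D" using V by (auto simp: ps_seq_def)
  show "\<forall>n. norm (NN (V n)) \<le> (BB (V n) + GG (V n) (V n)) / ?k"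
  proof
    fix n
    have "?k * NN (V n) \<le> BB (V n) + GG (V n) (V n)" using coercive[OF VD[of n]] unfolding GG_self by simp
    then show "norm (NN (V n)) \<le> (BB (V n) + GG (V n) (V n)) / ?k"
      using coercive_const by (simp add: pos_le_divide_eq mult.commute)
  qed
  have "(\<lambda>n. (BB (V n) + GG (V n) (V n)) / ?k) \<longlonglongrightarrow> (0 + 0) / ?k"
    using coercive_const by (intro tendsto_intros B ps_seq_self_pairing[OF V]) auto
  then show "(\<lambda>n. (BB (V n) + GG (V n) (V n)) / ?k) \<longlonglongrightarrow> 0" by simp
qed

lemma ps_seq_level_zero:
  assumes V: "ps_seq (\<lambda>_. 0) c V" and N: "(\<lambda>n. NN (V n)) \<longlonglongrightarrow> 0"
  shows "c = 0"
proof -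
  have VD: "\<And>n. V n \<in> D" and lim: "(\<lambda>n. I0 (V n)) \<longlonglongrightarrow> c" using V by (auto simp: ps_seq_def)
  have le: "norm (I0 (V n) - GG (V n) (V n) / q) \<le> (1 / p - 1 / q) * NN (V n)" for n
  proof -
    have "0 \<le> (1 - \<mu> / m) * NN (V n)" using coercive_const by (intro mult_nonneg_nonneg) auto
    then have "0 \<le> NN (V n) - \<mu> * HH (V n)" using coercive[OF VD[of n]] by simp
    moreover have "NN (V n) - \<mu> * HH (V n) \<le> NN (V n)" using \<mu> by simp
    ultimately show ?thesis unfolding I0_GG using pq_const by (simp add: abs_mult mult_left_mono)
  qed
  have "(\<lambda>n. (1 / p - 1 / q) * NN (V n)) \<longlonglongrightarrow> 0" by (intro tendsto_mult_right_zero N)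
  with le have "(\<lambda>n. I0 (V n) - GG (V n) (V n) / q) \<longlonglongrightarrow> 0"
    by - (rule Lim_null_comparison[where g="\<lambda>n. (1 / p - 1 / q) * NN (V n)"], auto)
  moreover have "(\<lambda>n. I0 (V n) - GG (V n) (V n) / q) \<longlonglongrightarrow> c - 0 / q"
    using exponents(5) by (intro tendsto_intros lim ps_seq_self_pairing[OF V]) auto
  ultimately show ?thesis using LIMSEQ_unique by fastforce
qed

text \<open>By \<open>loc_rescale\<close> the weighted quantity is the mass on a fixed ball after
  dilating by \<open>1 / \<tau> n\<close>: at this scale the sequence tends locally to zero.\<close>

definition vanish :: "(nat \<Rightarrow> real) \<Rightarrow> (nat \<Rightarrow> 'a \<Rightarrow> real) \<Rightarrow> bool" where
  "vanish \<tau> V \<longleftrightarrow> (\<forall>R>0. (\<lambda>n. \<tau> n powr (- (s * p)) * loc (R * \<tau> n) (V n)) \<longlonglongrightarrow> 0)"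

lemma vanish_subseq: "vanish \<tau> V \<Longrightarrow> strict_mono \<sigma> \<Longrightarrow> vanish (\<lambda>n. \<tau> (\<sigma> n)) (\<lambda>n. V (\<sigma> n))"
  unfolding vanish_def using LIMSEQ_subseq_LIMSEQ[of _ 0 \<sigma>] by (fastforce simp: o_def)

lemma scaled_loc_rescale:
  assumes "0 < \<rho>" "v \<in> D" shows "\<tau> powr (- (s * p)) * loc R (rescale s p \<rho> v)
      = (\<rho> powr (s * p) * \<tau> powr (- (s * p))) * loc (R / \<rho>) v"
  using loc_rescale[OF assms] by simp

lemma AE_zero_of_loc_zero:
  assumes v: "v \<in> D" and z: "\<And>R. 0 < R \<Longrightarrow> loc R v = 0" shows "AE x in lborel. v x = 0"
proof -
  have "AE x in lborel. indicator (cball 0 (real (Suc k))) x * v x = 0" for k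
    using z[of "real (Suc k)"] Lint_eq_0_iff[OF Lfun_loc[OF v, of "real (Suc k)"]] by (simp add: loc_def)
  then have "AE x in lborel. \<forall>k. indicator (cball 0 (real (Suc k))) x * v x = 0" unfolding AE_all_countable
      by blast
  then show ?thesis
  proof eventually_elim
    case (elim x)
    have "x \<in> cball 0 (real (Suc (nat \<lceil>norm x\<rceil>)))" by simp linarith
    then show ?case using elim[rule_format, of "nat \<lceil>norm x\<rceil>"] by simp
  qed
qed

text \<open>Dilating by the scales at which mass is found moves that mass to one fixed ball, where
  local compactness keeps it in the limit. Subtraction takes place at the dilated scale and is then
  undone, which preserves the Palais-Smale property.\<close>

lemma bubble_extraction:
  assumes V: "ps_seq (\<lambda>_. 0) c V" and N: "\<not> (\<lambda>n. NN (V n)) \<longlonglongrightarrow> 0"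
  shows "\<exists>\<sigma> \<rho> v. strict_mono (\<sigma> :: nat \<Rightarrow> nat) \<and> (\<forall>n. 0 < \<rho> n) \<and> v \<in> D \<and> \<not> (AE x in lborel. v x = 0)
      \<and> (\<forall>\<phi>\<in>D. GG v \<phi> = 0)
    \<and> ps_seq (\<lambda>_. 0) (c - I0 v) (\<lambda>n x. V (\<sigma> n) x - rescale s p (\<rho> n) v x)
    \<and> vanish \<rho> (\<lambda>n x. V (\<sigma> n) x - rescale s p (\<rho> n) v x)"
proof -
  have VD: "\<And>n. V n \<in> D" using V by (auto simp: ps_seq_def)
  obtain M where M: "0 < M" "\<And>n. NN (V n) \<le> M" using ps_seq_bounded[OF zero_dual V] by blast
  have "\<not> (\<lambda>n. BB (V n)) \<longlonglongrightarrow> 0" using ps_seq_strong[OF V] N by blast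
  from not_tendsto_0_subseq[OF this] obtain \<epsilon> \<sigma>0 where \<epsilon>: "0 < \<epsilon>"
      and \<sigma>0: "strict_mono (\<sigma>0 :: nat \<Rightarrow> nat)" "\<And>n. \<epsilon> < BB (V (\<sigma>0 n))" by auto
  obtain \<delta> where \<delta>: "0 < \<delta>" "\<And>u. u \<in> D \<Longrightarrow> NN u \<le> M \<Longrightarrow> (\<forall>r>0. loc (2 * r) u \<le> \<delta> * r powr (s * p)) \<Longrightarrow> BB u \<le> \<epsilon>"
    using crit_term_small[OF M(1) \<epsilon>] by blast
  \<comment> \<open>The contrapositive of \<open>crit_term_small\<close>: a critical term above
    \<open>\<epsilon>\<close> leaves a definite amount of mass at some scale.\<close>
  have "\<exists>r>0. \<delta> * r powr (s * p) < loc (2 * r) (V (\<sigma>0 n))" for n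
    using \<delta>(2)[OF VD M(2)] \<sigma>0(2)[of n] by (meson not_le)
  then obtain \<rho>0 where \<rho>0: "\<And>n. 0 < \<rho>0 n" "\<And>n. \<delta> * \<rho>0 n powr (s * p) < loc (2 * \<rho>0 n) (V (\<sigma>0 n))" by metis
  define W where "W n = rescale s p (1 / \<rho>0 n) (V (\<sigma>0 n))" for n
  have i0: "0 < 1 / \<rho>0 n" for n using \<rho>0(1)[of n] by simp
  have W: "W n \<in> D" "NN (W n) \<le> M" for n unfolding W_def using rescale_invariants[OF i0 VD] M(2) by auto
  have W2: "\<delta> < loc 2 (W n)" for n
  proof -
    have "loc 2 (W n) = (1 / \<rho>0 n) powr (s * p) * loc (2 * \<rho>0 n) (V (\<sigma>0 n))"
      unfolding W_def using loc_rescale[OF i0 VD, of 2 n] by simp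
    moreover have "(1 / \<rho>0 n) powr (s * p) = 1 / \<rho>0 n powr (s * p)" by (simp add: powr_divide)
    ultimately have "loc 2 (W n) = loc (2 * \<rho>0 n) (V (\<sigma>0 n)) / \<rho>0 n powr (s * p)" by simp
    then show ?thesis using \<rho>0[of n] by (simp add: pos_less_divide_eq)
  qed
  have Wps: "ps_seq (\<lambda>_. 0) c W" unfolding W_def by (rule ps_seq_rescale[OF ps_seq_subseq[OF V \<sigma>0(1)] i0])
  obtain \<sigma>1 v where \<sigma>1: "strict_mono (\<sigma>1 :: nat \<Rightarrow> nat)" and v: "v \<in> D"
      and ae: "AE x in lborel. (\<lambda>n. W (\<sigma>1 n) x) \<longlonglongrightarrow> v x"
    and lc: "\<And>R. (\<lambda>n. loc R (\<lambda>x. W (\<sigma>1 n) x - v x)) \<longlonglongrightarrow> 0" using rellich[of W, OF W M(1)] by blast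
  note spl = ps_seq_split[OF zero_dual ps_seq_subseq[OF Wps \<sigma>1] M(1) W(2) v ae]
  have XD: "(\<lambda>x. W (\<sigma>1 n) x - v x) \<in> D" for n by (intro Dsp_diff W v)
  \<comment> \<open>Strong convergence on the ball of radius \<open>2\<close> passes the lower bound
    \<open>\<delta>\<close> to the limit; almost everywhere convergence alone would not.\<close>
  have nz: "\<not> (AE x in lborel. v x = 0)"
  proof
    assume "AE x in lborel. v x = 0"
    then have "AE x in lborel. indicator (cball 0 2) x * v x = 0" by eventually_elim simp
    then have lv: "loc 2 v = 0" unfolding loc_def using Lint_eq_0_iff[OF Lfun_loc[OF v]] by simp
    have "\<delta> \<le> 2 powr p * loc 2 (\<lambda>x. W (\<sigma>1 n) x - v x)" for n
      using loc_add_le[OF XD[of n] v, of 2] W2[of "\<sigma>1 n"] lv by simp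
    moreover have "(\<lambda>n. 2 powr p * loc 2 (\<lambda>x. W (\<sigma>1 n) x - v x)) \<longlonglongrightarrow> 0"
      by (intro tendsto_mult_right_zero lc)
    ultimately have "\<delta> \<le> 0" using LIMSEQ_le_const[of _ 0 \<delta>] by blast
    then show False using \<delta>(1) by simp
  qed
  define \<rho> where "\<rho> n = \<rho>0 (\<sigma>1 n)" for n
  have \<rho>: "0 < \<rho> n" for n using \<rho>0(1) by (simp add: \<rho>_def)
  have undo: "rescale s p (\<rho> n) (\<lambda>x. W (\<sigma>1 n) x - v x) = (\<lambda>x. V (\<sigma>0 (\<sigma>1 n)) x - rescale s p (\<rho> n) v x)" for n
    unfolding rescale_diff W_def \<rho>_def[symmetric] using \<rho>[of n] by (simp add: rescale_rescale rescale_1)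
  have "ps_seq (\<lambda>_. 0) (c - (I0 v - 0)) (\<lambda>n. rescale s p (\<rho> n) (\<lambda>x. W (\<sigma>1 n) x - v x))"
    by (rule ps_seq_rescale[OF spl(2) \<rho>])
  then have pss: "ps_seq (\<lambda>_. 0) (c - I0 v) (\<lambda>n x. V (\<sigma>0 (\<sigma>1 n)) x - rescale s p (\<rho> n) v x)" unfolding undo
      by simp
  have "vanish \<rho> (\<lambda>n. rescale s p (\<rho> n) (\<lambda>x. W (\<sigma>1 n) x - v x))" unfolding vanish_def
  proof (intro allI impI)
    fix R :: real
    have "\<rho> n powr (- (s * p)) * loc (R * \<rho> n) (rescale s p (\<rho> n) (\<lambda>x. W (\<sigma>1 n) x - v x))
        = loc R (\<lambda>x. W (\<sigma>1 n) x - v x)" for n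
      unfolding scaled_loc_rescale[OF \<rho> XD] powr_add[symmetric] using \<rho>[of n] by simp
    then show "(\<lambda>n. \<rho> n powr (- (s * p)) * loc (R * \<rho> n) (rescale s p (\<rho> n) (\<lambda>x. W (\<sigma>1 n) x - v x))) \<longlonglongrightarrow> 0"
        using lc by simp
  qed
  then have va: "vanish \<rho> (\<lambda>n x. V (\<sigma>0 (\<sigma>1 n)) x - rescale s p (\<rho> n) v x)" unfolding undo .
  show ?thesis
    using strict_mono_o[OF \<sigma>0(1) \<sigma>1] \<rho> v nz spl(1) pss va
    by (intro exI[of _ "\<sigma>0 \<circ> \<sigma>1"] exI[of _ \<rho>] exI[of _ v]) auto
qed

lemma scales_separate:
  assumes V: "\<And>n. V n \<in> D" and pos: "\<And>n. 0 < \<rho> n" "\<And>n. 0 < \<tau> n" and v: "v \<in> D" "\<not> (AE x in lborel. v x = 0)"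
    and va: "vanish \<tau> V" and vb: "vanish \<rho> (\<lambda>n x. V n x - rescale s p (\<rho> n) v x)"
  shows "filterlim (\<lambda>n. \<bar>ln (\<rho> n / \<tau> n)\<bar>) at_top sequentially"
proof (rule ccontr)
  assume "\<not> ?thesis"
  then obtain K where K: "\<not> eventually (\<lambda>n. K \<le> \<bar>ln (\<rho> n / \<tau> n)\<bar>) sequentially" by (auto simp: filterlim_at_top)
  have "infinite {n. \<bar>ln (\<rho> n / \<tau> n)\<bar> < K}" unfolding infinite_nat_iff_unbounded_le
  proof
    fix N
    show "\<exists>n\<ge>N. n \<in> {n. \<bar>ln (\<rho> n / \<tau> n)\<bar> < K}" using K by (auto simp: eventually_sequentially not_le)
  qed
  from infinite_enumerate[OF this] obtain \<theta> where \<theta>: "strict_mono (\<theta> :: nat \<Rightarrow> nat)" "\<And>n. \<bar>ln (\<rho> (\<theta> n) / \<tau> (\<theta>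
      n))\<bar> < K" unfolding mem_Collect_eq by blast
  \<comment> \<open>A bound \<open>K\<close> on the logarithm of the ratio makes the two scales
    comparable with constant \<open>exp K\<close>.\<close>
  define E where "E = exp K"
  have E: "0 < E" by (simp add: E_def)
  have ratio: "\<rho> (\<theta> n) \<le> E * \<tau> (\<theta> n)" "\<tau> (\<theta> n) \<le> E * \<rho> (\<theta> n)" for n
  proof -
    let ?r = "\<rho> (\<theta> n)" and ?t = "\<tau> (\<theta> n)"
    have r: "0 < ?r" "0 < ?t" using pos by auto
    have l: "ln (?r / ?t) = ln ?r - ln ?t" using r by (simp add: ln_div)
    have "ln ?r \<le> ln (E * ?t)" "ln ?t \<le> ln (E * ?r)" using \<theta>(2)[of n] r unfolding l E_def
        by (auto simp: ln_mult)
    then show "?r \<le> E * ?t" "?t \<le> E * ?r" using r E by auto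
  qed
  have "loc R v = 0" if R: "0 < R" for R
  proof -
    let ?X = "\<lambda>n x. V n x - rescale s p (\<rho> n) v x"
    \<comment> \<open>At the scale \<open>\<tau>\<close> the radius is enlarged by \<open>E\<close>
      so that its ball contains the ball of radius \<open>R\<close> at the scale
      \<open>\<rho>\<close>.\<close>
    define A B where "A n = \<tau> (\<theta> n) powr (- (s * p)) * loc (R * E * \<tau> (\<theta> n)) (V (\<theta> n))"
      and "B n = \<rho> (\<theta> n) powr (- (s * p)) * loc (R * \<rho> (\<theta> n)) (?X (\<theta> n))" for n
    have A: "A \<longlonglongrightarrow> 0" unfolding A_def
      using vanish_subseq[OF va \<theta>(1), unfolded vanish_def, rule_format, OF mult_pos_pos[OF R E]] .
    have B: "B \<longlonglongrightarrow> 0" unfolding B_def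
      using vanish_subseq[OF vb \<theta>(1), unfolded vanish_def, rule_format, OF R] .
    have "loc R v \<le> 2 powr p * (E powr (s * p) * A n + B n)" for n
    proof -
      let ?r = "\<rho> (\<theta> n)" and ?t = "\<tau> (\<theta> n)" and ?V = "V (\<theta> n)"
      have r: "0 < ?r" "0 < ?t" using pos by auto
      have XD: "?X (\<theta> n) \<in> D" by (intro Dsp_diff V rescale_invariants(1) r v)
      \<comment> \<open>Seen at its own scale, the bubble has a mass independent of
        \<open>n\<close>; the two vanishing sequences force it to be zero.\<close>
      have "loc R v = ?r powr (- (s * p)) * loc (R * ?r) (rescale s p ?r v)"
        unfolding scaled_loc_rescale[OF r(1) v(1)] powr_add[symmetric] using r by simp
      also have "rescale s p ?r v = (\<lambda>x. ?V x - ?X (\<theta> n) x)" by simp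
      also have "?r powr (- (s * p)) * loc (R * ?r) (\<lambda>x. ?V x - ?X (\<theta> n) x)
          \<le> ?r powr (- (s * p)) * (2 powr p * (loc (R * ?r) ?V + loc (R * ?r) (?X (\<theta> n))))"
        by (intro mult_left_mono loc_diff_le V XD) auto
      also have "\<dots> = 2 powr p * (?r powr (- (s * p)) * loc (R * ?r) ?V + B n)"
          by (simp add: B_def algebra_simps)
      also have "\<dots> \<le> 2 powr p * (E powr (s * p) * A n + B n)"
      proof (intro mult_left_mono add_right_mono)
        have "?r powr (- (s * p)) * loc (R * ?r) ?V \<le> (?t / E) powr (- (s * p)) * loc (R * E * ?t) ?V"
        proof (rule mult_mono)
          have "?t / E \<le> ?r" using ratio(2)[of n] E by (simp add: field_simps)
          then show "?r powr (- (s * p)) \<le> (?t / E) powr (- (s * p))" using r E sp0 by (intro powr_mono2') auto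
          have "R * ?r \<le> R * (E * ?t)" using ratio(1)[of n] R by (intro mult_left_mono) auto
          then show "loc (R * ?r) ?V \<le> loc (R * E * ?t) ?V" by (intro loc_mono V) (simp add: mult.assoc)
        qed auto
        also have "(?t / E) powr (- (s * p)) = E powr (s * p) * ?t powr (- (s * p))"
          using r E by (simp add: powr_divide powr_minus_divide)
        finally show "?r powr (- (s * p)) * loc (R * ?r) ?V \<le> E powr (s * p) * A n" by (simp add: A_def)
      qed auto
      finally show ?thesis .
    qed
    moreover have "(\<lambda>n. 2 powr p * (E powr (s * p) * A n + B n)) \<longlonglongrightarrow> 2 powr p * (E powr (s * p) * 0 + 0)"
      by (intro tendsto_intros A B)
    ultimately have "loc R v \<le> 2 powr p * (E powr (s * p) * 0 + 0)"
        by - (rule LIMSEQ_le_const, assumption, blast)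
    then show ?thesis using loc_nonneg[of R v] by simp
  qed
  then show False using AE_zero_of_loc_zero[OF v(1)] v(2) by blast
qed

text \<open>With \<open>\<kappa> = \<rho> / \<tau>\<close> the mass is the integral of
  \<open>\<kappa> powr (s * p) * \<bar>v\<bar> powr p\<close> over the ball of radius
  \<open>R / \<kappa>\<close>. There \<open>\<kappa> \<le> R / norm x\<close>, so the Hardy density
  is a majorant. Pointwise, a small \<open>\<kappa>\<close> kills the factor and a large
  \<open>\<kappa>\<close> moves the ball away from \<open>x\<close>, so dominated convergence covers
  both regimes at once.\<close>

lemma vanish_rescale:
  assumes pos: "\<And>n. 0 < \<rho> n" "\<And>n. 0 < \<tau> n" and v: "v \<in> D"
    and sep: "filterlim (\<lambda>n. \<bar>ln (\<rho> n / \<tau> n)\<bar>) at_top sequentially"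
  shows "vanish \<tau> (\<lambda>n. rescale s p (\<rho> n) v)"
  unfolding vanish_def
proof (intro allI impI)
  fix R :: real assume R: "0 < R"
  have [measurable]: "v \<in> borel_measurable borel" using v by (rule DspD)
  define \<kappa> where "\<kappa> n = \<rho> n / \<tau> n" for n
  have \<kappa>: "0 < \<kappa> n" for n using pos by (simp add: \<kappa>_def)
  define F where "F n x = \<kappa> n powr (s * p) * \<bar>indicator (cball 0 (R / \<kappa> n)) x * v x\<bar> powr p" for n x
  have eq: "\<tau> n powr (- (s * p)) * loc (R * \<tau> n) (rescale s p (\<rho> n) v) = (LINT x|lborel. F n x)" for n
  proof -
    have "\<rho> n powr (s * p) * \<tau> n powr (- (s * p)) = \<kappa> n powr (s * p)"
      using pos by (simp add: \<kappa>_def powr_divide powr_minus_divide)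
    moreover have "R * \<tau> n / \<rho> n = R / \<kappa> n" using pos(2)[of n] by (simp add: \<kappa>_def)
    ultimately show ?thesis unfolding scaled_loc_rescale[OF pos(1) v] by (simp add: F_def loc_def Lint_def)
  qed
  have ne: "AE x in lborel. x \<noteq> (0::'a)" by (rule AE_lborel_singleton)
  have "(\<lambda>n. LINT x|lborel. F n x) \<longlonglongrightarrow> (LINT x|(lborel::'a measure). 0)"
  proof (rule integral_dominated_convergence[where w="\<lambda>x. R powr (s * p) * \<bar>hq v x\<bar> powr p"])
    show "integrable lborel (\<lambda>x. R powr (s * p) * \<bar>hq v x\<bar> powr p)"
      using LfunD(2)[OF Dsp_hardy(1)[OF v]] by simp
    show "AE x in lborel. norm (F n x) \<le> R powr (s * p) * \<bar>hq v x\<bar> powr p" for n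
      using ne
    proof eventually_elim
      case (elim x)
      show ?case
      proof (cases "norm x \<le> R / \<kappa> n")
        case True
        then have "\<kappa> n \<le> R / norm x" using \<kappa>[of n] elim by (simp add: field_simps)
        then have "\<kappa> n powr (s * p) \<le> (R / norm x) powr (s * p)" using \<kappa>[of n] sp0 by (intro powr_mono2) auto
        then have "\<kappa> n powr (s * p) * \<bar>v x\<bar> powr p \<le> (R / norm x) powr (s * p) * \<bar>v x\<bar> powr p"
          by (intro mult_right_mono) auto
        also have "(R / norm x) powr (s * p) * \<bar>v x\<bar> powr p = R powr (s * p) * \<bar>hq v x\<bar> powr p"
          using R by (simp add: wquot_powr[OF p0] powr_divide)
        finally show ?thesis using True by (simp add: F_def)
      qed (use p0 in \<open>simp add: F_def\<close>)
    qed
    show "AE x in lborel. (\<lambda>n. F n x) \<longlonglongrightarrow> 0"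
      using ne
    proof eventually_elim
      case (elim x)
      show ?case
      proof (rule LIMSEQ_I)
        fix e :: real assume e: "0 < e"
        define V where "V = \<bar>v x\<bar> powr p"
        have V: "0 \<le> V" by (simp add: V_def)
        define h where "h = e / (V + 1)"
        have h: "0 < h" using e V by (simp add: h_def)
        \<comment> \<open>One threshold for both regimes: \<open>\<kappa> n < b\<close> makes the
          prefactor small through \<open>h\<close>, while \<open>1 / b < \<kappa> n\<close> puts
          \<open>x\<close> outside the ball.\<close>
        define b where "b = min (1 / 2) (min (norm x / (2 * R)) (h powr (1 / (s * p))))"
        have b: "0 < b" "b < 1" using elim R h by (auto simp: b_def)
        have bx: "R / norm x < 1 / b"
        proof -
          have "b \<le> norm x / (2 * R)" by (simp add: b_def)
          also have "\<dots> < norm x / R" using elim R by (simp add: divide_strict_left_mono)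
          finally show ?thesis using b elim R by (simp add: field_simps)
        qed
        have bV: "b powr (s * p) * V < e"
        proof -
          have "b powr (s * p) \<le> (h powr (1 / (s * p))) powr (s * p)"
            using b sp0 by (intro powr_mono2) (auto simp: b_def)
          also have "\<dots> = h" using h sp0 s p0 by (simp add: powr_powr)
          finally have "b powr (s * p) * V \<le> h * V" using V by (intro mult_right_mono)
          also have "\<dots> < e" using e V by (simp add: h_def field_simps add_pos_nonneg)
          finally show ?thesis .
        qed
        have "eventually (\<lambda>n. - ln b < \<bar>ln (\<kappa> n)\<bar>) sequentially"
          using sep unfolding \<kappa>_def by (simp add: filterlim_at_top_dense)
        then obtain N where N: "\<And>n. n \<ge> N \<Longrightarrow> - ln b < \<bar>ln (\<kappa> n)\<bar>" by (auto simp: eventually_sequentially)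
        have "norm (F n x - 0) < e" if n: "n \<ge> N" for n
        proof -
          consider "ln (\<kappa> n) < ln b" | "- ln b < ln (\<kappa> n)" using N[OF n] by linarith
          then show ?thesis
          proof cases
            case 1
            then have "\<kappa> n < b" using \<kappa>[of n] b by simp
            then have k: "\<kappa> n powr (s * p) \<le> b powr (s * p)" using \<kappa>[of n] sp0 by (intro powr_mono2) auto
            have "F n x \<le> \<kappa> n powr (s * p) * V"
              unfolding F_def V_def using p0 by (intro mult_left_mono) (auto simp: indicator_def)
            also have "\<dots> \<le> b powr (s * p) * V" using k V by (intro mult_right_mono)
            also note bV
            finally show ?thesis by (simp add: F_def)
          next
            case 2
            have "ln (1 / b) < ln (\<kappa> n)" using 2 b by (simp add: ln_div)
            then have "1 / b < \<kappa> n" using \<kappa>[of n] b by (subst (asm) ln_less_cancel_iff) auto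
            then have "R / norm x < \<kappa> n" using bx by simp
            then have "R / \<kappa> n < norm x" using elim \<kappa>[of n] R by (simp add: field_simps)
            then show ?thesis using e p0 by (simp add: F_def)
          qed
        qed
        then show "\<exists>N. \<forall>n\<ge>N. norm (F n x - 0) < e" by blast
      qed
    qed
  qed (auto simp: F_def)
  then show "(\<lambda>n. \<tau> n powr (- (s * p)) * loc (R * \<tau> n) (rescale s p (\<rho> n) v)) \<longlonglongrightarrow> 0" unfolding eq by simp
qed

lemma vanish_diff:
  assumes "\<And>n. V n \<in> D" "\<And>n. W n \<in> D" "vanish \<tau> V" "vanish \<tau> W"
  shows "vanish \<tau> (\<lambda>n x. V n x - W n x)"
  unfolding vanish_def
proof (intro allI impI)
  fix R :: real assume R: "0 < R"
  let ?a = "\<lambda>n. \<tau> n powr (- (s * p)) * loc (R * \<tau> n) (V n)" and ?b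
      = "\<lambda>n. \<tau> n powr (- (s * p)) * loc (R * \<tau> n) (W n)"
  have "norm (\<tau> n powr (- (s * p)) * loc (R * \<tau> n) (\<lambda>x. V n x - W n x)) \<le> 2 powr p * (?a n + ?b n)" for n
    using mult_left_mono[OF loc_diff_le[OF assms(1,2), of "R * \<tau> n" n n], of "\<tau> n powr (- (s * p))"]
        by (simp add: algebra_simps)
  moreover have "?a \<longlonglongrightarrow> 0" "?b \<longlonglongrightarrow> 0" using assms R by (auto simp: vanish_def)
  then have "(\<lambda>n. 2 powr p * (?a n + ?b n)) \<longlonglongrightarrow> 2 powr p * (0 + 0)" by (intro tendsto_intros)
  ultimately show "(\<lambda>n. \<tau> n powr (- (s * p)) * loc (R * \<tau> n) (\<lambda>x. V n x - W n x)) \<longlonglongrightarrow> 0"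
    by - (rule Lim_null_comparison[where g="\<lambda>n. 2 powr p * (?a n + ?b n)"], auto)
qed

end

section \<open>Maximal decompositions\<close>

context hardy_space
begin

definition remainder :: "(nat \<Rightarrow> 'a \<Rightarrow> real) \<Rightarrow> nat \<Rightarrow> (nat \<Rightarrow> nat) \<Rightarrow> (nat \<Rightarrow> nat \<Rightarrow> real) \<Rightarrow> (nat \<Rightarrow> 'a \<Rightarrow> real) \<Rightarrow> nat \<Rightarrow>
    'a \<Rightarrow> real" where
  "remainder V k \<sigma> r v n x = V (\<sigma> n) x - (\<Sum>i=1..k. rescale s p (r i n) (v i) x)"

text \<open>The artificial scale \<open>r 0 = 1\<close> belongs to the weak limit; separation from it forces
  every bubble scale to tend to \<open>0\<close> or \<open>\<infinity>\<close>.\<close>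

definition decomposition :: "(nat \<Rightarrow> 'a \<Rightarrow> real) \<Rightarrow> real \<Rightarrow> nat \<Rightarrow> (nat \<Rightarrow> nat) \<Rightarrow> (nat \<Rightarrow> nat \<Rightarrow> real) \<Rightarrow> (nat \<Rightarrow> 'a \<Rightarrow>
    real) \<Rightarrow> bool" where
  "decomposition V c k \<sigma> r v \<longleftrightarrow> strict_mono \<sigma> \<and> (\<forall>n. r 0 n = 1) \<and> (\<forall>i\<le>k. \<forall>n. 0 < r i n) \<and>
     (\<forall>i\<in>{1..k}. v i \<in> D \<and> \<not> (AE x in lborel. v i x = 0) \<and> (\<forall>\<phi>\<in>D. GG (v i) \<phi> = 0)) \<and>
     ps_seq (\<lambda>_. 0) (c - (\<Sum>i=1..k. I0 (v i))) (remainder V k \<sigma> r v) \<and>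
     (\<forall>i\<le>k. vanish (r i) (remainder V k \<sigma> r v)) \<and>
     (\<forall>i\<in>{1..k}. r i \<longlonglongrightarrow> 0 \<or> filterlim (r i) at_top sequentially) \<and>
     (\<forall>i\<le>k. \<forall>j\<le>k. i \<noteq> j \<longrightarrow> filterlim (\<lambda>n. \<bar>ln (r i n / r j n)\<bar>) at_top sequentially)"

lemma abs_ln_divide_commute: "0 < a \<Longrightarrow> 0 < b \<Longrightarrow> \<bar>ln (a / b)\<bar> = \<bar>ln (b / a)\<bar>" for a b :: real
  by (simp add: ln_div)

text \<open>A remainder that does not tend to zero contains a further bubble. Vanishing at all
  earlier scales is carried in \<open>decomposition\<close> precisely to separate the new scale from
  them, and it has to be re-established for the new remainder.\<close>

lemma decomposition_extend:
  assumes dec: "decomposition V c k \<sigma> r v" and N: "\<not> (\<lambda>n. NN (remainder V k \<sigma> r v n)) \<longlonglongrightarrow> 0"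
  shows "\<exists>\<sigma>' r' v'. decomposition V c (Suc k) \<sigma>' r' v'"
proof -
  define X where "X = remainder V k \<sigma> r v"
  have \<sigma>: "strict_mono \<sigma>" and r0: "\<And>n. r 0 n = 1" and rpos: "\<And>i n. i \<le> k \<Longrightarrow> 0 < r i n"
    and v: "\<And>i. i \<in> {1..k} \<Longrightarrow> v i \<in> D \<and> \<not> (AE x in lborel. v i x = 0) \<and> (\<forall>\<phi>\<in>D. GG (v i) \<phi> = 0)"
    and X: "ps_seq (\<lambda>_. 0) (c - (\<Sum>i=1..k. I0 (v i))) X" and van: "\<And>i. i \<le> k \<Longrightarrow> vanish (r i) X"
    and lim: "\<And>i. i \<in> {1..k} \<Longrightarrow> r i \<longlonglongrightarrow> 0 \<or> filterlim (r i) at_top sequentially"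
    and sep: "\<And>i j. i \<le> k \<Longrightarrow> j \<le> k \<Longrightarrow> i \<noteq> j \<Longrightarrow> filterlim (\<lambda>n. \<bar>ln (r i n / r j n)\<bar>) at_top sequentially"
    using dec unfolding decomposition_def X_def[symmetric] by blast+
  obtain \<tau> \<rho> w where \<tau>: "strict_mono (\<tau> :: nat \<Rightarrow> nat)" and \<rho>: "\<And>n. 0 < \<rho> n"
      and w: "w \<in> D" "\<not> (AE x in lborel. w x = 0)" "\<And>\<phi>. \<phi> \<in> D \<Longrightarrow> GG w \<phi> = 0"
    and Y: "ps_seq (\<lambda>_. 0) (c - (\<Sum>i=1..k. I0 (v i)) - I0 w) (\<lambda>n x. X (\<tau> n) x - rescale s p (\<rho> n) w x)"
    and vY: "vanish \<rho> (\<lambda>n x. X (\<tau> n) x - rescale s p (\<rho> n) w x)"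
    using bubble_extraction[OF X] N unfolding X_def[symmetric] by blast
  have XD: "X n \<in> D" for n using X by (simp add: ps_seq_def)
  have sep\<rho>: "filterlim (\<lambda>n. \<bar>ln (\<rho> n / r i (\<tau> n))\<bar>) at_top sequentially" if "i \<le> k" for i
    by (rule scales_separate[OF XD \<rho> rpos[OF that] w(1,2) vanish_subseq[OF van[OF that] \<tau>] vY])
  \<comment> \<open>At an old scale the old remainder vanishes by hypothesis and the new bubble
    because its scale has separated.\<close>
  have vold: "vanish (\<lambda>n. r i (\<tau> n)) (\<lambda>n x. X (\<tau> n) x - rescale s p (\<rho> n) w x)" if "i \<le> k" for i
    by (rule vanish_diff[OF XD rescale_invariants(1)[OF \<rho> w(1)] vanish_subseq[OF van[OF that] \<tau>]
          vanish_rescale[OF \<rho> rpos[OF that] w(1) sep\<rho>[OF that]]])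
  have "filterlim (\<lambda>n. \<bar>ln (\<rho> n)\<bar>) at_top sequentially" using sep\<rho>[of 0] by (simp add: r0)
  from abs_ln_at_top_subseq[OF \<rho> this] obtain \<theta> where \<theta>: "strict_mono (\<theta> :: nat \<Rightarrow> nat)"
    and \<theta>lim: "(\<lambda>n. \<rho> (\<theta> n)) \<longlonglongrightarrow> 0 \<or> filterlim (\<lambda>n. \<rho> (\<theta> n)) at_top sequentially" by blast
  define \<sigma>' where "\<sigma>' n = \<sigma> (\<tau> (\<theta> n))" for n
  define r' where "r' i n = (if i = Suc k then \<rho> (\<theta> n) else r i (\<tau> (\<theta> n)))" for i n
  define v' where "v' = v(Suc k := w)"
  have \<tau>\<theta>: "strict_mono (\<lambda>n. \<tau> (\<theta> n))" using strict_mono_o[OF \<tau> \<theta>] by (simp add: o_def)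
  have \<sigma>': "strict_mono \<sigma>'" using strict_mono_o[OF \<sigma> \<tau>\<theta>] by (simp add: o_def \<sigma>'_def[abs_def])
  have r'old: "r' i = (\<lambda>n. r i (\<tau> (\<theta> n)))" if "i \<le> k" for i using that by (auto simp: r'_def)
  have r'new: "r' (Suc k) = (\<lambda>n. \<rho> (\<theta> n))" by (auto simp: r'_def)
  have v'old: "v' i = v i" if "i \<le> k" for i using that by (simp add: v'_def)
  have v'new: "v' (Suc k) = w" by (simp add: v'_def)
  have ssum: "(\<Sum>i=1..Suc k. h i) = (\<Sum>i=1..k. h i) + h (Suc k)" for h :: "nat \<Rightarrow> real" by simp
  have rem: "remainder V (Suc k) \<sigma>' r' v' = (\<lambda>n x. X (\<tau> (\<theta> n)) x - rescale s p (\<rho> (\<theta> n)) w x)"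
  proof (intro ext)
    fix n x
    have "(\<Sum>i=1..k. rescale s p (r' i n) (v' i) x) = (\<Sum>i=1..k. rescale s p (r i (\<tau> (\<theta> n))) (v i) x)"
      by (intro sum.cong) (auto simp: r'old v'old)
    then show "remainder V (Suc k) \<sigma>' r' v' n x = X (\<tau> (\<theta> n)) x - rescale s p (\<rho> (\<theta> n)) w x"
      unfolding remainder_def X_def ssum by (simp add: r'new v'new \<sigma>'_def)
  qed
  have lev: "c - (\<Sum>i=1..Suc k. I0 (v' i)) = c - (\<Sum>i=1..k. I0 (v i)) - I0 w"
  proof -
    have "(\<Sum>i=1..k. I0 (v' i)) = (\<Sum>i=1..k. I0 (v i))" by (intro sum.cong) (auto simp: v'old)
    then show ?thesis unfolding ssum by (simp add: v'new)
  qed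
  have "decomposition V c (Suc k) \<sigma>' r' v'" unfolding decomposition_def
  proof (intro conjI ballI allI impI)
    show "strict_mono \<sigma>'" by fact
    show "r' 0 n = 1" for n by (simp add: r'old r0)
    show "0 < r' i n" if "i \<le> Suc k" for i n using that \<rho> rpos by (cases "i = Suc k") (auto simp: r'_def)
    show "v' i \<in> D" "\<not> (AE x in lborel. v' i x = 0)" if "i \<in> {1..Suc k}" for i
      using that v[of i] w by (cases "i = Suc k"; simp add: v'old v'new)+
    show "GG (v' i) \<phi> = 0" if "i \<in> {1..Suc k}" "\<phi> \<in> D" for i \<phi>
      using that v[of i] w by (cases "i = Suc k") (simp_all add: v'old v'new)
    show "ps_seq (\<lambda>_. 0) (c - (\<Sum>i=1..Suc k. I0 (v' i))) (remainder V (Suc k) \<sigma>' r' v')"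
      unfolding rem lev by (rule ps_seq_subseq[OF Y \<theta>])
    show "vanish (r' i) (remainder V (Suc k) \<sigma>' r' v')" if "i \<le> Suc k" for i
      unfolding rem using that vanish_subseq[OF vY \<theta>] vanish_subseq[OF vold \<theta>, of i]
      by (cases "i = Suc k") (simp_all add: r'old r'new)
    show "r' i \<longlonglongrightarrow> 0 \<or> filterlim (r' i) at_top sequentially" if i: "i \<in> {1..Suc k}" for i
    proof (cases "i = Suc k")
      case False
      then have i': "i \<in> {1..k}" "i \<le> k" using i by auto
      show ?thesis unfolding r'old[OF i'(2)]
        using lim[OF i'(1)] filterlim_compose[OF _ filterlim_subseq[OF \<tau>\<theta>], of "r i"] by blast
    qed (use \<theta>lim in \<open>simp add: r'new\<close>)
    show "filterlim (\<lambda>n. \<bar>ln (r' i n / r' j n)\<bar>) at_top sequentially" if ij: "i \<le> Suc k" "j \<le> Suc k" "i \<noteq> j"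
        for i j
    proof -
      have new: "filterlim (\<lambda>n. \<bar>ln (\<rho> (\<theta> n) / r l (\<tau> (\<theta> n)))\<bar>) at_top sequentially" if "l \<le> k" for l
        using filterlim_compose[OF sep\<rho>[OF that] filterlim_subseq[OF \<theta>]] .
      consider "i = Suc k" "j \<le> k" | "j = Suc k" "i \<le> k" | "i \<le> k" "j \<le> k" using ij by linarith
      then show ?thesis
      proof cases
        case 1
        then show ?thesis using new by (simp add: r'old r'new)
      next
        case 2
        then have "\<bar>ln (r' i n / r' j n)\<bar> = \<bar>ln (\<rho> (\<theta> n) / r i (\<tau> (\<theta> n)))\<bar>" for n
          using abs_ln_divide_commute[OF rpos[OF 2(2)] \<rho>] by (simp add: r'old r'new)
        then show ?thesis using new[OF 2(2)] by simp
      next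
        case 3
        then show ?thesis using filterlim_compose[OF sep[OF 3 ij(3)] filterlim_subseq[OF \<tau>\<theta>]]
            by (simp add: r'old)
      qed
    qed
  qed
  then show ?thesis by blast
qed

lemma global_compactness:
  assumes f: "f \<in> dual" and U: "ps_seq f \<eta> U"
  shows "\<exists>u \<sigma> k r v. u \<in> D \<and> (\<forall>\<phi>\<in>D. GG u \<phi> = f \<phi>)
     \<and> decomposition (\<lambda>n x. U n x - u x) (\<eta> - (I0 u - f u)) k \<sigma> r v
     \<and> (\<lambda>n. NN (remainder (\<lambda>n x. U n x - u x) k \<sigma> r v n)) \<longlonglongrightarrow> 0"
proof -
  have UD: "\<And>n. U n \<in> D" using U by (auto simp: ps_seq_def)
  obtain M where M: "0 < M" "\<And>n. NN (U n) \<le> M" using ps_seq_bounded[OF f U] by blast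
  obtain \<sigma>0 u where \<sigma>0: "strict_mono (\<sigma>0 :: nat \<Rightarrow> nat)" and u: "u \<in> D"
      and ae: "AE x in lborel. (\<lambda>n. U (\<sigma>0 n) x) \<longlonglongrightarrow> u x"
    and lc: "\<And>R. (\<lambda>n. loc R (\<lambda>x. U (\<sigma>0 n) x - u x)) \<longlonglongrightarrow> 0" using rellich[of U, OF UD M(2) M(1)] by blast
  note spl = ps_seq_split[OF f ps_seq_subseq[OF U \<sigma>0] M(1) M(2) u ae]
  define V where "V = (\<lambda>n x. U n x - u x)"
  define c where "c = \<eta> - (I0 u - f u)"
  have rem0: "remainder V 0 \<sigma>0 (\<lambda>_ _. 1) (\<lambda>_ _. 0) = (\<lambda>n x. U (\<sigma>0 n) x - u x)"
    by (intro ext) (simp add: remainder_def V_def)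
  \<comment> \<open>At the artificial scale \<open>1\<close> vanishing is exactly the local
    convergence to the weak limit given by \<open>rellich\<close>.\<close>
  have d0: "decomposition V c 0 \<sigma>0 (\<lambda>_ _. 1) (\<lambda>_ _. 0)"
    unfolding decomposition_def rem0 using \<sigma>0 spl(2) lc by (simp add: c_def vanish_def)
  obtain c0 where c0: "0 < c0" "\<And>v. v \<in> D \<Longrightarrow> (\<forall>\<phi>\<in>D. GG v \<phi> = 0) \<Longrightarrow> \<not> (AE x in lborel. v x = 0) \<Longrightarrow> c0 \<le> I0 v"
    using bubble_energy_lower_bound by blast
  define P where "P k \<longleftrightarrow> (\<exists>\<sigma> r v. decomposition V c k \<sigma> r v)" for k
  \<comment> \<open>The level left for the remainder is nonnegative and every bubble takes at least
    \<open>c0\<close> from \<open>c\<close>, so \<open>c / c0\<close> bounds the number of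
    bubbles.\<close>
  have bound: "k \<le> nat \<lceil>c / c0\<rceil>" if Pk: "P k" for k
  proof -
    obtain \<sigma> r v where dec: "decomposition V c k \<sigma> r v" using Pk by (auto simp: P_def)
    have "0 \<le> c - (\<Sum>i=1..k. I0 (v i))"
      by (rule ps_seq_level_nonneg[of _ "remainder V k \<sigma> r v"]) (use dec in \<open>simp add: decomposition_def\<close>)
    moreover have "real k * c0 = (\<Sum>i=1..k. c0)" by simp
    moreover have "(\<Sum>i=1..k. c0) \<le> (\<Sum>i=1..k. I0 (v i))"
      by (intro sum_mono c0(2)) (use dec in \<open>simp_all add: decomposition_def\<close>)
    ultimately have "real k * c0 \<le> c" by linarith
    then have "real k \<le> c / c0" using c0 by (simp add: field_simps)
    then show ?thesis by linarith
  qed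
  have P0: "P 0" using d0 by (auto simp: P_def)
  obtain k where k: "P k" "\<And>j. P j \<Longrightarrow> j \<le> k"
    using ex_has_greatest_nat[of P 0 id "Suc (nat \<lceil>c / c0\<rceil>)"] P0 bound by (auto simp: less_Suc_eq_le)
  from k(1) obtain \<sigma> r v where dec: "decomposition V c k \<sigma> r v" by (auto simp: P_def)
  have "(\<lambda>n. NN (remainder V k \<sigma> r v n)) \<longlonglongrightarrow> 0"
  proof (rule ccontr)
    assume "\<not> ?thesis"
    from decomposition_extend[OF dec this] have "P (Suc k)" by (simp add: P_def)
    from k(2)[OF this] show False by simp
  qed
  with dec u spl(1) show ?thesis unfolding V_def c_def by blast
qed

end

text \<open>If the admissible constants are unbounded, \<open>Sup\<close> has no meaning, but then some admissible
  constant exceeds \<open>\<mu>\<close> anyway.\<close>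

lemma hardy_const_admissible:
  assumes "\<mu> < hardy_const TYPE('a::euclidean_space) s p"
  shows "\<exists>m>\<mu>. \<forall>u \<in> (Dsp s p :: ('a \<Rightarrow> real) set).
      ennreal m * (\<integral>\<^sup>+ x. ennreal (\<bar>u x\<bar> powr p / norm x powr (s * p)) \<partial>lborel) \<le> gagliardo_energy s p u"
proof -
  define A where "A = {m. 0 \<le> m \<and> (\<forall>u \<in> (Dsp s p :: ('a \<Rightarrow> real) set).
      ennreal m * (\<integral>\<^sup>+ x. ennreal (\<bar>u x\<bar> powr p / norm x powr (s * p)) \<partial>lborel) \<le> gagliardo_energy s p u)}"
  have A0: "0 \<in> A" by (simp add: A_def)
  have "\<exists>m\<in>A. \<mu> < m"
  proof (cases "bdd_above A")
    case True
    have "\<mu> < Sup A" using assms by (simp add: hardy_const_def A_def)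
    then show ?thesis using less_cSupE[of \<mu> A] A0 by blast
  next
    case False
    then show ?thesis by (meson bdd_above.unfold not_le)
  qed
  then show ?thesis by (auto simp: A_def)
qed

theorem theorem1p1:
  fixes s p \<alpha> \<mu> \<eta> :: real
    and f :: "('a::euclidean_space \<Rightarrow> real) \<Rightarrow> real"
    and U :: "nat \<Rightarrow> 'a \<Rightarrow> real"
  assumes "1 < p" and "0 < s" and "s < 1"
    and "0 < \<alpha>" and "\<alpha> < s * p" and "s * p < real DIM('a)"
    and "0 < \<mu>" and "\<mu> < hardy_const TYPE('a) s p"
    and "f \<in> Dsp_dual s p"
    and "palais_smale s p (energy s p \<mu> \<alpha> f) \<eta> U"
  shows "\<exists>\<sigma> :: nat \<Rightarrow> nat. strict_mono \<sigma> \<and>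
    (\<exists>(k :: nat) (r :: nat \<Rightarrow> nat \<Rightarrow> real) (u :: 'a \<Rightarrow> real) (v :: nat \<Rightarrow> 'a \<Rightarrow> real).
       (\<forall>i\<in>{1..k}. \<forall>n. 0 < r i n) \<and>
       weak_solution s p \<mu> \<alpha> f u \<and>
       (\<forall>i\<in>{1..k}. v i \<in> Dsp s p \<and> \<not> (AE x in lborel. v i x = 0) \<and>
          weak_solution s p \<mu> \<alpha> (\<lambda>_. 0) (v i)) \<and>
       (\<exists>w :: nat \<Rightarrow> 'a \<Rightarrow> real.
          (\<forall>n. w n \<in> Dsp s p) \<and> (\<lambda>n. gagliardo s p (w n)) \<longlonglongrightarrow> 0 \<and>
          (\<forall>n x. U (\<sigma> n) x = u x + (\<Sum>i=1..k. rescale s p (r i n) (v i) x) + w n x)) \<and>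
       \<eta> = energy s p \<mu> \<alpha> f u + (\<Sum>i=1..k. energy s p \<mu> \<alpha> (\<lambda>_. 0) (v i)) \<and>
       (\<forall>i\<in>{1..k}. r i \<longlonglongrightarrow> 0 \<or> filterlim (r i) at_top sequentially) \<and>
       (\<forall>i\<in>{1..k}. \<forall>j\<in>{1..k}. i \<noteq> j \<longrightarrow>
          filterlim (\<lambda>n. \<bar>ln (r i n / r j n)\<bar>) at_top sequentially))"
proof -
  \<comment> \<open>Any admissible constant strictly above \<open>\<mu>\<close> serves; the gap
    between the two is what coercivity uses.\<close>
  obtain m where m: "\<mu> < m" "\<And>u :: 'a \<Rightarrow> real. u \<in> Dsp s p \<Longrightarrow>
      ennreal m * (\<integral>\<^sup>+ x. ennreal (\<bar>u x\<bar> powr p / norm x powr (s * p)) \<partial>lborel) \<le> gagliardo_energy s p u"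
    using hardy_const_admissible[OF assms(8)] by blast
  interpret hardy_space s p \<alpha> \<mu> m "TYPE('a)" "real DIM('a)" "crit_exp (real DIM('a)) s p \<alpha>" "crit_exp (real
      DIM('a)) s p 0"
    by unfold_locales (use assms m in auto)
  obtain u \<sigma> k r v where u: "u \<in> D" "\<And>\<phi>. \<phi> \<in> D \<Longrightarrow> GG u \<phi> = f \<phi>"
    and dec: "decomposition (\<lambda>n x. U n x - u x) (\<eta> - (I0 u - f u)) k \<sigma> r v"
    and N: "(\<lambda>n. NN (remainder (\<lambda>n x. U n x - u x) k \<sigma> r v n)) \<longlonglongrightarrow> 0"
    using global_compactness[OF assms(9) palais_smale_imp_ps_seq[OF assms(9,10)]] by blast
  define w where "w = remainder (\<lambda>n x. U n x - u x) k \<sigma> r v"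
  have \<sigma>: "strict_mono \<sigma>" and rpos: "\<And>i n. i \<in> {1..k} \<Longrightarrow> 0 < r i n"
    and v: "\<And>i. i \<in> {1..k} \<Longrightarrow> v i \<in> D \<and> \<not> (AE x in lborel. v i x = 0) \<and> (\<forall>\<phi>\<in>D. GG (v i) \<phi> = 0)"
    and w: "ps_seq (\<lambda>_. 0) (\<eta> - (I0 u - f u) - (\<Sum>i=1..k. I0 (v i))) w"
    and lim: "\<And>i. i \<in> {1..k} \<Longrightarrow> r i \<longlonglongrightarrow> 0 \<or> filterlim (r i) at_top sequentially"
    and sep: "\<And>i j. i \<in> {1..k} \<Longrightarrow> j \<in> {1..k} \<Longrightarrow> i \<noteq> j \<Longrightarrow> filterlim (\<lambda>n. \<bar>ln (r i n / r j n)\<bar>) at_top sequentially"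
    using dec unfolding decomposition_def w_def[symmetric] by simp_all
  have wD: "w n \<in> D" for n using w by (simp add: ps_seq_def)
  have "(\<lambda>n. NN (w n) powr (1 / p)) \<longlonglongrightarrow> 0 powr (1 / p)"
    using N assms(1) unfolding w_def by (intro tendsto_powr' tendsto_const) auto
  then have wlim: "(\<lambda>n. gagliardo s p (w n)) \<longlonglongrightarrow> 0" by (simp add: gagliardo_NN[OF wD])
  \<comment> \<open>The remainder is itself a Palais-Smale sequence at this level and tends to zero,
    so the level is zero; this is the energy identity.\<close>
  have "\<eta> - (I0 u - f u) - (\<Sum>i=1..k. I0 (v i)) = 0" by (rule ps_seq_level_zero[OF w]) (use N w_def in simp)
  moreover have "(\<Sum>i=1..k. energy s p \<mu> \<alpha> (\<lambda>_. 0) (v i)) = (\<Sum>i=1..k. I0 (v i))"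
    using v by (intro sum.cong) (auto simp: energy_eq)
  ultimately have lev: "\<eta> = energy s p \<mu> \<alpha> f u + (\<Sum>i=1..k. energy s p \<mu> \<alpha> (\<lambda>_. 0) (v i))"
    using energy_eq[OF u(1), of f] by simp
  have eq: "\<forall>n x. U (\<sigma> n) x = u x + (\<Sum>i=1..k. rescale s p (r i n) (v i) x) + w n x"
    by (simp add: w_def remainder_def)
  show ?thesis
  proof (rule exI[of _ \<sigma>], rule conjI[OF \<sigma>], rule exI[of _ k], rule exI[of _ r], rule exI[of _ u], rule exI[of
      _ v], intro conjI)
    show "\<exists>w. (\<forall>n. w n \<in> D) \<and> (\<lambda>n. gagliardo s p (w n)) \<longlonglongrightarrow> 0 \<and>
        (\<forall>n x. U (\<sigma> n) x = u x + (\<Sum>i=1..k. rescale s p (r i n) (v i) x) + w n x)"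
      using wD wlim eq by (intro exI[of _ w]) blast
    show "weak_solution s p \<mu> \<alpha> f u" using u by (simp add: weak_solution_iff)
    show "\<forall>i\<in>{1..k}. v i \<in> D \<and> \<not> (AE x in lborel. v i x = 0) \<and> weak_solution s p \<mu> \<alpha> (\<lambda>_. 0) (v i)"
      using v by (simp add: weak_solution_iff)
    show "\<forall>i\<in>{1..k}. r i \<longlonglongrightarrow> 0 \<or> filterlim (r i) at_top sequentially" using lim by blast
    show "\<forall>i\<in>{1..k}. \<forall>j\<in>{1..k}. i \<noteq> j \<longrightarrow> filterlim (\<lambda>n. \<bar>ln (r i n / r j n)\<bar>) at_top sequentially" using sep
        by blast
  qed (use rpos lev in blast)+
qed

end
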